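(* Let $S$ be a $(2,\omega)$-divisible $\mathrm{Cu}$-semigroup satisfying (O5). Then for every $x\in S$ and $k\in\mathbb{N}$ there exists a strongly soft element $y\in S$ such that $ky\leq x\leq\infty y$. In particular, $S$ has an abundance of strongly soft elements. Consequently, if a $C^*$-algebra has the Global Glimm Property, then it has an abundance of soft elements.
   Context: In a partially ordered set in which suprema of increasing sequences exist, $x\ll y$ means that for every increasing sequence $(z_n)_n$ with $y\leq\sup_nz_n$ there is $n$ with $x\leq z_n$. A $\mathrm{Cu}$-semigroup is a commutative monoid $S$ with a translation-invariant partial order in which $0\leq x$ for all $x$, such that: (O1) every increasing sequence has a supremum; (O2) every element is the supremum of a sequence $(x_n)_n$ with $x_n\ll x_{n+1}$ for all $n$; (O3) $x'\ll x$ and $y'\ll y$ imply $x'+y'\ll x+y$; (O4) $\sup_n(x_n+y_n)=\sup_nx_n+\sup_ny_n$ for increasing sequences. We write $\infty y:=\sup_nny$. (O5): given $x',x,y',y,z\in S$ with $x'\ll x$, $y'\ll y$ and $x+y\leq z$, there is $c\in S$ with $x'+c\leq z\leq x+c$ and $y'\ll c$. $S$ is $(2,\omega)$-divisible if for all $x'\ll x$ in $S$ there are $y\in S$ and $n\in\mathbb{N}$ with $2y\leq x$ and $x'\leq ny$. An element $x\in S$ is strongly soft if for every $x'\in S$ with $x'\ll x$ there is $t\in S$ with $x'+t\ll x$ and $x'\ll\infty t$. $S$ has an abundance of strongly soft elements if for all $x',x\in S$ with $x'\ll x$ there is a strongly soft $y\in S$ with $x'\leq\infty y$ and $y\leq x$.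 $C^*$-algebras: $(a-\varepsilon)_+$ is given by functional calculus with $t\mapsto\max(t-\varepsilon,0)$. A $C^*$-algebra $A$ has the Global Glimm Property if for every $a\in A_+$, every $\varepsilon>0$ and every $k\geq2$ there is a $*$-homomorphism $\varphi\colon C_0(0,1]\otimes M_k\to\overline{aAa}$ such that $(a-\varepsilon)_+$ is in the closed two-sided ideal of $A$ generated by the image of $\varphi$. A $C^*$-algebra $B$ is soft if for every proper closed two-sided ideal $I\subseteq B$ the quotient $B/I$ is nonunital; $b\in A_+$ is soft if $\overline{bAb}$ is soft. $A$ has an abundance of soft elements if for every $a\in A_+$ and $\varepsilon>0$ there is a positive, soft element $b\in\overline{aAa}$ such that $(a-\varepsilon)_+$ is in the closed two-sided ideal of $A$ generated by $b$. *)

theory Defs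
  imports "HOL-Analysis.Elementary_Normed_Spaces" "Jordan_Normal_Form.Schur_Decomposition"
begin

section \<open>Cu-semigroups\<close>

context order
begin

definition is_seq_sup :: "(nat \<Rightarrow> 'a) \<Rightarrow> 'a \<Rightarrow> bool" where
  "is_seq_sup z s \<longleftrightarrow> (\<forall>n. z n \<le> s) \<and> (\<forall>u. (\<forall>n. z n \<le> u) \<longrightarrow> s \<le> u)"

text \<open>Only meaningful for sequences that have a supremum; in a Cu-semigroup all increasing ones do.\<close>

definition seq_sup :: "(nat \<Rightarrow> 'a) \<Rightarrow> 'a" where
  "seq_sup z = (THE s. is_seq_sup z s)"

definition increasing :: "(nat \<Rightarrow> 'a) \<Rightarrow> bool" where
  "increasing z \<longleftrightarrow> (\<forall>n. z n \<le> z (Suc n))"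

definition way_below :: "'a \<Rightarrow> 'a \<Rightarrow> bool"  (infix \<open>\<lless>\<close> 50) where
  "x \<lless> y \<longleftrightarrow> (\<forall>z. increasing z \<and> y \<le> seq_sup z \<longrightarrow> (\<exists>n. x \<le> z n))"

end

lemma increasing_iff_incseq: "increasing z \<longleftrightarrow> incseq z"
  by (simp add: increasing_def incseq_Suc_iff)

class cu_semigroup = ordered_comm_monoid_add +
  assumes zero_least: "0 \<le> x"
    and O1: "increasing z \<Longrightarrow> \<exists>s. is_seq_sup z s"
    and O2: "\<exists>z. (\<forall>n. z n \<lless> z (Suc n)) \<and> is_seq_sup z x"
    and O3: "x' \<lless> x \<Longrightarrow> y' \<lless> y \<Longrightarrow> x' + y' \<lless> x + y"
    and O4: "increasing z \<Longrightarrow> increasing w \<Longrightarrow> seq_sup (\<lambda>n. z n + w n) = seq_sup z + seq_sup w"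

definition multiple :: "nat \<Rightarrow> 's::comm_monoid_add \<Rightarrow> 's"  (infixr \<open>\<cdot>\<^sub>N\<close> 75) where
  "n \<cdot>\<^sub>N x = (\<Sum>i<n. x)"

definition infty_times :: "'s::cu_semigroup \<Rightarrow> 's"  (\<open>\<infinity>\<cdot> _\<close> [76] 75) where
  "\<infinity>\<cdot> x = seq_sup (\<lambda>n. n \<cdot>\<^sub>N x)"

definition satisfies_O5 :: "'s::cu_semigroup itself \<Rightarrow> bool" where
  "satisfies_O5 _ \<longleftrightarrow>
    (\<forall>(x'::'s) x y' y z. x' \<lless> x \<and> y' \<lless> y \<and> x + y \<le> z \<longrightarrow>
       (\<exists>c. x' + c \<le> z \<and> z \<le> x + c \<and> y' \<lless> c))"

definition two_omega_divisible :: "'s::cu_semigroup itself \<Rightarrow> bool" where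
  "two_omega_divisible _ \<longleftrightarrow>
    (\<forall>(x'::'s) x. x' \<lless> x \<longrightarrow> (\<exists>y n. 2 \<cdot>\<^sub>N y \<le> x \<and> x' \<le> n \<cdot>\<^sub>N y))"

definition strongly_soft :: "'s::cu_semigroup \<Rightarrow> bool" where
  "strongly_soft x \<longleftrightarrow> (\<forall>x'. x' \<lless> x \<longrightarrow> (\<exists>t. x' + t \<lless> x \<and> x' \<lless> \<infinity>\<cdot> t))"

definition abundance_of_strongly_soft_elements :: "'s::cu_semigroup itself \<Rightarrow> bool" where
  "abundance_of_strongly_soft_elements _ \<longleftrightarrow>
    (\<forall>(x'::'s) x. x' \<lless> x \<longrightarrow> (\<exists>y. strongly_soft y \<and> x' \<le> \<infinity>\<cdot> y \<and> y \<le> x))"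

section \<open>C*-algebras\<close>

text \<open>Not necessarily unital complex C*-algebras. The algebra is the whole type; its C*-subalgebras
  and ideals are subsets of that type.\<close>

class cstar_algebra = real_normed_algebra + banach +
  fixes scaleC :: "complex \<Rightarrow> 'a \<Rightarrow> 'a"  (infixr \<open>*\<^sub>C\<close> 75)
    and adj :: "'a \<Rightarrow> 'a"
  assumes scaleC_add_right: "c *\<^sub>C (x + y) = c *\<^sub>C x + c *\<^sub>C y"
    and scaleC_add_left: "(c + d) *\<^sub>C x = c *\<^sub>C x + d *\<^sub>C x"
    and scaleC_scaleC: "c *\<^sub>C (d *\<^sub>C x) = (c * d) *\<^sub>C x"
    and scaleC_one: "1 *\<^sub>C x = x"
    and scaleR_scaleC: "r *\<^sub>R x = complex_of_real r *\<^sub>C x"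
    and norm_scaleC: "norm (c *\<^sub>C x) = cmod c * norm x"
    and mult_scaleC_left: "(c *\<^sub>C x) * y = c *\<^sub>C (x * y)"
    and mult_scaleC_right: "x * (c *\<^sub>C y) = c *\<^sub>C (x * y)"
    and adj_adj: "adj (adj x) = x"
    and adj_add: "adj (x + y) = adj x + adj y"
    and adj_scaleC: "adj (c *\<^sub>C x) = cnj c *\<^sub>C adj x"
    and adj_mult: "adj (x * y) = adj y * adj x"
    and cstar_identity: "norm (adj x * x) = (norm x)\<^sup>2"

subsection \<open>*-homomorphisms\<close>

text \<open>Algebraic *-algebra data on a carrier, for domains of *-homomorphisms that are not types.
  No norm is recorded, since *-homomorphisms between C*-algebras are algebraically defined.\<close>

record 'x star_algebra =
  sa_carrier :: "'x set"
  sa_add :: "'x \<Rightarrow> 'x \<Rightarrow> 'x"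
  sa_mult :: "'x \<Rightarrow> 'x \<Rightarrow> 'x"
  sa_scale :: "complex \<Rightarrow> 'x \<Rightarrow> 'x"
  sa_star :: "'x \<Rightarrow> 'x"

definition star_hom :: "'x star_algebra \<Rightarrow> 'a::cstar_algebra set \<Rightarrow> ('x \<Rightarrow> 'a) \<Rightarrow> bool" where
  "star_hom D B \<phi> \<longleftrightarrow>
    (\<forall>x\<in>sa_carrier D. \<phi> x \<in> B) \<and>
    (\<forall>x\<in>sa_carrier D. \<forall>y\<in>sa_carrier D. \<phi> (sa_add D x y) = \<phi> x + \<phi> y) \<and>
    (\<forall>x\<in>sa_carrier D. \<forall>y\<in>sa_carrier D. \<phi> (sa_mult D x y) = \<phi> x * \<phi> y) \<and>
    (\<forall>c. \<forall>x\<in>sa_carrier D. \<phi> (sa_scale D c x) = c *\<^sub>C \<phi> x) \<and>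
    (\<forall>x\<in>sa_carrier D. \<phi> (sa_star D x) = adj (\<phi> x))"

text \<open>Continuous functions on \<open>X\<close> vanishing at infinity, represented by their extension by zero
  to the ambient type (which need not be continuous there).\<close>

definition C0_functions :: "'t::topological_space set \<Rightarrow> ('t \<Rightarrow> complex) set" where
  "C0_functions X = {f. continuous_on X f \<and> (\<forall>e>0. compact {t\<in>X. e \<le> cmod (f t)}) \<and> (\<forall>t. t \<notin> X \<longrightarrow> f t = 0)}"

definition C0 :: "'t::topological_space set \<Rightarrow> ('t \<Rightarrow> complex) star_algebra" where
  "C0 X = \<lparr>sa_carrier = C0_functions X,
     sa_add = (\<lambda>f g t. f t + g t),
     sa_mult = (\<lambda>f g t. f t * g t),
     sa_scale = (\<lambda>c f t. c * f t),
     sa_star = (\<lambda>f t. cnj (f t))\<rparr>"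

text \<open>The tensor product of \<open>C0 X\<close> with the \<open>k \<times> k\<close> matrices, as matrix-valued functions all of whose
  entries lie in \<open>C0 X\<close>. As the matrix algebra is finite-dimensional, the algebraic tensor product is
  already complete; \<open>elem_tensor\<close> below gives the identification.\<close>

definition C0_tensor_M :: "'t::topological_space set \<Rightarrow> nat \<Rightarrow> ('t \<Rightarrow> complex mat) star_algebra" where
  "C0_tensor_M X k = \<lparr>
     sa_carrier = {F. (\<forall>t. F t \<in> carrier_mat k k) \<and> (\<forall>i<k. \<forall>j<k. (\<lambda>t. F t $$ (i, j)) \<in> C0_functions X)},
     sa_add = (\<lambda>F G t. F t + G t),
     sa_mult = (\<lambda>F G t. F t * G t),
     sa_scale = (\<lambda>c F t. c \<cdot>\<^sub>m F t),
     sa_star = (\<lambda>F t. mat_adjoint (F t))\<rparr>"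

definition elem_tensor :: "('t \<Rightarrow> complex) \<Rightarrow> complex mat \<Rightarrow> 't \<Rightarrow> complex mat" where
  "elem_tensor f m = (\<lambda>t. f t \<cdot>\<^sub>m m)"

lemma C0_functions_mult_const:
  assumes "f \<in> C0_functions X"
  shows "(\<lambda>t. f t * c) \<in> C0_functions X"
proof (cases "c = 0")
  case True
  then show ?thesis by (auto simp: C0_functions_def)
next
  case False
  have "{t\<in>X. e \<le> cmod (f t * c)} = {t\<in>X. e / cmod c \<le> cmod (f t)}" for e
    using False by (auto simp: norm_mult field_simps)
  then show ?thesis
    using assms False by (auto simp: C0_functions_def intro!: continuous_intros)
qed

lemma elem_tensor_in_carrier:
  assumes "f \<in> C0_functions X" "m \<in> carrier_mat k k"
  shows "elem_tensor f m \<in> sa_carrier (C0_tensor_M X k)"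
  using assms C0_functions_mult_const[OF assms(1)] by (auto simp: C0_tensor_M_def elem_tensor_def)

lemma elem_tensor_mult:
  assumes "m \<in> carrier_mat k k" "n \<in> carrier_mat k k"
  shows "sa_mult (C0_tensor_M X k) (elem_tensor f m) (elem_tensor g n) =
    elem_tensor (\<lambda>t. f t * g t) (m * n)"
  using assms
  by (auto simp: C0_tensor_M_def elem_tensor_def fun_eq_iff mult_smult_distrib mult_smult_assoc_mat)

lemma elem_tensor_star:
  assumes "m \<in> carrier_mat k k"
  shows "sa_star (C0_tensor_M X k) (elem_tensor f m) = elem_tensor (\<lambda>t. cnj (f t)) (mat_adjoint m)"
  using assms
  by (auto simp: C0_tensor_M_def elem_tensor_def mat_adjoint_def fun_eq_iff mat_of_rows_def intro!: eq_matI)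

text \<open>Every element is a sum of elementary tensors with matrix units, with unique coefficients.\<close>

lemma elem_tensor_decomposition:
  assumes "F \<in> sa_carrier (C0_tensor_M X k)" "i < k" "j < k"
  shows "F t $$ (i, j) =
    (\<Sum>p<k. \<Sum>q<k. elem_tensor (\<lambda>t. F t $$ (p, q)) (mat k k (\<lambda>r. if r = (p, q) then 1 else 0)) t $$ (i, j))"
proof -
  have "(\<Sum>p<k. \<Sum>q<k. elem_tensor (\<lambda>t. F t $$ (p, q)) (mat k k (\<lambda>r. if r = (p, q) then 1 else 0)) t $$ (i, j))
      = (\<Sum>p<k. \<Sum>q<k. if q = j then (if p = i then F t $$ (p, q) else 0) else 0)"
    using assms(2,3) by (intro sum.cong) (auto simp: elem_tensor_def)
  also have "\<dots> = F t $$ (i, j)"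
    using assms(2,3) by (simp add: sum.delta)
  finally show ?thesis by simp
qed

subsection \<open>Spectrum, positivity and functional calculus\<close>

text \<open>Multiplication of the minimal unitization, where \<open>(x, c)\<close> stands for \<open>x + c1\<close>.\<close>

definition unitization_mult :: "'a::cstar_algebra \<times> complex \<Rightarrow> 'a \<times> complex \<Rightarrow> 'a \<times> complex" where
  "unitization_mult u v =
    (fst u * fst v + snd v *\<^sub>C fst u + snd u *\<^sub>C fst v, snd u * snd v)"

text \<open>The spectrum is always taken in the unitization, so it contains 0 even if the algebra is unital.
  This affects neither positivity nor the calculus with functions vanishing at 0.\<close>

definition spectrum :: "'a::cstar_algebra \<Rightarrow> complex set" where
  "spectrum a = {l. \<not> (\<exists>v. unitization_mult (a, - l) v = (0, 1) \<and> unitization_mult v (a, - l) = (0, 1))}"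

definition positive :: "'a::cstar_algebra \<Rightarrow> bool" where
  "positive a \<longleftrightarrow> adj a = a \<and> spectrum a \<subseteq> complex_of_real ` {0..}"

definition restrict_zero :: "'t set \<Rightarrow> ('t \<Rightarrow> complex) \<Rightarrow> 't \<Rightarrow> complex" where
  "restrict_zero X f = (\<lambda>t. if t \<in> X then f t else 0)"

text \<open>For normal \<open>a\<close> and continuous \<open>f\<close> with \<open>f 0 = 0\<close>: the value at \<open>f\<close> of the unique
  *-homomorphism on \<open>C0 (spectrum a - {0})\<close> that maps the identity function to \<open>a\<close>.\<close>

definition functional_calculus :: "'a::cstar_algebra \<Rightarrow> (complex \<Rightarrow> complex) \<Rightarrow> 'a" where
  "functional_calculus a f = (THE b. \<exists>\<Phi>. star_hom (C0 (spectrum a - {0})) UNIV \<Phi> \<and>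
     \<Phi> (restrict_zero (spectrum a - {0}) (\<lambda>z. z)) = a \<and>
     \<Phi> (restrict_zero (spectrum a - {0}) f) = b)"

definition cut_down :: "'a::cstar_algebra \<Rightarrow> real \<Rightarrow> 'a" where
  "cut_down a \<epsilon> = functional_calculus a (\<lambda>z. complex_of_real (max (Re z - \<epsilon>) 0))"

subsection \<open>Hereditary subalgebras, ideals and quotients\<close>

definition hereditary :: "'a::cstar_algebra \<Rightarrow> 'a set" where
  "hereditary a = closure {a * x * a | x. True}"

definition closed_ideal :: "'a::cstar_algebra set \<Rightarrow> 'a set \<Rightarrow> bool" where
  "closed_ideal B I \<longleftrightarrow> I \<subseteq> B \<and> closed I \<and> 0 \<in> I \<and>
    (\<forall>x\<in>I. \<forall>y\<in>I. x + y \<in> I) \<and> (\<forall>c. \<forall>x\<in>I. c *\<^sub>C x \<in> I) \<and>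
    (\<forall>b\<in>B. \<forall>x\<in>I. b * x \<in> I \<and> x * b \<in> I)"

definition ideal_generated :: "'a::cstar_algebra set \<Rightarrow> 'a set" where
  "ideal_generated X = closed_ideal UNIV hull X"

definition coset :: "'a::cstar_algebra set \<Rightarrow> 'a \<Rightarrow> 'a set" where
  "coset I x = (\<lambda>y. x + y) ` I"

definition quotient_carrier :: "'a::cstar_algebra set \<Rightarrow> 'a set \<Rightarrow> 'a set set" where
  "quotient_carrier B I = coset I ` B"

definition quotient_mult :: "'a::cstar_algebra set \<Rightarrow> 'a set \<Rightarrow> 'a set \<Rightarrow> 'a set" where
  "quotient_mult I X Y = (\<Union>x\<in>X. \<Union>y\<in>Y. coset I (x * y))"

definition quotient_unital :: "'a::cstar_algebra set \<Rightarrow> 'a set \<Rightarrow> bool" where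
  "quotient_unital B I \<longleftrightarrow>
    (\<exists>E\<in>quotient_carrier B I. \<forall>X\<in>quotient_carrier B I. quotient_mult I E X = X \<and> quotient_mult I X E = X)"

subsection \<open>The Global Glimm Property and softness\<close>

definition global_glimm_property :: "'a::cstar_algebra itself \<Rightarrow> bool" where
  "global_glimm_property _ \<longleftrightarrow>
    (\<forall>(a::'a) \<epsilon> k. positive a \<and> \<epsilon> > 0 \<and> k \<ge> 2 \<longrightarrow>
      (\<exists>\<phi>. star_hom (C0_tensor_M {0<..1::real} k) (hereditary a) \<phi> \<and>
         cut_down a \<epsilon> \<in> ideal_generated (\<phi> ` sa_carrier (C0_tensor_M {0<..1} k))))"

definition soft_algebra :: "'a::cstar_algebra set \<Rightarrow> bool" where
  "soft_algebra B \<longleftrightarrow> (\<forall>I. closed_ideal B I \<and> I \<noteq> B \<longrightarrow> \<not> quotient_unital B I)"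

definition soft_element :: "'a::cstar_algebra \<Rightarrow> bool" where
  "soft_element b \<longleftrightarrow> positive b \<and> soft_algebra (hereditary b)"

definition abundance_of_soft_elements :: "'a::cstar_algebra itself \<Rightarrow> bool" where
  "abundance_of_soft_elements _ \<longleftrightarrow>
    (\<forall>(a::'a) \<epsilon>. positive a \<and> \<epsilon> > 0 \<longrightarrow>
      (\<exists>b. b \<in> hereditary a \<and> soft_element b \<and> cut_down a \<epsilon> \<in> ideal_generated {b}))"

end

theory Submission
  imports Defs "HOL-Analysis.Continuous_Extension" "HOL-Analysis.Weierstrass_Theorems"
    "HOL-Library.Nat_Bijection"
begin

text \<open>A divisor \<open>y\<close> of a remainder \<open>r\<close> is split off with (O5) so that the new remainder \<open>c\<close> still
  satisfies \<open>r \<le> \<infinity>c\<close>. Iterating gives a series whose tails all generate the same ideal as \<open>x\<close>,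
  and such a series is strongly soft.

  The C*-algebraic half needs no Cuntz semigroup and no functional calculus of general elements, as
  all positive elements that occur are images of the generator of the cone under *-homomorphisms. The
  Global Glimm Property provides two orthogonal copies of the cone; one copy is kept, and the property
  is applied again to the other one. This gives orthogonal elements \<open>b i\<close>, each lying in the ideals
  generated by infinitely many of the others. If \<open>b = \<Sum>i. 2\<^sup>-\<^sup>i b i\<close> were invertible in a quotient of
  \<open>bAb\<close>, then almost all \<open>b i\<close>, hence all of them, would vanish there, so \<open>b\<close> is soft.\<close>

section \<open>Cu-semigroups\<close>

text \<open>The Global Glimm Property controls only \<open>cut_down a \<epsilon>\<close>, never
  \<open>a\<close>, so each use loses a little near 0. Between two stages the loss is bridged by a
  compactness argument: the ideal of a positive element is the closure of an increasing union of the
  ideals of its cut-downs, and an element within distance \<eta> of an ideal has its cut-down by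
  \<eta> in that ideal. Hence every stage carries a threshold \<delta> along with its copy of the
  cone.

  The bridge needs functions of the element to be reached. They are available for generators of
  cones, but not for the given \<open>a\<close>, so the outermost copy of the cone must be recovered
  without any loss. This is why it is chopped into countably many bumps, with one sequence
  constructed below each: a single bump may lose a neighbourhood of its zeros, as the others make up
  for it. Such bumps overlap and are not all orthogonal, but neighbours can be put into different
  diagonal corners of the 2 by 2 matrices.\<close>

context order
begin

lemma seq_sup_eqI:
  assumes "is_seq_sup z s"
  shows "seq_sup z = s"
  unfolding seq_sup_def
proof (rule the_equality)
  show "is_seq_sup z s" by (fact assms)
  show "u = s" if "is_seq_sup z u" for u
    using that assms unfolding is_seq_sup_def by (intro order.antisym) auto
qed

lemma way_below_le_trans: "x \<lless> y \<Longrightarrow> y \<le> z \<Longrightarrow> x \<lless> z"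
  unfolding way_below_def by (meson order_trans)

lemma le_way_below_trans: "x \<le> y \<Longrightarrow> y \<lless> z \<Longrightarrow> x \<lless> z"
  unfolding way_below_def by (meson order_trans)

lemma way_below_imp_le:
  assumes "x \<lless> y"
  shows "x \<le> y"
proof -
  have "seq_sup (\<lambda>_. y) = y"
    by (rule seq_sup_eqI) (auto simp: is_seq_sup_def)
  then show ?thesis
    using assms unfolding way_below_def increasing_def by (metis order_refl)
qed

end

context cu_semigroup
begin

lemma is_seq_sup_seq_sup: "increasing z \<Longrightarrow> is_seq_sup z (seq_sup z)"
  using O1 seq_sup_eqI by blast

lemma le_seq_sup: "increasing z \<Longrightarrow> z n \<le> seq_sup z"
  using is_seq_sup_seq_sup unfolding is_seq_sup_def by blast

lemma seq_sup_le: "increasing z \<Longrightarrow> (\<And>n. z n \<le> u) \<Longrightarrow> seq_sup z \<le> u"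
  using is_seq_sup_seq_sup unfolding is_seq_sup_def by blast

lemma zero_way_below: "0 \<lless> x"
  using zero_least unfolding way_below_def by blast

lemma O2_obtain:
  obtains z where "\<And>n. z n \<lless> z (Suc n)" "increasing z" "seq_sup z = x" "\<And>n. z n \<lless> x"
proof -
  obtain z where z: "\<And>n. z n \<lless> z (Suc n)" "is_seq_sup z x"
    using O2 by blast
  show ?thesis
  proof (rule that)
    show "z n \<lless> z (Suc n)" for n by (rule z)
    show "increasing z" using z(1) way_below_imp_le unfolding increasing_def by blast
    show "seq_sup z = x" using z(2) by (rule seq_sup_eqI)
    show "z n \<lless> x" for n
      using z way_below_le_trans unfolding is_seq_sup_def by blast
  qed
qed

text \<open>An approximating sequence of \<open>y\<close> has a member above \<open>x\<close>; the
  next member is the interpolant.\<close>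

lemma way_below_interpolate:
  assumes "x \<lless> y"
  obtains z where "x \<lless> z" "z \<lless> y"
proof -
  obtain z where z: "\<And>n. z n \<lless> z (Suc n)" "increasing z" "seq_sup z = y" "\<And>n. z n \<lless> y"
    using O2_obtain[of y] by blast
  then obtain n where "x \<le> z n"
    using assms unfolding way_below_def by blast
  then show ?thesis
    using that z(1,4) le_way_below_trans by blast
qed

text \<open>Interpolation upgrades the \<open>\<le>\<close> that the definition of
  \<open>\<lless>\<close> provides to \<open>\<lless>\<close>.\<close>

lemma way_below_seq_sup:
  assumes "increasing z" "x \<lless> seq_sup z"
  obtains n where "x \<lless> z n"
proof -
  obtain y where y: "x \<lless> y" "y \<lless> seq_sup z"
    using assms(2) by (rule way_below_interpolate)
  obtain n where "y \<le> z n"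
    using y(2) assms(1) unfolding way_below_def by blast
  then show ?thesis
    using that y(1) way_below_le_trans by blast
qed

end

section \<open>Finite and infinite multiples\<close>

lemma multiple_0 [simp]: "0 \<cdot>\<^sub>N x = 0"
  by (simp add: multiple_def)

lemma multiple_Suc [simp]: "Suc n \<cdot>\<^sub>N x = n \<cdot>\<^sub>N x + x"
  by (simp add: multiple_def)

lemma multiple_add: "(m + n) \<cdot>\<^sub>N x = m \<cdot>\<^sub>N x + n \<cdot>\<^sub>N x"
  by (induction n) (simp_all add: add.assoc)

lemma multiple_mult: "(m * n) \<cdot>\<^sub>N x = m \<cdot>\<^sub>N (n \<cdot>\<^sub>N x)"
  by (induction m) (simp_all add: multiple_add add.commute)

lemma multiple_add_right: "n \<cdot>\<^sub>N (x + y) = n \<cdot>\<^sub>N x + n \<cdot>\<^sub>N y"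
  unfolding multiple_def by (rule sum.distrib)

lemma multiple_mono: "x \<le> y \<Longrightarrow> n \<cdot>\<^sub>N x \<le> n \<cdot>\<^sub>N (y::'s::cu_semigroup)"
  unfolding multiple_def by (rule sum_mono)

lemma le_add_cu: "(x::'s::cu_semigroup) \<le> x + y" "x \<le> y + x"
  using add_left_mono[OF zero_least, of x y] by (simp_all add: add.commute)

lemma multiple_mono_left:
  assumes "m \<le> n"
  shows "m \<cdot>\<^sub>N x \<le> n \<cdot>\<^sub>N (x::'s::cu_semigroup)"
  using multiple_add[of m "n - m" x] le_add_cu(1) assms by auto

lemma increasing_multiple: "increasing (\<lambda>n. n \<cdot>\<^sub>N (x::'s::cu_semigroup))"
  unfolding increasing_def by (simp add: le_add_cu)

lemma multiple_le_infty: "n \<cdot>\<^sub>N x \<le> \<infinity>\<cdot> x"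
  unfolding infty_times_def using le_seq_sup[OF increasing_multiple] .

lemma le_infty: "x \<le> \<infinity>\<cdot> x"
  using multiple_le_infty[of 1 x] by simp

text \<open>By (O4) the sum is the supremum of the multiples
  \<open>(n + n) \<cdot>\<^sub>N x\<close>.\<close>

lemma infty_plus_infty: "\<infinity>\<cdot> x + \<infinity>\<cdot> x = \<infinity>\<cdot> x"
proof (rule order.antisym)
  have "increasing (\<lambda>n. n \<cdot>\<^sub>N x + n \<cdot>\<^sub>N x)"
    using increasing_multiple[of x] unfolding increasing_def by (meson add_mono)
  then have "seq_sup (\<lambda>n. n \<cdot>\<^sub>N x + n \<cdot>\<^sub>N x) \<le> \<infinity>\<cdot> x"
    by (rule seq_sup_le) (simp add: multiple_le_infty flip: multiple_add)
  then show "\<infinity>\<cdot> x + \<infinity>\<cdot> x \<le> \<infinity>\<cdot> x"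
    unfolding infty_times_def using O4[OF increasing_multiple increasing_multiple] by metis
qed (rule le_add_cu)

lemma multiple_infty_le: "n \<cdot>\<^sub>N (\<infinity>\<cdot> x) \<le> \<infinity>\<cdot> x"
proof (induction n)
  case (Suc n)
  have "n \<cdot>\<^sub>N (\<infinity>\<cdot> x) + \<infinity>\<cdot> x \<le> \<infinity>\<cdot> x + \<infinity>\<cdot> x"
    using Suc by (rule add_right_mono)
  then show ?case by (simp add: infty_plus_infty)
qed (simp add: zero_least)

lemma infty_le:
  assumes "x \<le> \<infinity>\<cdot> y"
  shows "\<infinity>\<cdot> x \<le> \<infinity>\<cdot> y"
  unfolding infty_times_def[of x]
  by (rule seq_sup_le[OF increasing_multiple order_trans[OF multiple_mono[OF assms] multiple_infty_le]])

lemma infty_mono: "x \<le> y \<Longrightarrow> \<infinity>\<cdot> x \<le> \<infinity>\<cdot> y"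
  using infty_le le_infty by (meson order_trans)

lemma way_below_multiple: "x \<lless> y \<Longrightarrow> n \<cdot>\<^sub>N x \<lless> n \<cdot>\<^sub>N (y::'s::cu_semigroup)"
  by (induction n) (simp_all add: zero_way_below O3)

lemma increasing_multiple_seq: "increasing z \<Longrightarrow> increasing (\<lambda>i. n \<cdot>\<^sub>N (z i :: 's::cu_semigroup))"
  unfolding increasing_def using multiple_mono by blast

lemma multiple_seq_sup:
  assumes "increasing z"
  shows "n \<cdot>\<^sub>N seq_sup z = seq_sup (\<lambda>i. n \<cdot>\<^sub>N (z i :: 's::cu_semigroup))"
proof (induction n)
  case 0
  have "is_seq_sup (\<lambda>i. 0) (0::'s)" by (auto simp: is_seq_sup_def)
  then show ?case by (simp add: seq_sup_eqI)
next
  case (Suc n)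
  then show ?case
    using O4[OF increasing_multiple_seq[OF assms] assms] by simp
qed

text \<open>Two compactness steps: finitely many copies of \<open>y\<close> suffice, and then, since
  multiples commute with suprema, copies of a member of an approximating sequence of
  \<open>y\<close>. The gap \<open>y' \<lless> y\<close> is what divisibility, (O5) and (O3) consume
  later.\<close>

lemma way_below_infty:
  fixes x y :: "'s::cu_semigroup"
  assumes "x \<lless> \<infinity>\<cdot> y"
  obtains n y' where "y' \<lless> y" "x \<lless> n \<cdot>\<^sub>N y'"
proof -
  obtain n where n: "x \<lless> n \<cdot>\<^sub>N y"
    using assms way_below_seq_sup[OF increasing_multiple] unfolding infty_times_def by blast
  obtain z where z: "increasing z" "seq_sup z = y" "\<And>n. z n \<lless> y"
    using O2_obtain by blast
  obtain i where "x \<lless> n \<cdot>\<^sub>N z i"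
    using n multiple_seq_sup[OF z(1), of n] z(2) way_below_seq_sup[OF increasing_multiple_seq[OF z(1)]]
    by metis
  then show ?thesis using that z(3) by blast
qed

text \<open>Induction on \<open>j\<close>: halve \<open>x\<close>, then divide the half.
  Interpolating first keeps room, because halving only yields
  \<open>w \<le> n \<cdot>\<^sub>N y\<close>, while the induction hypothesis asks for an element way
  below \<open>y\<close>.\<close>

lemma divisible_power2:
  fixes x' x :: "'s::cu_semigroup"
  assumes div: "two_omega_divisible TYPE('s)" and "x' \<lless> x"
  shows "\<exists>y n. (2 ^ j) \<cdot>\<^sub>N y \<le> x \<and> x' \<le> n \<cdot>\<^sub>N y"
  using assms(2)
proof (induction j arbitrary: x' x)
  case 0
  have "(2 ^ 0) \<cdot>\<^sub>N x \<le> x \<and> x' \<le> 1 \<cdot>\<^sub>N x"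
    using 0 way_below_imp_le by (simp add: multiple_def)
  then show ?case by blast
next
  case (Suc j)
  obtain w where w: "x' \<lless> w" "w \<lless> x"
    using Suc.prems by (rule way_below_interpolate)
  obtain y n where y: "2 \<cdot>\<^sub>N y \<le> x" "w \<le> n \<cdot>\<^sub>N y"
    using div w(2) unfolding two_omega_divisible_def by blast
  have "x' \<lless> \<infinity>\<cdot> y"
    using w(1) y(2) multiple_le_infty way_below_le_trans by (meson order_trans)
  then obtain m y' where y': "y' \<lless> y" "x' \<lless> m \<cdot>\<^sub>N y'"
    by (rule way_below_infty)
  obtain v l where v: "(2 ^ j) \<cdot>\<^sub>N v \<le> y" "y' \<le> l \<cdot>\<^sub>N v"
    using Suc.IH[OF y'(1)] by blast
  have "(2 ^ Suc j) \<cdot>\<^sub>N v \<le> 2 \<cdot>\<^sub>N y"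
    using multiple_mono[OF v(1), of 2] by (simp only: power_Suc multiple_mult)
  moreover have "x' \<le> (m * l) \<cdot>\<^sub>N v"
    using way_below_imp_le[OF y'(2)] multiple_mono[OF v(2), of m]
    by (simp add: multiple_mult)
  ultimately show ?case using y(1) by (meson order_trans)
qed

lemma divisible:
  fixes x' x :: "'s::cu_semigroup"
  assumes "two_omega_divisible TYPE('s)" and "x' \<lless> x"
  obtains y n where "k \<cdot>\<^sub>N y \<le> x" "x' \<le> n \<cdot>\<^sub>N y"
proof -
  have "k \<le> 2 ^ k" by (simp add: less_imp_le)
  then show ?thesis
    using divisible_power2[OF assms, of k] multiple_mono_left[of k "2 ^ k"] that
    by (meson order_trans)
qed

text \<open>(O5) is applied to \<open>k y \<lless> k y''\<close> for a \<open>(k + 1)\<close>-fold divisor \<open>y0\<close> and \<open>y \<lless> y'' \<lless> y0\<close>: the spare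
  copy of \<open>y0\<close> gives \<open>y'' \<lless> c\<close>, so \<open>r \<le> k y'' + c \<le> (k + 1) c\<close> and the remainder loses no ideal.\<close>

lemma split_off_divisor:
  fixes w r :: "'s::cu_semigroup"
  assumes div: "two_omega_divisible TYPE('s)" and O5: "satisfies_O5 TYPE('s)" and "w \<lless> \<infinity>\<cdot> r"
  obtains y c where "k \<cdot>\<^sub>N y + c \<le> r" "r \<le> \<infinity>\<cdot> c" "w \<le> \<infinity>\<cdot> y"
proof -
  obtain n r' where r': "r' \<lless> r" "w \<lless> n \<cdot>\<^sub>N r'"
    using assms(3) by (rule way_below_infty)
  obtain y0 m where y0: "Suc k \<cdot>\<^sub>N y0 \<le> r" "r' \<le> m \<cdot>\<^sub>N y0"
    using div r'(1) by (rule divisible)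
  have "n \<cdot>\<^sub>N r' \<le> \<infinity>\<cdot> y0"
    using multiple_mono[OF y0(2), of n] multiple_le_infty[of "n * m" y0]
    by (simp add: multiple_mult)
  then have "w \<lless> \<infinity>\<cdot> y0"
    using r'(2) way_below_le_trans by blast
  then obtain l y where y: "y \<lless> y0" "w \<lless> l \<cdot>\<^sub>N y"
    by (rule way_below_infty)
  obtain y'' where y'': "y \<lless> y''" "y'' \<lless> y0"
    using y(1) by (rule way_below_interpolate)
  have "k \<cdot>\<^sub>N y'' + y0 \<le> r"
    using y0(1) multiple_mono[OF way_below_imp_le[OF y''(2)], of k]
    by (auto intro: order_trans add_right_mono)
  then obtain c where c: "k \<cdot>\<^sub>N y + c \<le> r" "r \<le> k \<cdot>\<^sub>N y'' + c" "y'' \<lless> c"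
    using O5 way_below_multiple[OF y''(1), of k] y''(2) unfolding satisfies_O5_def by blast
  have "k \<cdot>\<^sub>N y'' + c \<le> Suc k \<cdot>\<^sub>N c"
    using multiple_mono[OF way_below_imp_le[OF c(3)], of k] by (simp add: add_right_mono)
  then have "r \<le> \<infinity>\<cdot> c"
    using c(2) multiple_le_infty by (meson order_trans)
  then show ?thesis
    using that c(1) y(2) way_below_imp_le multiple_le_infty by (meson order_trans)
qed

section \<open>Suprema of series and strong softness\<close>

definition series_sup :: "(nat \<Rightarrow> 's::cu_semigroup) \<Rightarrow> 's" where
  "series_sup y = seq_sup (\<lambda>n. \<Sum>i<n. y i)"

lemma increasing_partial_sums: "increasing (\<lambda>n. \<Sum>i<n. (y i :: 's::cu_semigroup))"
  unfolding increasing_def by (simp add: le_add_cu)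

text \<open>(O4) with a constant sequence as first summand; dropping finitely many partial sums does
  not change the supremum.\<close>

lemma series_sup_split: "series_sup y = (\<Sum>i<N. y i) + series_sup (\<lambda>i. y (N + i))"
proof -
  have const: "increasing (\<lambda>n. \<Sum>i<N. y i)" "seq_sup (\<lambda>n. \<Sum>i<N. y i) = (\<Sum>i<N. y i)"
    by (auto simp: increasing_def is_seq_sup_def intro!: seq_sup_eqI)
  have "is_seq_sup (\<lambda>n. \<Sum>i<N + n. y i) (series_sup y)"
    unfolding is_seq_sup_def series_sup_def
  proof (intro conjI allI impI)
    show "(\<Sum>i<N + n. y i) \<le> seq_sup (\<lambda>n. \<Sum>i<n. y i)" for n
      using le_seq_sup[OF increasing_partial_sums] .
    fix u assume u: "\<forall>n. (\<Sum>i<N + n. y i) \<le> u"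
    have "(\<Sum>i<n. y i) \<le> (\<Sum>i<N + n. y i)" for n
      by (intro sum_mono2) (auto simp: zero_least)
    then have "(\<Sum>i<n. y i) \<le> u" for n
      using u by (meson order_trans)
    then show "seq_sup (\<lambda>n. \<Sum>i<n. y i) \<le> u"
      by (rule seq_sup_le[OF increasing_partial_sums])
  qed
  moreover have "(\<Sum>i<N + n. y i) = (\<Sum>i<N. y i) + (\<Sum>i<n. y (N + i))" for n
    by (induction n) (simp_all add: add.assoc)
  ultimately have "series_sup y = seq_sup (\<lambda>n. (\<Sum>i<N. y i) + (\<Sum>i<n. y (N + i)))"
    by (simp add: seq_sup_eqI)
  then show ?thesis
    using O4[OF const(1) increasing_partial_sums] const(2) by (simp add: series_sup_def)
qed

text \<open>An element way below the sum is already way below a partial sum, so it uses up only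
  finitely many terms. A multiple of some \<open>t\<close> way below the remaining tail still
  dominates it, and (O3) adds the two relations up.\<close>

lemma strongly_soft_series:
  fixes y :: "nat \<Rightarrow> 's::cu_semigroup"
  assumes "\<And>N. series_sup y \<le> \<infinity>\<cdot> series_sup (\<lambda>i. y (N + i))"
  shows "strongly_soft (series_sup y)"
  unfolding strongly_soft_def
proof (intro allI impI)
  fix y' assume "y' \<lless> series_sup y"
  then obtain N where N: "y' \<lless> (\<Sum>i<N. y i)"
    unfolding series_sup_def using way_below_seq_sup[OF increasing_partial_sums] by blast
  define v where "v = series_sup (\<lambda>i. y (N + i))"
  have "(\<Sum>i<N. y i) \<le> series_sup y"
    unfolding series_sup_def using le_seq_sup[OF increasing_partial_sums] .
  then have "y' \<lless> \<infinity>\<cdot> v"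
    using N assms[of N] way_below_le_trans unfolding v_def by (meson order_trans)
  then obtain n t where t: "t \<lless> v" "y' \<lless> n \<cdot>\<^sub>N t"
    by (rule way_below_infty)
  have "y' + t \<lless> series_sup y"
    unfolding series_sup_split[of y N] using O3[OF N t(1)] by (simp add: v_def)
  moreover have "y' \<lless> \<infinity>\<cdot> t"
    using t(2) multiple_le_infty way_below_le_trans by blast
  ultimately show "\<exists>t. y' + t \<lless> series_sup y \<and> y' \<lless> \<infinity>\<cdot> t" by blast
qed

text \<open>An arbitrary \<open>x\<close> is reached through its approximants: stage
  \<open>n\<close> splits off a divisor whose infinite multiple dominates \<open>z n\<close>. As
  \<open>z\<close> is increasing, every tail of the series then dominates all of \<open>z\<close> in
  this sense.\<close>

lemma strongly_soft_full_divisor: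
  fixes x :: "'s::cu_semigroup"
  assumes div: "two_omega_divisible TYPE('s)" and O5: "satisfies_O5 TYPE('s)"
  obtains y where "strongly_soft y" "k \<cdot>\<^sub>N y \<le> x" "x \<le> \<infinity>\<cdot> y"
proof -
  obtain z where z: "increasing z" "seq_sup z = x" "\<And>n. z n \<lless> x"
    using O2_obtain by blast
  \<comment> \<open>\<open>p n\<close> pairs the current remainder with the divisor split off last;
    at index 0 the second component is a placeholder. Splitting off \<open>Suc k\<close> copies
    instead of \<open>k\<close> ensures \<open>v \<le> x\<close> also for
    \<open>k = 0\<close>.\<close>
  have "\<exists>p :: nat \<Rightarrow> 's \<times> 's. \<forall>n. (x \<le> \<infinity>\<cdot> fst (p n) \<and> (n = 0 \<longrightarrow> fst (p n) = x)) \<and>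
      (Suc k \<cdot>\<^sub>N snd (p (Suc n)) + fst (p (Suc n)) \<le> fst (p n) \<and> z n \<le> \<infinity>\<cdot> snd (p (Suc n)))"
  proof (rule dependent_nat_choice)
    show "\<exists>q :: 's \<times> 's. x \<le> \<infinity>\<cdot> fst q \<and> (0 = (0::nat) \<longrightarrow> fst q = x)"
      by (intro exI[of _ "(x, x)"]) (simp add: le_infty)
    fix q :: "'s \<times> 's" and n :: nat
    assume q: "x \<le> \<infinity>\<cdot> fst q \<and> (n = 0 \<longrightarrow> fst q = x)"
    then have "z n \<lless> \<infinity>\<cdot> fst q"
      using z(3) way_below_le_trans by blast
    then obtain y c where "Suc k \<cdot>\<^sub>N y + c \<le> fst q" "fst q \<le> \<infinity>\<cdot> c" "z n \<le> \<infinity>\<cdot> y"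
      using split_off_divisor[OF div O5] by blast
    moreover from this have "x \<le> \<infinity>\<cdot> c"
      using q infty_le by (meson order_trans)
    ultimately show "\<exists>q'. (x \<le> \<infinity>\<cdot> fst q' \<and> (Suc n = 0 \<longrightarrow> fst q' = x)) \<and>
        Suc k \<cdot>\<^sub>N snd q' + fst q' \<le> fst q \<and> z n \<le> \<infinity>\<cdot> snd q'"
      by (intro exI[of _ "(c, y)"]) simp
  qed
  then obtain p :: "nat \<Rightarrow> 's \<times> 's" where p: "fst (p 0) = x"
    "\<And>n. Suc k \<cdot>\<^sub>N snd (p (Suc n)) + fst (p (Suc n)) \<le> fst (p n)" "\<And>n. z n \<le> \<infinity>\<cdot> snd (p (Suc n))"
    by blast
  define y where "y n = snd (p (Suc n))" for n
  define v where "v = series_sup y"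
  have "Suc k \<cdot>\<^sub>N (\<Sum>i<n. y i) + fst (p n) \<le> x" for n
  proof (induction n)
    case 0
    then show ?case by (simp add: p(1) multiple_def)
  next
    case (Suc n)
    have "Suc k \<cdot>\<^sub>N (\<Sum>i<Suc n. y i) + fst (p (Suc n))
        = Suc k \<cdot>\<^sub>N (\<Sum>i<n. y i) + (Suc k \<cdot>\<^sub>N y n + fst (p (Suc n)))"
      by (simp only: sum.lessThan_Suc multiple_add_right add.assoc)
    also have "\<dots> \<le> Suc k \<cdot>\<^sub>N (\<Sum>i<n. y i) + fst (p n)"
      unfolding y_def using p(2) by (intro add_left_mono) blast
    finally show ?case using Suc by (meson order_trans)
  qed
  then have "Suc k \<cdot>\<^sub>N (\<Sum>i<n. y i) \<le> x" for n
    using le_add_cu(1) by (meson order_trans)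
  then have kv: "Suc k \<cdot>\<^sub>N v \<le> x"
    unfolding v_def series_sup_def multiple_seq_sup[OF increasing_partial_sums]
    by (intro seq_sup_le increasing_multiple_seq increasing_partial_sums)
  then have "v \<le> x" "k \<cdot>\<^sub>N v \<le> x"
    using le_add_cu[of v "k \<cdot>\<^sub>N v"] le_add_cu[of "k \<cdot>\<^sub>N v" v]
    by (auto intro: order_trans)
  have tail: "x \<le> \<infinity>\<cdot> series_sup (\<lambda>i. y (N + i))" for N
  proof -
    have "z n \<le> \<infinity>\<cdot> series_sup (\<lambda>i. y (N + i))" for n
    proof -
      have "z n \<le> z (N + n)"
        using z(1) unfolding increasing_iff_incseq by (simp add: incseqD)
      also have "z (N + n) \<le> \<infinity>\<cdot> y (N + n)"
        unfolding y_def by (rule p)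
      also have "y (N + n) \<le> (\<Sum>i<Suc n. y (N + i))"
        by (simp add: le_add_cu)
      then have "\<infinity>\<cdot> y (N + n) \<le> \<infinity>\<cdot> series_sup (\<lambda>i. y (N + i))"
        unfolding series_sup_def
        by (intro infty_mono order_trans[OF _ le_seq_sup[OF increasing_partial_sums]])
      finally show ?thesis .
    qed
    then show ?thesis using seq_sup_le[OF z(1)] z(2) by blast
  qed
  have "strongly_soft v"
    unfolding v_def using tail \<open>v \<le> x\<close> unfolding v_def
    by (intro strongly_soft_series) (meson order_trans)
  moreover have "x \<le> \<infinity>\<cdot> v"
    using tail[of 0] by (simp add: v_def)
  ultimately show ?thesis using that \<open>k \<cdot>\<^sub>N v \<le> x\<close> by blast
qed

section \<open>C*-algebra basics\<close>

lemma scaleC_zero_left [simp]: "0 *\<^sub>C x = (0::'a::cstar_algebra)"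
  using scaleR_scaleC[of 0 x] by simp

lemma scaleC_minus_one: "(- 1) *\<^sub>C x = - (x::'a::cstar_algebra)"
  using scaleR_scaleC[of "-1" x] by simp

lemma scaleC_minus_left: "(- c) *\<^sub>C x = - (c *\<^sub>C (x::'a::cstar_algebra))"
  using scaleC_add_left[of c "- c" x] by (simp add: eq_neg_iff_add_eq_0 add.commute)

lemma scaleC_zero_right [simp]: "c *\<^sub>C 0 = (0::'a::cstar_algebra)"
  using norm_scaleC[of c 0] by simp

lemma scaleC_minus_right: "c *\<^sub>C (- x) = - (c *\<^sub>C (x::'a::cstar_algebra))"
  using scaleC_add_right[of c x "- x"] by (simp add: eq_neg_iff_add_eq_0 add.commute)

lemma scaleC_diff_right: "c *\<^sub>C (x - y) = c *\<^sub>C x - c *\<^sub>C (y::'a::cstar_algebra)"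
  using scaleC_add_right[of c x "- y"] by (simp add: scaleC_minus_right)

lemma bounded_linear_scaleC: "bounded_linear (\<lambda>x::'a::cstar_algebra. c *\<^sub>C x)"
proof (rule bounded_linear_intro[where K = "cmod c"])
  show "c *\<^sub>C (r *\<^sub>R x) = r *\<^sub>R (c *\<^sub>C x)" for r and x :: 'a
    by (simp add: scaleR_scaleC scaleC_scaleC mult.commute)
qed (simp_all add: scaleC_add_right norm_scaleC mult.commute)

lemma of_real_norm_power2: "(complex_of_real (cmod z))\<^sup>2 = z * cnj z"
  by (metis complex_norm_square of_real_power)

lemma adj_zero [simp]: "adj 0 = (0::'a::cstar_algebra)"
  using adj_add[of 0 "0::'a"] by simp

lemma adj_minus: "adj (- x) = - adj (x::'a::cstar_algebra)"
  using adj_add[of x "- x"] by (simp add: eq_neg_iff_add_eq_0 add.commute)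

lemma adj_diff: "adj (x - y) = adj x - adj (y::'a::cstar_algebra)"
  using adj_add[of x "- y"] by (simp add: adj_minus)

lemma norm_adj [simp]: "norm (adj x) = norm (x::'a::cstar_algebra)"
proof -
  have le: "norm y \<le> norm (adj y)" for y :: 'a
  proof (cases "y = 0")
    case False
    have "norm y * norm y \<le> norm (adj y) * norm y"
      using cstar_identity[of y] norm_mult_ineq[of "adj y" y] by (simp add: power2_eq_square)
    then show ?thesis using False by simp
  qed simp
  show ?thesis using le[of x] le[of "adj x"] by (simp add: adj_adj)
qed

lemma bounded_linear_adj: "bounded_linear (adj :: 'a::cstar_algebra \<Rightarrow> 'a)"
proof (rule bounded_linear_intro[where K = 1])
  show "adj (r *\<^sub>R x) = r *\<^sub>R adj x" for r and x :: 'a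
    by (simp add: scaleR_scaleC adj_scaleC)
qed (simp_all add: adj_add)

text \<open>The relation says that \<open>u = x + i(1 - y)\<close> is unitary in the unitization, so that \<open>x\<close> is the
  mean of two isometric multipliers \<open>u\<close> and \<open>u\<^sup>*\<close>.\<close>

lemma norm_le_one_if_unitary_dilation:
  fixes x y :: "'a::cstar_algebra"
  assumes adj: "adj x = x" "adj y = y" and comm: "x * y = y * x" and eq: "x * x + y * y = y + y"
  shows "norm x \<le> 1"
proof -
  \<comment> \<open>Multiplication by \<open>x + s(1 - y)\<close> preserves norms by the
    C*-identity; the mixed terms cancel because \<open>x\<close> and \<open>y\<close> commute and
    \<open>s\<close> is purely imaginary.\<close>
  have iso: "norm (x * z + s *\<^sub>C (z - y * z)) = norm z" if s: "cnj s = - s" "s * s = - 1" for s z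
  proof -
    define w where "w = z - y * z"
    have pp: "adj (x * z) * (x * z) = adj z * (x * x) * z"
      and ww: "adj w * w = adj z * z - adj z * (y + y) * z + adj z * (y * y) * z"
      and pw: "adj (x * z) * w = adj z * x * z - adj z * (x * y) * z"
      and wp: "adj w * (x * z) = adj z * x * z - adj z * (y * x) * z"
      by (simp_all add: w_def adj_mult adj_diff adj algebra_simps)
    have "adj (x * z + s *\<^sub>C w) * (x * z + s *\<^sub>C w) = adj (x * z) * (x * z) + adj w * w
        + s *\<^sub>C (adj (x * z) * w) - s *\<^sub>C (adj w * (x * z))"
      using s by (simp add: adj_add adj_scaleC algebra_simps mult_scaleC_left
          mult_scaleC_right scaleC_scaleC scaleC_minus_left scaleC_one scaleC_add_right scaleC_diff_right)
    also have "\<dots> = adj z * (x * x + y * y) * z + adj z * z - adj z * (y + y) * z"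
      unfolding pp ww pw wp comm by (simp add: algebra_simps)
    also have "\<dots> = adj z * z" by (simp add: eq)
    finally have "(norm (x * z + s *\<^sub>C w))\<^sup>2 = (norm z)\<^sup>2"
      by (metis cstar_identity)
    then show ?thesis by (simp add: w_def)
  qed
  \<comment> \<open>Both isometries are applied to \<open>x\<close> itself; their sum leaves only
    \<open>2 *\<^sub>R (x * x)\<close>, whose norm is twice the square of the norm of
    \<open>x\<close>.\<close>
  have "norm (2 *\<^sub>R (x * x)) \<le> 2 * norm x"
  proof -
    have "2 *\<^sub>R (x * x) = (x * x + \<i> *\<^sub>C (x - y * x)) + (x * x + (- \<i>) *\<^sub>C (x - y * x))"
      by (simp add: scaleC_minus_left scaleR_2)
    also have "norm \<dots> \<le> norm x + norm x"
      using iso[of \<i> x] iso[of "- \<i>" x] by (intro norm_triangle_mono) simp_all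
    finally show ?thesis by simp
  qed
  then have "norm x * norm x \<le> norm x"
    using cstar_identity[of x] by (simp add: adj power2_eq_square)
  then show ?thesis by (cases "norm x = 0") auto
qed

section \<open>Functions on the cone\<close>

text \<open>Elements of \<open>C0 {0<..1}\<close> are handled as continuous functions on the closed interval that vanish
  at 0; their values outside the interval are irrelevant.\<close>

definition cone_fun :: "(real \<Rightarrow> complex) set" where
  "cone_fun = {F. continuous_on {0..1} F \<and> F 0 = 0}"

lemma cone_funI: "continuous_on {0..1} F \<Longrightarrow> F 0 = 0 \<Longrightarrow> F \<in> cone_fun"
  by (simp add: cone_fun_def)

lemma cone_fun_continuous: "F \<in> cone_fun \<Longrightarrow> continuous_on {0..1} F"
  by (simp add: cone_fun_def)

lemma cone_fun_zero: "F \<in> cone_fun \<Longrightarrow> F 0 = 0"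
  by (simp add: cone_fun_def)

lemma cone_fun_id [simp]: "complex_of_real \<in> cone_fun"
  by (auto simp: cone_fun_def intro!: continuous_intros)

lemma cone_fun_0 [simp]: "(\<lambda>t. 0) \<in> cone_fun"
  by (simp add: cone_fun_def)

lemma cone_fun_add: "F \<in> cone_fun \<Longrightarrow> G \<in> cone_fun \<Longrightarrow> (\<lambda>t. F t + G t) \<in> cone_fun"
  by (auto simp: cone_fun_def intro!: continuous_intros)

lemma cone_fun_diff: "F \<in> cone_fun \<Longrightarrow> G \<in> cone_fun \<Longrightarrow> (\<lambda>t. F t - G t) \<in> cone_fun"
  by (auto simp: cone_fun_def intro!: continuous_intros)

lemma cone_fun_mult: "F \<in> cone_fun \<Longrightarrow> G \<in> cone_fun \<Longrightarrow> (\<lambda>t. F t * G t) \<in> cone_fun"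
  by (auto simp: cone_fun_def intro!: continuous_intros)

lemma cone_fun_scale: "F \<in> cone_fun \<Longrightarrow> (\<lambda>t. c * F t) \<in> cone_fun"
  by (auto simp: cone_fun_def intro!: continuous_intros)

lemma cone_fun_cnj: "F \<in> cone_fun \<Longrightarrow> (\<lambda>t. cnj (F t)) \<in> cone_fun"
  by (auto simp: cone_fun_def intro!: continuous_intros)

lemma cone_fun_compose:
  assumes "F \<in> cone_fun" "continuous_on {0..1} h" "h 0 = 0" "\<And>t. t \<in> {0..1} \<Longrightarrow> h t \<in> {0..1}"
  shows "(\<lambda>t. F (h t)) \<in> cone_fun"
proof (rule cone_funI)
  show "continuous_on {0..1} (\<lambda>t. F (h t))"
    using assms(2) by (rule continuous_on_compose2[OF cone_fun_continuous[OF assms(1)]]) (use assms(4) in blast)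
qed (simp add: assms(1,3) cone_fun_zero)

lemma compact_norm_ge:
  fixes f :: "'t::topological_space \<Rightarrow> 'b::real_normed_vector"
  assumes "compact S" "continuous_on S f"
  shows "compact {t\<in>S. e \<le> norm (f t)}"
proof -
  have "closed {z::'b. e \<le> norm z}"
    by (intro closed_Collect_le continuous_intros)
  then have "closedin (top_of_set S) (S \<inter> f -` {z. e \<le> norm z})"
    using assms(2) continuous_closedin_preimage by blast
  moreover have "S \<inter> f -` {z. e \<le> norm z} = {t\<in>S. e \<le> norm (f t)}" by auto
  ultimately show ?thesis using closedin_compact[OF assms(1)] by simp
qed

text \<open>Vanishing at infinity gives continuity at the added point: the set where the modulus of
  \<open>f\<close> is at least \<open>e\<close> is compact, hence closed, and misses
  \<open>p\<close>.\<close>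

lemma continuous_on_insert_vanishing:
  fixes f :: "'t::metric_space \<Rightarrow> complex"
  assumes cont: "continuous_on X f" and "f p = 0" "p \<notin> X"
    and comp: "\<And>e. e > 0 \<Longrightarrow> compact {t\<in>X. e \<le> cmod (f t)}"
  shows "continuous_on (insert p X) f"
  unfolding continuous_on_eq_continuous_within
proof
  fix t assume t: "t \<in> insert p X"
  show "continuous (at t within insert p X) f"
  proof (cases "t = p")
    case True
    show ?thesis
      unfolding continuous_within_eps_delta True
    proof (intro allI impI)
      fix e :: real assume e: "e > 0"
      define C where "C = {t\<in>X. e \<le> cmod (f t)}"
      have "closed C" "p \<notin> C"
        using comp[OF e] assms(3) by (auto simp: C_def compact_imp_closed)
      then obtain d where d: "d > 0" "ball p d \<subseteq> - C"
        by (metis open_Compl open_contains_ball ComplI)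
      have "dist (f x) (f p) < e" if "x \<in> insert p X" "dist x p < d" for x
      proof (cases "x = p")
        case False
        have "x \<in> ball p d" using that by (simp add: dist_commute)
        then have "x \<in> - C" using d by blast
        then show ?thesis using False that assms(2) by (auto simp: C_def)
      qed (use e in simp)
      then show "\<exists>d>0. \<forall>x\<in>insert p X. dist x p < d \<longrightarrow> dist (f x) (f p) < e"
        using d(1) by blast
    qed
  next
    case False
    have "continuous (at t within X) f"
      using cont t False by (auto simp: continuous_on_eq_continuous_within)
    moreover have "at t within X = at t within insert p X"
      by (rule at_within_nhd[of t "- {p}"]) (use t False in auto)
    ultimately show ?thesis by (simp add: continuous_within)
  qed
qed

lemma C0_functions_imp_cone_fun:
  assumes "f \<in> C0_functions {0<..1}"
  shows "f \<in> cone_fun"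
proof (rule cone_funI)
  have "insert 0 {0<..1} = {0..1::real}" by auto
  moreover have "continuous_on (insert 0 {0<..1}) f"
    using assms by (intro continuous_on_insert_vanishing) (auto simp: C0_functions_def)
  ultimately show "continuous_on {0..1} f" by simp
qed (use assms in \<open>simp add: C0_functions_def\<close>)

lemma restrict_cone_fun_in_C0_functions:
  assumes F: "F \<in> cone_fun"
  shows "restrict_zero {0<..1} F \<in> C0_functions {0<..1}"
  unfolding C0_functions_def
proof (intro CollectI conjI allI impI)
  show "continuous_on {0<..1} (restrict_zero {0<..1} F)"
    using continuous_on_subset[OF cone_fun_continuous[OF F], of "{0<..1}"]
    by (rule continuous_on_eq) (auto simp: restrict_zero_def)
  fix e :: real assume "e > 0"
  then have "{t\<in>{0<..1}. e \<le> cmod (restrict_zero {0<..1} F t)} = {t\<in>{0..1}. e \<le> cmod (F t)}"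
    using cone_fun_zero[OF F] by (auto simp: restrict_zero_def order_less_le)
  moreover have "compact {t\<in>{0..1}. e \<le> cmod (F t)}"
    using cone_fun_continuous[OF F] by (intro compact_norm_ge) auto
  ultimately show "compact {t\<in>{0<..1}. e \<le> cmod (restrict_zero {0<..1} F t)}" by simp
qed (auto simp: restrict_zero_def)

section \<open>Closed ideals of the cone and their zeros\<close>

definition cone_ideal :: "(real \<Rightarrow> complex) set \<Rightarrow> bool" where
  "cone_ideal N \<longleftrightarrow> N \<subseteq> cone_fun \<and> (\<lambda>t. 0) \<in> N \<and>
    (\<forall>F\<in>N. \<forall>G\<in>N. (\<lambda>t. F t + G t) \<in> N) \<and> (\<forall>F\<in>cone_fun. \<forall>G\<in>N. (\<lambda>t. F t * G t) \<in> N) \<and>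
    (\<forall>F\<in>cone_fun. (\<forall>e>0. \<exists>G\<in>N. \<forall>t\<in>{0..1}. cmod (F t - G t) \<le> e) \<longrightarrow> F \<in> N)"

lemma cone_ideal_mult: "cone_ideal N \<Longrightarrow> F \<in> cone_fun \<Longrightarrow> G \<in> N \<Longrightarrow> (\<lambda>t. F t * G t) \<in> N"
  unfolding cone_ideal_def by blast

lemma cone_ideal_closed:
  assumes "cone_ideal N" "F \<in> cone_fun" "\<And>e. e > 0 \<Longrightarrow> \<exists>G\<in>N. \<forall>t\<in>{0..1}. cmod (F t - G t) \<le> e"
  shows "F \<in> N"
  using assms unfolding cone_ideal_def by meson

lemma cone_ideal_cone_fun: "cone_ideal N \<Longrightarrow> G \<in> N \<Longrightarrow> G \<in> cone_fun"
  unfolding cone_ideal_def by blast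

text \<open>Closed ideals are determined by their common zeros. Where \<open>F\<close> is not small,
  finitely many members of \<open>N\<close> have no common zero by compactness, and the sum
  \<open>g\<close> of their squared moduli, again in \<open>N\<close>, can be inverted
  there.\<close>

lemma cone_ideal_memI:
  assumes N: "cone_ideal N" and F: "F \<in> cone_fun"
    and supp: "\<And>t. t \<in> {0<..1} \<Longrightarrow> F t \<noteq> 0 \<Longrightarrow> \<exists>G\<in>N. G t \<noteq> 0"
  shows "F \<in> N"
proof -
  have "\<exists>G\<in>N. \<forall>t\<in>{0..1}. cmod (F t - G t) \<le> e" if e: "e > 0" for e
  proof -
    define C where "C = {t\<in>{0..1}. e \<le> cmod (F t)}"
    have C: "compact C" unfolding C_def
      using cone_fun_continuous[OF F] by (intro compact_norm_ge) auto
    have "\<exists>G\<in>N. G t \<noteq> 0" if "t \<in> C" for t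
    proof (rule supp)
      show "F t \<noteq> 0" using that e by (auto simp: C_def)
      then show "t \<in> {0<..1}"
        using that cone_fun_zero[OF F] by (auto simp: C_def order_less_le)
    qed
    then obtain G where G: "\<And>t. t \<in> C \<Longrightarrow> G t \<in> N" "\<And>t. t \<in> C \<Longrightarrow> G t t \<noteq> 0"
      by metis
    have Gc: "continuous_on {0..1} (G t)" if "t \<in> C" for t
      using G(1)[OF that] N cone_fun_continuous unfolding cone_ideal_def by blast
    have "\<exists>d>0. \<forall>s\<in>{0..1}. dist s t < d \<longrightarrow> G t s \<noteq> 0" if t: "t \<in> C" for t
    proof -
      have "\<exists>d>0. \<forall>s\<in>{0..1}. dist s t < d \<longrightarrow> dist (G t s) (G t t) < cmod (G t t)"
        using Gc[OF t] t G(2)[OF t] unfolding continuous_on_iff C_def by auto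
      moreover have "G t s \<noteq> 0" if "dist (G t s) (G t t) < cmod (G t t)" for s
        using that by auto
      ultimately show ?thesis by meson
    qed
    then obtain d where d: "\<And>t. t \<in> C \<Longrightarrow> d t > 0"
      "\<And>t s. t \<in> C \<Longrightarrow> s \<in> {0..1} \<Longrightarrow> dist s t < d t \<Longrightarrow> G t s \<noteq> 0"
      by metis
    have "C \<subseteq> (\<Union>t\<in>C. ball t (d t))"
      using d(1) by (intro subsetI UN_I) auto
    then obtain T where T: "T \<subseteq> C" "finite T" "C \<subseteq> (\<Union>t\<in>T. ball t (d t))"
      using compactE_image[OF C, of C "\<lambda>t. ball t (d t)"] by auto
    define g where "g s = (\<Sum>t\<in>T. (cmod (G t s))\<^sup>2)" for s
    have g: "continuous_on {0..1} g"
      unfolding g_def using T(1) Gc by (intro continuous_intros) auto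
    have g_nonneg: "g s \<ge> 0" for s
      unfolding g_def by (intro sum_nonneg) auto
    have g_pos: "g s > 0" if "s \<in> C" for s
    proof -
      obtain t where t: "t \<in> T" "dist s t < d t"
        using T(3) \<open>s \<in> C\<close> by (auto simp: dist_commute)
      have "G t s \<noteq> 0" using d(2) t T(1) \<open>s \<in> C\<close> by (auto simp: C_def)
      then show ?thesis
        unfolding g_def using t(1) T(2) by (intro sum_pos2[of T t]) auto
    qed
    obtain m where m: "m > 0" "\<And>s. s \<in> C \<Longrightarrow> m \<le> g s"
    proof (cases "C = {}")
      case False
      have "continuous_on C g"
        using g by (rule continuous_on_subset) (auto simp: C_def)
      then obtain s where "s \<in> C" "\<And>s'. s' \<in> C \<Longrightarrow> g s \<le> g s'"
        using continuous_attains_inf[OF C False] by blast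
      then show ?thesis using that g_pos by blast
    qed (use that[of 1] in simp)
    \<comment> \<open>The modulus of \<open>F\<close> is shrunk by \<open>e\<close>, so
      \<open>r\<close> is within \<open>e\<close> of \<open>F\<close> and vanishes on the interval
      off \<open>C\<close>. The maximum in the denominator avoids a division by zero.\<close>
    define r where "r s = F s * complex_of_real (max (cmod (F s) - e) 0 / max (cmod (F s)) e)" for s
    \<comment> \<open>On \<open>C\<close> the denominator is \<open>g\<close>, so \<open>H\<close>
      times \<open>g\<close> is \<open>r\<close>; elsewhere \<open>m\<close> keeps the denominator
      away from 0.\<close>
    define H where "H s = r s / complex_of_real (max (g s) m)" for s
    have pos: "max (cmod (F s)) e \<noteq> 0" "max (g s) m \<noteq> 0" for s
      using e m(1) by auto
    have H: "H \<in> cone_fun"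
    proof (rule cone_funI)
      show "continuous_on {0..1} H"
        unfolding H_def r_def using cone_fun_continuous[OF F] g pos
        by (intro continuous_intros) (simp_all del: max_less_iff_conj)
    qed (simp add: H_def r_def cone_fun_zero[OF F])
    have sum_mem: "(\<lambda>s. \<Sum>t\<in>T'. cnj (G t s) * G t s) \<in> N" if "T' \<subseteq> C" "finite T'" for T'
      using that(2,1)
    proof (induction T' rule: finite_induct)
      case empty
      then show ?case using N by (simp add: cone_ideal_def)
    next
      case (insert t T')
      have "(\<lambda>s. cnj (G t s) * G t s) \<in> N"
        using G(1)[of t] insert.prems
        by (intro cone_ideal_mult[OF N] cone_fun_cnj cone_ideal_cone_fun[OF N]) auto
      then show ?case
        using insert N unfolding cone_ideal_def by simp
    qed
    have sum_eq: "(\<Sum>t\<in>T. cnj (G t s) * G t s) = complex_of_real (g s)" for s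
      unfolding g_def by (simp add: of_real_norm_power2 mult.commute)
    have "(\<lambda>s. complex_of_real (g s)) \<in> N"
      using sum_mem[OF T(1,2)] by (simp only: sum_eq)
    then have "(\<lambda>s. H s * complex_of_real (g s)) \<in> N"
      by (rule cone_ideal_mult[OF N H])
    moreover have "cmod (F s - H s * complex_of_real (g s)) \<le> e" if "s \<in> {0..1}" for s
    proof -
      have "H s * complex_of_real (g s) = r s"
      proof (cases "s \<in> C")
        case True
        then have "max (g s) m = g s" "g s \<noteq> 0" using m g_pos[of s] by fastforce+
        then show ?thesis by (simp add: H_def)
      next
        case False
        then have "r s = 0" using that by (auto simp: r_def C_def)
        then show ?thesis by (simp add: H_def)
      qed
      moreover have "cmod (F s - r s) \<le> e"
      proof (cases "e \<le> cmod (F s)")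
        case True
        then have "cmod (F s) \<noteq> 0" using e by linarith
        then have q: "max (cmod (F s) - e) 0 / max (cmod (F s)) e = 1 - e / cmod (F s)"
          using True e by (simp add: diff_divide_distrib)
        have *: "F s - r s = F s * complex_of_real (e / cmod (F s))"
          unfolding r_def q by (simp add: right_diff_distrib)
        show ?thesis
          unfolding * norm_mult using True e by (simp add: norm_divide)
      next
        case False
        then show ?thesis by (simp add: r_def)
      qed
      ultimately show ?thesis by simp
    qed
    ultimately show ?thesis
      by (intro bexI[of _ "\<lambda>s. H s * complex_of_real (g s)"] ballI)
  qed
  then show ?thesis by (intro cone_ideal_closed[OF N F])
qed

text \<open>Stated for contractive additive maps and closed additive sets, so that it covers
  off-diagonal matrix entries, which are not multiplicative, as well as kernels and
  annihilators.\<close>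

lemma cone_ideal_preimage:
  fixes \<kappa> :: "(real \<Rightarrow> complex) \<Rightarrow> 'a::cstar_algebra"
  assumes V: "closed V" "0 \<in> V" "\<And>x y. x \<in> V \<Longrightarrow> y \<in> V \<Longrightarrow> x + y \<in> V"
    and "\<kappa> (\<lambda>t. 0) = 0"
    and add: "\<And>F G. F \<in> cone_fun \<Longrightarrow> G \<in> cone_fun \<Longrightarrow> \<kappa> (\<lambda>t. F t + G t) = \<kappa> F + \<kappa> G"
    and contr: "\<And>F G e. F \<in> cone_fun \<Longrightarrow> G \<in> cone_fun \<Longrightarrow>
      (\<And>t. t \<in> {0..1} \<Longrightarrow> cmod (F t - G t) \<le> e) \<Longrightarrow> norm (\<kappa> F - \<kappa> G) \<le> e"
    and mult: "\<And>F G. F \<in> cone_fun \<Longrightarrow> G \<in> cone_fun \<Longrightarrow> \<kappa> G \<in> V \<Longrightarrow> \<kappa> (\<lambda>t. F t * G t) \<in> V"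
  shows "cone_ideal {F\<in>cone_fun. \<kappa> F \<in> V}"
  unfolding cone_ideal_def
proof (intro conjI ballI impI)
  fix F assume F: "F \<in> cone_fun"
    and lim: "\<forall>e>0. \<exists>G\<in>{F\<in>cone_fun. \<kappa> F \<in> V}. \<forall>t\<in>{0..1}. cmod (F t - G t) \<le> e"
  have "\<exists>v\<in>V. dist v (\<kappa> F) < e" if "e > 0" for e
  proof -
    obtain G where G: "G \<in> cone_fun" "\<kappa> G \<in> V" "\<And>t. t \<in> {0..1} \<Longrightarrow> cmod (F t - G t) \<le> e / 2"
      using lim \<open>e > 0\<close> by (auto dest!: spec[of _ "e / 2"])
    have "norm (\<kappa> F - \<kappa> G) \<le> e / 2" using contr[OF F G(1) G(3)] .
    then have "dist (\<kappa> G) (\<kappa> F) < e"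
      using \<open>e > 0\<close> by (simp add: dist_norm norm_minus_commute)
    then show ?thesis using G(2) by blast
  qed
  then have "\<kappa> F \<in> closure V" by (auto simp: closure_approachable)
  then show "F \<in> {F\<in>cone_fun. \<kappa> F \<in> V}" using F V(1) by simp
qed (auto simp: assms cone_fun_add cone_fun_mult)

text \<open>A *-homomorphism on \<open>C0 {0<..1}\<close> amounts to a positive contraction, the
  image \<open>gen\<close> of the identity function. Recording the homomorphism instead of the
  element makes all continuous functions of \<open>gen\<close> that vanish at 0 available at once.
  By \<open>cong\<close> the map descends to functions on the half-open interval.\<close>

locale cone_hom =
  fixes \<theta> :: "(real \<Rightarrow> complex) \<Rightarrow> 'a::cstar_algebra"
  assumes add: "F \<in> cone_fun \<Longrightarrow> G \<in> cone_fun \<Longrightarrow> \<theta> (\<lambda>t. F t + G t) = \<theta> F + \<theta> G"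
    and mult: "F \<in> cone_fun \<Longrightarrow> G \<in> cone_fun \<Longrightarrow> \<theta> (\<lambda>t. F t * G t) = \<theta> F * \<theta> G"
    and scale: "F \<in> cone_fun \<Longrightarrow> \<theta> (\<lambda>t. c * F t) = c *\<^sub>C \<theta> F"
    and cnj: "F \<in> cone_fun \<Longrightarrow> \<theta> (\<lambda>t. cnj (F t)) = adj (\<theta> F)"
    and cong: "F \<in> cone_fun \<Longrightarrow> G \<in> cone_fun \<Longrightarrow> (\<And>t. t \<in> {0<..1} \<Longrightarrow> F t = G t) \<Longrightarrow> \<theta> F = \<theta> G"
begin

abbreviation gen :: 'a where
  "gen \<equiv> \<theta> complex_of_real"

lemma zero [simp]: "\<theta> (\<lambda>t. 0) = 0"
  using scale[of "\<lambda>t. 0" 0] by simp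

lemma diff: "F \<in> cone_fun \<Longrightarrow> G \<in> cone_fun \<Longrightarrow> \<theta> (\<lambda>t. F t - G t) = \<theta> F - \<theta> G"
  using add[of F "\<lambda>t. (- 1) * G t"] scale[of G "- 1"] cone_fun_scale[of G "- 1"]
  by (simp add: scaleC_minus_one)

lemma commute: "F \<in> cone_fun \<Longrightarrow> G \<in> cone_fun \<Longrightarrow> \<theta> F * \<theta> G = \<theta> G * \<theta> F"
  by (simp add: mult[symmetric] mult.commute)

text \<open>The unitary dilation of a real contraction \<open>p\<close> is
  \<open>p + \<i> * sqrt (1 - p * p)\<close>. Writing the root as \<open>1 - h\<close> brings it
  into the form of the norm lemma, with an \<open>h\<close> that vanishes at 0 and so lies in the
  cone.\<close>

lemma norm_real_le_one:
  assumes p: "(\<lambda>t. complex_of_real (p t)) \<in> cone_fun" and le: "\<And>t. t \<in> {0<..1} \<Longrightarrow> \<bar>p t\<bar> \<le> 1"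
  shows "norm (\<theta> (\<lambda>t. complex_of_real (p t))) \<le> 1"
proof -
  define h where "h t = 1 - sqrt (1 - (p t)\<^sup>2)" for t
  let ?P = "\<lambda>t. complex_of_real (p t)" and ?H = "\<lambda>t. complex_of_real (h t)"
  have "continuous_on {0..1} p"
    using continuous_on_Re[OF cone_fun_continuous[OF p]] by simp
  then have H: "?H \<in> cone_fun"
    unfolding h_def using cone_fun_zero[OF p] by (intro cone_funI continuous_intros) auto
  have "p t * p t + h t * h t = h t + h t" if "t \<in> {0<..1}" for t
  proof -
    have "(p t)\<^sup>2 \<le> 1" using le[OF that] by (simp add: abs_square_le_1)
    then have "(sqrt (1 - (p t)\<^sup>2))\<^sup>2 = 1 - (p t)\<^sup>2" by simp
    then show ?thesis by (simp add: h_def power2_eq_square algebra_simps)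
  qed
  then have "\<theta> (\<lambda>t. ?P t * ?P t + ?H t * ?H t) = \<theta> (\<lambda>t. ?H t + ?H t)"
    using p H by (intro cong cone_fun_add cone_fun_mult) (simp_all flip: of_real_mult of_real_add)
  then have "\<theta> ?P * \<theta> ?P + \<theta> ?H * \<theta> ?H = \<theta> ?H + \<theta> ?H"
    by (simp only: add mult cone_fun_mult p H)
  moreover have "adj (\<theta> ?P) = \<theta> ?P" "adj (\<theta> ?H) = \<theta> ?H"
    using cnj[OF p] cnj[OF H] by simp_all
  ultimately show ?thesis
    using commute[OF p H] by (intro norm_le_one_if_unitary_dilation)
qed

text \<open>The C*-identity reduces this to the squared modulus of \<open>F\<close>, which is real
  and becomes a contraction after division by the square of a bound. That bound is a positive
  \<open>M' \<ge> M\<close>, since \<open>M\<close> may be 0.\<close>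

lemma norm_le:
  assumes F: "F \<in> cone_fun" and le: "\<And>t. t \<in> {0<..1} \<Longrightarrow> cmod (F t) \<le> M"
  shows "norm (\<theta> F) \<le> M"
proof -
  have pos: "norm (\<theta> F) \<le> M'" if M': "M' > 0" "M \<le> M'" for M'
  proof -
    define p where "p t = (cmod (F t) / M')\<^sup>2" for t
    let ?P = "\<lambda>t. complex_of_real (p t)" and ?G = "\<lambda>t. cnj (F t) * F t"
    have P: "?P = (\<lambda>t. complex_of_real (1 / M'\<^sup>2) * ?G t)"
      unfolding p_def
      by (auto simp: power_divide of_real_norm_power2 mult.commute)
    have G: "?G \<in> cone_fun" using F by (intro cone_fun_mult cone_fun_cnj)
    have "norm (\<theta> ?P) \<le> 1"
    proof (rule norm_real_le_one)
      show "?P \<in> cone_fun" unfolding P using G by (rule cone_fun_scale)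
      show "\<bar>p t\<bar> \<le> 1" if "t \<in> {0<..1}" for t
        using le[OF that] M' by (simp add: p_def power_le_one)
    qed
    moreover have "\<theta> ?P = complex_of_real (1 / M'\<^sup>2) *\<^sub>C (adj (\<theta> F) * \<theta> F)"
      unfolding P by (simp only: scale[OF G] mult[OF cone_fun_cnj[OF F] F] cnj[OF F])
    ultimately have "(norm (\<theta> F))\<^sup>2 \<le> M'\<^sup>2"
      using M'(1) by (simp add: norm_scaleC cstar_identity norm_divide norm_power divide_simps)
    then show ?thesis using M'(1) power2_le_imp_le[of "norm (\<theta> F)" M'] by linarith
  qed
  have "0 \<le> M" by (rule order_trans[OF norm_ge_zero le[of 1]]) simp
  show ?thesis
    by (rule field_le_epsilon) (use pos \<open>0 \<le> M\<close> in auto)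
qed

lemma norm_diff_le:
  assumes "F \<in> cone_fun" "G \<in> cone_fun" "\<And>t. t \<in> {0..1} \<Longrightarrow> cmod (F t - G t) \<le> e"
  shows "norm (\<theta> F - \<theta> G) \<le> e"
  using norm_le[OF cone_fun_diff[OF assms(1,2)], of e] assms by (simp add: diff)

lemma cone_ideal_vimage:
  assumes "closed V" "0 \<in> V" "\<And>x y. x \<in> V \<Longrightarrow> y \<in> V \<Longrightarrow> x + y \<in> V"
    and "\<And>F G. F \<in> cone_fun \<Longrightarrow> G \<in> cone_fun \<Longrightarrow> \<theta> G \<in> V \<Longrightarrow> \<theta> F * \<theta> G \<in> V"
  shows "cone_ideal {F\<in>cone_fun. \<theta> F \<in> V}"
  by (rule cone_ideal_preimage) (use assms in \<open>simp_all add: add mult norm_diff_le del: atLeastAtMost_iff\<close>)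

text \<open>The generator of the composite is the function \<open>h\<close> of \<open>gen\<close>.
  In this way cut-downs and bumps of a generator become generators themselves.\<close>

lemma cone_hom_compose:
  assumes h: "continuous_on {0..1} h" "h 0 = 0" "\<And>t. t \<in> {0..1} \<Longrightarrow> h t \<in> {0..1}"
  shows "cone_hom (\<lambda>F. \<theta> (\<lambda>t. F (h t)))"
proof
  fix F G assume FG: "F \<in> cone_fun" "G \<in> cone_fun" and eq: "\<And>t. t \<in> {0<..1} \<Longrightarrow> F t = G t"
  have "F (h t) = G (h t)" if "t \<in> {0<..1}" for t
    using that h(3)[of t] eq[of "h t"] FG by (cases "h t = 0") (auto simp: cone_fun_zero)
  then show "\<theta> (\<lambda>t. F (h t)) = \<theta> (\<lambda>t. G (h t))"
    by (intro cong cone_fun_compose[OF _ h] FG)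
qed (rule add mult scale cnj; rule cone_fun_compose[OF _ h]; assumption)+

section \<open>The kernel and the spectrum of the generator\<close>

definition hull_set :: "real set" where
  "hull_set = {t\<in>{0<..1}. \<forall>F\<in>cone_fun. \<theta> F = 0 \<longrightarrow> F t = 0}"

text \<open>The kernel is a closed ideal of the cone, hence determined by its common zeros, which
  form \<open>hull_set\<close>.\<close>

lemma eq_zero_if_vanishing_on_hull:
  assumes "F \<in> cone_fun" "\<And>t. t \<in> hull_set \<Longrightarrow> F t = 0"
  shows "\<theta> F = 0"
proof -
  have "cone_ideal {F\<in>cone_fun. \<theta> F \<in> {0}}"
    by (rule cone_ideal_vimage) auto
  moreover have "\<exists>G\<in>{F\<in>cone_fun. \<theta> F \<in> {0}}. G t \<noteq> 0" if "t \<in> {0<..1}" "F t \<noteq> 0" for t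
  proof -
    have "t \<notin> hull_set" using assms(2) that(2) by metis
    then show ?thesis using that(1) by (auto simp: hull_set_def)
  qed
  ultimately have "F \<in> {F\<in>cone_fun. \<theta> F \<in> {0}}"
    by (rule cone_ideal_memI[OF _ assms(1)])
  then show ?thesis by simp
qed

lemma eq_if_eq_on_hull:
  assumes "F \<in> cone_fun" "G \<in> cone_fun" "\<And>t. t \<in> hull_set \<Longrightarrow> F t = G t"
  shows "\<theta> F = \<theta> G"
  using eq_zero_if_vanishing_on_hull[OF cone_fun_diff[OF assms(1,2)]] assms
  by (simp add: diff)

lemma compact_insert_hull: "compact (insert 0 hull_set)"
proof -
  have "insert 0 hull_set = {0..1} \<inter> (\<Inter>F\<in>{F\<in>cone_fun. \<theta> F = 0}. {t\<in>{0..1}. F t = 0})"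
    unfolding hull_set_def by (auto simp: cone_fun_zero order_less_le)
  moreover have "closed {t\<in>{0..1}. F t = 0}" if "F \<in> cone_fun" for F
  proof -
    have "{t\<in>{0..1}. F t = 0} = {0..1} \<inter> F -` {0}" by auto
    then show ?thesis
      using continuous_closed_preimage[OF cone_fun_continuous[OF that], of "{0}"] by simp
  qed
  ultimately show ?thesis
    by (simp only:) (intro compact_Int_closed closed_INT, auto)
qed

text \<open>Off the hull, an explicit function inverts \<open>t - l\<close> modulo the kernel. At a
  point of the hull, a one-sided inverse would bound \<open>\<theta> G\<close> by a multiple of the
  image of \<open>(t - l) * G\<close>; iterating this for a \<open>G\<close> supported close to the
  point forces \<open>\<theta> G = 0\<close>, against the choice of the point.\<close>

lemma spectrum_gen: "spectrum gen = insert 0 (complex_of_real ` hull_set)"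
proof (intro equalityI subsetI)
  fix l assume l: "l \<in> spectrum gen"
  show "l \<in> insert 0 (complex_of_real ` hull_set)"
  proof (rule ccontr)
    assume not: "l \<notin> insert 0 (complex_of_real ` hull_set)"
    then have l0: "l \<noteq> 0" by auto
    obtain G where G: "G \<in> cone_fun" "\<theta> G = 0" "\<And>t. t \<in> {0<..1} \<Longrightarrow> complex_of_real t = l \<Longrightarrow> G t \<noteq> 0"
    proof (cases "l \<in> complex_of_real ` {0<..1}")
      case True
      then obtain t where t: "t \<in> {0<..1}" "l = complex_of_real t" by blast
      then obtain G where "G \<in> cone_fun" "\<theta> G = 0" "G t \<noteq> 0"
        using not unfolding hull_set_def by blast
      then show ?thesis using that t by auto
    next
      case False
      have "complex_of_real t \<noteq> l" if "t \<in> {0<..1}" for t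
        using False that by blast
      then show ?thesis using that[of "\<lambda>t. 0"] by auto
    qed
    define D where "D t = (cmod (complex_of_real t - l))\<^sup>2 + (cmod (G t))\<^sup>2" for t
    have D: "D t \<noteq> 0" if "t \<in> {0..1}" for t
    proof
      assume "D t = 0"
      then have "complex_of_real t = l" "G t = 0"
        unfolding D_def by (simp_all add: add_nonneg_eq_0_iff)
      then show False using G(3)[of t] that l0 by (cases "t = 0") auto
    qed
    have D_cont: "continuous_on {0..1} D"
      unfolding D_def using cone_fun_continuous[OF G(1)] by (intro continuous_intros)
    \<comment> \<open>Modulo the kernel \<open>G\<close> is 0, so the first summand inverts
      \<open>t - l\<close>. Adding \<open>1 / l\<close> makes \<open>k\<close> vanish at 0; the
      constant reappears as the scalar part \<open>- 1 / l\<close> of the inverse in the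
      unitization.\<close>
    define k where "k t = cnj (complex_of_real t - l) / complex_of_real (D t) + 1 / l" for t
    define H where "H t = cnj (G t) / complex_of_real (D t)" for t
    have k: "k \<in> cone_fun"
    proof (rule cone_funI)
      show "continuous_on {0..1} k"
        unfolding k_def using D D_cont l0 by (intro continuous_intros) auto
      show "k 0 = 0"
        using l0 by (simp add: k_def D_def cone_fun_zero[OF G(1)] of_real_norm_power2)
    qed
    have H: "H \<in> cone_fun"
      unfolding H_def using D D_cont cone_fun_continuous[OF G(1)] cone_fun_zero[OF G(1)]
      by (intro cone_funI continuous_intros) auto
    let ?t = complex_of_real
    have "(\<lambda>t. ?t t * k t + (- 1 / l) * ?t t + (- l) * k t) \<in> cone_fun"
      using k by (intro cone_fun_add cone_fun_mult cone_fun_scale cone_fun_id)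
    moreover have "?t t * k t + (- 1 / l) * ?t t + (- l) * k t = (- 1) * (H t * G t)"
      if "t \<in> {0<..1}" for t
    proof -
      have D0: "?t (D t) \<noteq> 0" using D[of t] that by simp
      have "?t (D t) = (?t t - l) * cnj (?t t - l) + G t * cnj (G t)"
        by (simp only: D_def of_real_add of_real_power of_real_norm_power2)
      then have "(?t t - l) * cnj (?t t - l) / ?t (D t) - 1 = - (cnj (G t) / ?t (D t) * G t)"
        using D0 by (simp add: field_simps)
      moreover have "?t t * k t + (- 1 / l) * ?t t + (- l) * k t
          = (?t t - l) * cnj (?t t - l) / ?t (D t) - 1"
      proof -
        have "?t t * k t + (- 1 / l) * ?t t + (- l) * k t = (?t t - l) * k t - ?t t / l"
          by (simp add: left_diff_distrib)
        also have "\<dots> = (?t t - l) * cnj (?t t - l) / ?t (D t) + ((?t t - l) / l - ?t t / l)"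
          by (simp add: k_def distrib_left)
        also have "(?t t - l) / l - ?t t / l = - 1"
          using l0 by (simp add: diff_divide_distrib)
        finally show ?thesis by simp
      qed
      ultimately show ?thesis by (simp add: H_def)
    qed
    ultimately have "\<theta> (\<lambda>t. ?t t * k t + (- 1 / l) * ?t t + (- l) * k t) = \<theta> (\<lambda>t. (- 1) * (H t * G t))"
      using H G(1) by (intro cong cone_fun_scale cone_fun_mult)
    then have *: "gen * \<theta> k + (- 1 / l) *\<^sub>C gen + (- l) *\<^sub>C \<theta> k = 0"
      using k H G(1,2)
      by (simp only: add mult scale cone_fun_add cone_fun_mult cone_fun_scale cone_fun_id
          mult_zero_right scaleC_zero_right)
    have "unitization_mult (gen, - l) (\<theta> k, - 1 / l) = (0, 1)"
      "unitization_mult (\<theta> k, - 1 / l) (gen, - l) = (0, 1)"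
      using * commute[OF k cone_fun_id] l0 by (simp_all add: unitization_mult_def add_ac)
    then show False using l unfolding spectrum_def by blast
  qed
next
  fix l assume "l \<in> insert 0 (complex_of_real ` hull_set)"
  then consider "l = 0" | s where "l = complex_of_real s" "s \<in> hull_set" by blast
  then show "l \<in> spectrum gen"
  proof cases
    case 1
    then show ?thesis by (auto simp: spectrum_def unitization_mult_def)
  next
    case 2
    have False if inv: "unitization_mult v (gen, - l) = (0, 1)" for v
    proof -
      obtain x d where v: "v = (x, d)" by (cases v)
      have xd: "x * gen + (- l) *\<^sub>C x + d *\<^sub>C gen = 0" "- (l * d) = 1"
        using inv by (simp_all add: v unitization_mult_def mult.commute)
      define M where "M = norm x + cmod d"
      have M: "M \<ge> 0" by (simp add: M_def)
      have step: "norm (\<theta> G) \<le> M * norm (\<theta> (\<lambda>t. (complex_of_real t - l) * G t))" if G: "G \<in> cone_fun" for G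
      proof -
        let ?w = "\<theta> (\<lambda>t. (complex_of_real t - l) * G t)"
        have w: "?w = gen * \<theta> G - l *\<^sub>C \<theta> G"
          using G by (simp add: left_diff_distrib diff mult scale cone_fun_mult cone_fun_scale)
        have "x * ?w + d *\<^sub>C ?w
            = (x * gen + (- l) *\<^sub>C x + d *\<^sub>C gen) * \<theta> G + (- (l * d)) *\<^sub>C \<theta> G"
          unfolding w by (simp add: algebra_simps scaleC_diff_right mult_scaleC_left mult_scaleC_right
              scaleC_scaleC scaleC_minus_left)
        then have eq: "\<theta> G = x * ?w + d *\<^sub>C ?w"
          by (simp only: xd scaleC_one mult_zero_left add_0_left)
        have "norm (x * ?w + d *\<^sub>C ?w) \<le> norm x * norm ?w + cmod d * norm ?w"
          by (intro norm_triangle_mono norm_mult_ineq) (simp add: norm_scaleC)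
        then show ?thesis
          by (subst eq) (simp add: M_def distrib_right)
      qed
      have iter: "norm (\<theta> G) \<le> M ^ n * norm (\<theta> (\<lambda>t. (complex_of_real t - l) ^ n * G t))"
        if G: "G \<in> cone_fun" for G n
        using G
      proof (induction n)
        case (Suc n)
        have mem: "(\<lambda>t. (complex_of_real t - l) ^ n * G t) \<in> cone_fun"
          using Suc.prems by (auto simp: cone_fun_def intro!: continuous_intros)
        have "M ^ n * norm (\<theta> (\<lambda>t. (complex_of_real t - l) ^ n * G t))
            \<le> M ^ n * (M * norm (\<theta> (\<lambda>t. (complex_of_real t - l) * ((complex_of_real t - l) ^ n * G t))))"
          using M step[OF mem] by (intro mult_left_mono) auto
        then show ?case using Suc by (simp add: mult_ac)
      qed simp
      \<comment> \<open>On the support of \<open>G\<close> each factor \<open>t - l\<close> has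
        modulus below \<open>r\<close>, and \<open>M * r \<le> 1 / 2\<close>, so the iterated bound
        tends to 0. The \<open>+ 1\<close> covers \<open>M = 0\<close>, and the factor
        \<open>t\<close> in \<open>G\<close> puts it into the cone.\<close>
      define r where "r = 1 / (2 * (M + 1))"
      define G where "G t = complex_of_real (t * max 0 (r - \<bar>t - s\<bar>))" for t
      have r: "r > 0" "r \<le> 1" "M * r \<le> 1 / 2"
        using M by (auto simp: r_def field_simps)
      have G: "G \<in> cone_fun"
        unfolding G_def by (auto simp: cone_fun_def intro!: continuous_intros)
      have "norm (\<theta> G) \<le> (1 / 2) ^ n" for n
      proof -
        have mem: "(\<lambda>t. (complex_of_real t - l) ^ n * G t) \<in> cone_fun"
          using G by (auto simp: cone_fun_def intro!: continuous_intros)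
        have "cmod ((complex_of_real t - l) ^ n * G t) \<le> r ^ n" if "t \<in> {0<..1}" for t
        proof (cases "\<bar>t - s\<bar> < r")
          case True
          have "cmod (complex_of_real t - l) = \<bar>t - s\<bar>"
            unfolding 2 by (metis norm_of_real of_real_diff)
          moreover have "cmod (G t) \<le> 1"
            unfolding G_def norm_of_real abs_mult using that r True by (intro mult_le_one) auto
          ultimately show ?thesis
            using True power_mono[of "\<bar>t - s\<bar>" r n] r
            by (simp add: norm_mult norm_power)
               (metis abs_ge_zero less_eq_real_def mult.right_neutral mult_mono norm_ge_zero power_mono zero_le_power)
        next
          case False
          then show ?thesis using r by (simp add: G_def)
        qed
        then have "M ^ n * norm (\<theta> (\<lambda>t. (complex_of_real t - l) ^ n * G t)) \<le> M ^ n * r ^ n"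
          using M by (intro mult_left_mono norm_le[OF mem]) auto
        also have "\<dots> = (M * r) ^ n" by (simp add: power_mult_distrib)
        also have "\<dots> \<le> (1 / 2) ^ n" using r M by (intro power_mono) auto
        finally show ?thesis using iter[OF G, of n] by simp
      qed
      then have "norm (\<theta> G) \<le> 0"
        by (intro LIMSEQ_le_const[OF LIMSEQ_realpow_zero[of "1/2"]]) auto
      then have "G s = 0" using 2 G unfolding hull_set_def by simp
      then show False using r 2 by (simp add: G_def hull_set_def)
    qed
    then show ?thesis by (auto simp: spectrum_def)
  qed
qed

lemma adj_gen: "adj gen = gen"
  using cnj[OF cone_fun_id] unfolding complex_cnj_complex_of_real by (rule sym)

lemma positive_gen: "positive gen"
  by (auto simp: positive_def adj_gen spectrum_gen hull_set_def)

end

text \<open>\<open>X\<close> will be the nonzero spectrum of a generator, a subset of the complex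
  plane, and \<open>h\<close> the real part: every candidate for the functional calculus then pulls
  back to the cone.\<close>

lemma cone_hom_if_star_hom:
  assumes \<Phi>: "star_hom (C0 X) B \<Phi>"
    and mem: "\<And>F. F \<in> cone_fun \<Longrightarrow> restrict_zero X (F \<circ> h) \<in> C0_functions X"
    and h: "\<And>z. z \<in> X \<Longrightarrow> h z \<in> {0<..1}"
  shows "cone_hom (\<lambda>F. \<Phi> (restrict_zero X (F \<circ> h)))"
proof
  fix F G assume "F \<in> cone_fun" "G \<in> cone_fun" and eq: "\<And>t. t \<in> {0<..1} \<Longrightarrow> F t = G t"
  have "restrict_zero X (F \<circ> h) = restrict_zero X (G \<circ> h)"
    using eq h by (auto simp: restrict_zero_def fun_eq_iff)
  then show "\<Phi> (restrict_zero X (F \<circ> h)) = \<Phi> (restrict_zero X (G \<circ> h))" by simp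
next
  fix F G assume FG: "F \<in> cone_fun" "G \<in> cone_fun"
  let ?R = "\<lambda>F. restrict_zero X (F \<circ> h)"
  have "?R (\<lambda>t. F t + G t) = sa_add (C0 X) (?R F) (?R G)"
    "?R (\<lambda>t. F t * G t) = sa_mult (C0 X) (?R F) (?R G)"
    by (auto simp: restrict_zero_def fun_eq_iff C0_def)
  moreover have "?R F \<in> sa_carrier (C0 X)" "?R G \<in> sa_carrier (C0 X)"
    using mem FG by (simp_all add: C0_def)
  ultimately show "\<Phi> (?R (\<lambda>t. F t + G t)) = \<Phi> (?R F) + \<Phi> (?R G)"
    "\<Phi> (?R (\<lambda>t. F t * G t)) = \<Phi> (?R F) * \<Phi> (?R G)"
    using \<Phi> unfolding star_hom_def by simp_all
next
  fix F c assume F: "F \<in> cone_fun"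
  let ?R = "\<lambda>F. restrict_zero X (F \<circ> h)"
  have "?R (\<lambda>t. c * F t) = sa_scale (C0 X) c (?R F)" "?R (\<lambda>t. cnj (F t)) = sa_star (C0 X) (?R F)"
    by (auto simp: restrict_zero_def fun_eq_iff C0_def)
  moreover have "?R F \<in> sa_carrier (C0 X)"
    using mem F by (simp add: C0_def)
  ultimately show "\<Phi> (?R (\<lambda>t. c * F t)) = c *\<^sub>C \<Phi> (?R F)" "\<Phi> (?R (\<lambda>t. cnj (F t))) = adj (\<Phi> (?R F))"
    using \<Phi> unfolding star_hom_def by simp_all
qed

section \<open>Uniqueness of the homomorphism with a given generator\<close>

lemma cone_fun_polynomial:
  "real_polynomial_function p \<Longrightarrow> (\<lambda>t. complex_of_real (p t - p 0)) \<in> cone_fun"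
  by (intro cone_funI continuous_intros continuous_on_polymonial_function)
     (auto simp: real_polynomial_function_eq)

text \<open>The constant term is subtracted to stay in the cone. In a product the subtracted
  constants come back as scalar multiples of the other factor.\<close>

lemma cone_hom_eq_polynomial:
  assumes "cone_hom \<theta>" "cone_hom \<theta>'" and gen: "\<theta> complex_of_real = \<theta>' complex_of_real"
    and "real_polynomial_function p"
  shows "\<theta> (\<lambda>t. complex_of_real (p t - p 0)) = \<theta>' (\<lambda>t. complex_of_real (p t - p 0))"
proof -
  interpret T: cone_hom \<theta> by fact
  interpret T': cone_hom \<theta>' by fact
  show ?thesis
    using assms(4)
  proof (induction p rule: real_polynomial_function.induct)
    case (linear f)
    have "f t = t * f 1" for t
      using linear_scale[OF bounded_linear.linear[OF linear], of t 1] by simp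
    then have "(\<lambda>t. complex_of_real (f t - f 0)) = (\<lambda>t. complex_of_real (f 1) * complex_of_real t)"
      by (metis (no_types, opaque_lifting) diff_zero mult.commute mult_zero_left of_real_mult)
    then show ?case by (simp add: T.scale T'.scale gen)
  next
    case (const c)
    show ?case by simp
  next
    case (add f g)
    have "(\<lambda>t. complex_of_real (f t + g t - (f 0 + g 0)))
        = (\<lambda>t. complex_of_real (f t - f 0) + complex_of_real (g t - g 0))"
      by (simp add: fun_eq_iff)
    then show ?case
      using add.IH by (simp only: T.add T'.add cone_fun_polynomial[OF add.hyps(1)] cone_fun_polynomial[OF add.hyps(2)])
  next
    case (mult f g)
    note m = cone_fun_polynomial[OF mult.hyps(1)] cone_fun_polynomial[OF mult.hyps(2)]
    have "(\<lambda>t. complex_of_real (f t * g t - f 0 * g 0))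
        = (\<lambda>t. complex_of_real (f t - f 0) * complex_of_real (g t - g 0)
            + (complex_of_real (f 0) * complex_of_real (g t - g 0)
              + complex_of_real (g 0) * complex_of_real (f t - f 0)))"
      by (simp add: fun_eq_iff algebra_simps)
    then show ?case
      using mult.IH m
      by (simp only: T.add T'.add T.mult T'.mult T.scale T'.scale cone_fun_add cone_fun_mult cone_fun_scale)
  qed
qed

text \<open>Polynomials without constant term are uniformly dense by the Stone-Weierstrass theorem,
  applied to real and imaginary parts, and both maps are contractive.\<close>

lemma cone_hom_eqI:
  assumes "cone_hom \<theta>" "cone_hom \<theta>'" and gen: "\<theta> complex_of_real = \<theta>' complex_of_real"
    and F: "F \<in> cone_fun"
  shows "\<theta> F = \<theta>' F"
proof -
  interpret T: cone_hom \<theta> by fact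
  interpret T': cone_hom \<theta>' by fact
  have approx: "\<exists>p. real_polynomial_function p \<and> (\<forall>t\<in>{0..1}. \<bar>f t - (p t - p 0)\<bar> \<le> e)"
    if "continuous_on {0..1} f" "f 0 = 0" "e > 0" for f :: "real \<Rightarrow> real" and e
  proof -
    \<comment> \<open>The tolerance is halved because subtracting \<open>p 0\<close> can double the
      error.\<close>
    have "\<exists>p. polynomial_function p \<and> (\<forall>t\<in>{0..1}. norm (f t - p t) < e / 2)"
      using that by (intro Stone_Weierstrass_polynomial_function) auto
    then obtain p where p: "real_polynomial_function p" "\<And>t. t \<in> {0..1} \<Longrightarrow> norm (f t - p t) < e / 2"
      unfolding real_polynomial_function_eq by blast
    have "\<bar>f t - (p t - p 0)\<bar> \<le> e" if "t \<in> {0..1}" for t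
      using p(2)[OF that] p(2)[of 0] \<open>f 0 = 0\<close> unfolding real_norm_def atLeastAtMost_iff
      by linarith
    then show ?thesis using p(1) by blast
  qed
  have le: "norm (\<theta> F - \<theta>' F) \<le> e" if "e > 0" for e
  proof -
    obtain p where p: "real_polynomial_function p" "\<forall>t\<in>{0..1}. \<bar>Re (F t) - (p t - p 0)\<bar> \<le> e / 4"
      using approx[of "\<lambda>t. Re (F t)" "e / 4"] continuous_on_Re[OF cone_fun_continuous[OF F]]
        cone_fun_zero[OF F] \<open>e > 0\<close> by auto
    obtain q where q: "real_polynomial_function q" "\<forall>t\<in>{0..1}. \<bar>Im (F t) - (q t - q 0)\<bar> \<le> e / 4"
      using approx[of "\<lambda>t. Im (F t)" "e / 4"] continuous_on_Im[OF cone_fun_continuous[OF F]]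
        cone_fun_zero[OF F] \<open>e > 0\<close> by auto
    define P where "P t = complex_of_real (p t - p 0)" for t
    define Q where "Q t = complex_of_real (q t - q 0)" for t
    have mem: "P \<in> cone_fun" "Q \<in> cone_fun"
      unfolding P_def Q_def using p(1) q(1) cone_fun_polynomial by auto
    let ?H = "\<lambda>t. P t + \<i> * Q t"
    have H: "?H \<in> cone_fun" using mem by (intro cone_fun_add cone_fun_scale)
    have "\<theta> P = \<theta>' P" "\<theta> Q = \<theta>' Q"
      unfolding P_def Q_def
      using cone_hom_eq_polynomial[OF assms(1,2) gen] p(1) q(1) by auto
    then have eq: "\<theta> ?H = \<theta>' ?H"
      using mem by (simp add: T.add T'.add T.scale T'.scale cone_fun_scale)
    have bound: "cmod (F t - ?H t) \<le> e / 2" if "t \<in> {0..1}" for t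
    proof -
      have "cmod (F t - ?H t) \<le> \<bar>Re (F t) - (p t - p 0)\<bar> + \<bar>Im (F t) - (q t - q 0)\<bar>"
        using cmod_le[of "F t - ?H t"] by (simp add: P_def Q_def)
      also have "\<dots> \<le> e / 4 + e / 4"
        using p(2) q(2) that by (intro add_mono) auto
      finally show ?thesis by simp
    qed
    have "\<theta> F - \<theta>' F = (\<theta> F - \<theta> ?H) - (\<theta>' F - \<theta>' ?H)"
      unfolding eq by simp
    then have "norm (\<theta> F - \<theta>' F) \<le> norm (\<theta> F - \<theta> ?H) + norm (\<theta>' F - \<theta>' ?H)"
      by (simp only: norm_triangle_ineq4)
    also have "\<dots> \<le> e / 2 + e / 2"
      by (rule add_mono[OF T.norm_diff_le[OF F H bound] T'.norm_diff_le[OF F H bound]])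
    finally show ?thesis by simp
  qed
  have "norm (\<theta> F - \<theta>' F) \<le> 0"
    by (rule field_le_epsilon, unfold add_0_left, rule le)
  then show ?thesis by simp
qed

context cone_hom
begin

section \<open>Functional calculus of the generator\<close>

lemma spectrum_gen_nonzero: "spectrum gen - {0} = complex_of_real ` hull_set"
  unfolding spectrum_gen hull_set_def by auto

lemma hull_set_subset: "hull_set \<subseteq> {0<..1}"
  unfolding hull_set_def by blast

lemma restrict_in_C0_spectrum:
  assumes F: "F \<in> cone_fun"
  shows "restrict_zero (complex_of_real ` hull_set) (F \<circ> Re) \<in> C0_functions (complex_of_real ` hull_set)"
    (is "restrict_zero ?X _ \<in> _")
  unfolding C0_functions_def
proof (intro CollectI conjI allI impI)
  have "continuous_on ?X (F \<circ> Re)"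
    using hull_set_subset
    by (intro continuous_on_compose continuous_intros continuous_on_subset[OF cone_fun_continuous[OF F]])
       (auto simp: image_image intro: less_imp_le)
  then show "continuous_on ?X (restrict_zero ?X (F \<circ> Re))"
    by (rule continuous_on_eq) (auto simp: restrict_zero_def)
  fix e :: real assume "e > 0"
  \<comment> \<open>Adding 0 to the hull makes it compact and leaves this set unchanged, because
    \<open>F\<close> vanishes at 0.\<close>
  then have "{z\<in>?X. e \<le> cmod (restrict_zero ?X (F \<circ> Re) z)}
      = complex_of_real ` {t\<in>insert 0 hull_set. e \<le> cmod (F t)}"
    using cone_fun_zero[OF F] by (auto simp: restrict_zero_def)
  moreover have "compact {t\<in>insert 0 hull_set. e \<le> cmod (F t)}"
    using hull_set_subset
    by (intro compact_norm_ge compact_insert_hull continuous_on_subset[OF cone_fun_continuous[OF F]]) force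
  ultimately show "compact {z\<in>?X. e \<le> cmod (restrict_zero ?X (F \<circ> Re) z)}"
    by (simp only:) (intro compact_continuous_image continuous_intros)
qed (auto simp: restrict_zero_def)

text \<open>The hull with 0 added is closed in the unit interval, so Tietze's theorem applies once
  \<open>g\<close> is continued by 0.\<close>

lemma cone_extension:
  assumes g: "g \<in> C0_functions (complex_of_real ` hull_set)"
  obtains E where "E \<in> cone_fun" "\<And>t. t \<in> hull_set \<Longrightarrow> E t = g (complex_of_real t)"
proof -
  have "0 \<notin> complex_of_real ` hull_set" using hull_set_subset by auto
  then have g0: "g 0 = 0" using g by (simp add: C0_functions_def)
  have "continuous_on (insert 0 (complex_of_real ` hull_set)) g"
    using g g0 \<open>0 \<notin> _\<close> by (intro continuous_on_insert_vanishing) (auto simp: C0_functions_def)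
  then have "continuous_on (insert 0 hull_set) (\<lambda>t. g (complex_of_real t))"
    by (rule continuous_on_compose2) (auto intro!: continuous_intros)
  moreover have "closedin (top_of_set {0..1}) (insert 0 hull_set)"
    using compact_imp_closed[OF compact_insert_hull] hull_set_subset
    by (intro closed_subset) (auto intro: less_imp_le)
  ultimately obtain E where E: "continuous_on {0..1} E"
    "\<And>t. t \<in> insert 0 hull_set \<Longrightarrow> E t = g (complex_of_real t)"
    using Tietze_unbounded[of "insert 0 hull_set" "\<lambda>t. g (complex_of_real t)" "{0..1}"] by blast
  then show ?thesis using that[of E] g0 by (auto simp: cone_fun_def)
qed

text \<open>The definite description needs existence and uniqueness. A homomorphism is obtained by
  extending functions from the spectrum to the interval and applying \<open>\<theta>\<close>, which
  depends only on values on the hull. Any other one pulls back to a homomorphism on the cone with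
  the same generator.\<close>

lemma functional_calculus_gen:
  assumes F: "F \<in> cone_fun" and h: "\<And>t. t \<in> {0<..1} \<Longrightarrow> h (complex_of_real t) = F t"
  shows "functional_calculus gen h = \<theta> F"
proof -
  define X where "X = complex_of_real ` hull_set"
  have restrict_eq: "restrict_zero X h = restrict_zero X (F \<circ> Re)"
    "restrict_zero X (\<lambda>z. z) = restrict_zero X (complex_of_real \<circ> Re)"
    using h hull_set_subset by (auto simp: X_def restrict_zero_def fun_eq_iff)
  define ext where "ext g = (SOME E. E \<in> cone_fun \<and> (\<forall>t\<in>hull_set. E t = g (complex_of_real t)))" for g
  have ext: "ext g \<in> cone_fun" "\<And>t. t \<in> hull_set \<Longrightarrow> ext g t = g (complex_of_real t)"
    if "\<exists>E\<in>cone_fun. \<forall>t\<in>hull_set. E t = g (complex_of_real t)" for g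
    using someI_ex[of "\<lambda>E. E \<in> cone_fun \<and> (\<forall>t\<in>hull_set. E t = g (complex_of_real t))"] that
    unfolding ext_def by blast+
  have extC: "\<exists>E\<in>cone_fun. \<forall>t\<in>hull_set. E t = g (complex_of_real t)" if "g \<in> C0_functions X" for g
    using cone_extension[of g] that unfolding X_def by metis
  define \<Phi> where "\<Phi> g = \<theta> (ext g)" for g
  have \<Phi>_eq: "\<Phi> g = \<theta> E" if "E \<in> cone_fun" "\<And>t. t \<in> hull_set \<Longrightarrow> E t = g (complex_of_real t)" for g E
    unfolding \<Phi>_def using ext[of g] that by (intro eq_if_eq_on_hull) auto
  have \<Phi>_restrict: "\<Phi> (restrict_zero X (G \<circ> Re)) = \<theta> G" if "G \<in> cone_fun" for G
    using that by (intro \<Phi>_eq) (auto simp: X_def restrict_zero_def)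
  have "star_hom (C0 X) UNIV \<Phi>"
    unfolding star_hom_def
  proof (intro conjI ballI allI)
    fix f g c assume "f \<in> sa_carrier (C0 X)" "g \<in> sa_carrier (C0 X)"
    then have fg: "f \<in> C0_functions X" "g \<in> C0_functions X" by (simp_all add: C0_def)
    note e = ext[OF extC[OF fg(1)]] ext[OF extC[OF fg(2)]]
    show "\<Phi> (sa_add (C0 X) f g) = \<Phi> f + \<Phi> g"
      unfolding \<Phi>_def[of f] \<Phi>_def[of g] add[OF e(1,3), symmetric]
      by (rule \<Phi>_eq) (use e in \<open>simp_all add: C0_def cone_fun_add\<close>)
    show "\<Phi> (sa_mult (C0 X) f g) = \<Phi> f * \<Phi> g"
      unfolding \<Phi>_def[of f] \<Phi>_def[of g] mult[OF e(1,3), symmetric]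
      by (rule \<Phi>_eq) (use e in \<open>simp_all add: C0_def cone_fun_mult\<close>)
    show "\<Phi> (sa_scale (C0 X) c f) = c *\<^sub>C \<Phi> f"
      unfolding \<Phi>_def[of f] scale[OF e(1), symmetric]
      by (rule \<Phi>_eq) (use e in \<open>simp_all add: C0_def cone_fun_scale\<close>)
    show "\<Phi> (sa_star (C0 X) f) = adj (\<Phi> f)"
      unfolding \<Phi>_def[of f] cnj[OF e(1), symmetric]
      by (rule \<Phi>_eq) (use e in \<open>simp_all add: C0_def cone_fun_cnj\<close>)
  qed simp
  moreover have "\<Psi> (restrict_zero X (F \<circ> Re)) = \<theta> F"
    if \<Psi>: "star_hom (C0 X) UNIV \<Psi>" "\<Psi> (restrict_zero X (complex_of_real \<circ> Re)) = gen" for \<Psi>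
  proof -
    have "cone_hom (\<lambda>F. \<Psi> (restrict_zero X (F \<circ> Re)))"
      using restrict_in_C0_spectrum hull_set_subset unfolding X_def
      by (intro cone_hom_if_star_hom[OF \<Psi>(1)[unfolded X_def]]) auto
    then show ?thesis
      using cone_hom_eqI[OF _ cone_hom_axioms _ F] \<Psi>(2) by blast
  qed
  ultimately show ?thesis
    unfolding functional_calculus_def spectrum_gen_nonzero X_def[symmetric] restrict_eq
    using \<Phi>_restrict[OF F] \<Phi>_restrict[OF cone_fun_id] by (intro the_equality) blast+
qed

lemma cut_down_gen:
  assumes "\<delta> \<ge> 0"
  shows "cut_down gen \<delta> = \<theta> (\<lambda>t. complex_of_real (max (t - \<delta>) 0))"
  unfolding cut_down_def using assms
  by (intro functional_calculus_gen) (auto simp: cone_fun_def intro!: continuous_intros)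

end

lemma closed_vimage_mult:
  fixes V :: "'a::real_normed_algebra set"
  assumes "closed V"
  shows "closed {x. p * x * q \<in> V}"
proof -
  have "closed ((\<lambda>x. p * x * q) -` V)"
    by (intro closed_vimage assms continuous_intros)
  then show ?thesis by (simp add: vimage_def)
qed

lemma closed_vimage_mult_left:
  fixes V :: "'a::real_normed_algebra set"
  assumes "closed V"
  shows "closed {x. p * x \<in> V}"
proof -
  have "closed ((\<lambda>x. p * x) -` V)"
    by (intro closed_vimage assms continuous_intros)
  then show ?thesis by (simp add: vimage_def)
qed

lemma closed_vimage_mult_right:
  fixes V :: "'a::real_normed_algebra set"
  assumes "closed V"
  shows "closed {x. x * q \<in> V}"
proof -
  have "closed ((\<lambda>x. x * q) -` V)"
    by (intro closed_vimage assms continuous_intros)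
  then show ?thesis by (simp add: vimage_def)
qed

section \<open>Hereditary subalgebras\<close>

lemma closed_hereditary: "closed (hereditary a)"
  by (simp add: hereditary_def)

lemma mult_in_hereditary: "a * x * a \<in> hereditary a"
  unfolding hereditary_def by (rule closure_subset[THEN subsetD]) blast

lemma closure_add:
  fixes S :: "'a::real_normed_vector set"
  assumes "\<And>x y. x \<in> S \<Longrightarrow> y \<in> S \<Longrightarrow> x + y \<in> S" "x \<in> closure S" "y \<in> closure S"
  shows "x + y \<in> closure S"
proof -
  obtain f g where "\<And>n. f n \<in> S" "f \<longlonglongrightarrow> x" "\<And>n. g n \<in> S" "g \<longlonglongrightarrow> y"
    using assms(2,3) unfolding closure_sequential by blast
  then show ?thesis
    unfolding closure_sequential using assms(1) by (intro exI[of _ "\<lambda>n. f n + g n"]) (auto intro: tendsto_add)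
qed

lemma hereditary_zero: "0 \<in> hereditary a"
  using mult_in_hereditary[of a 0] by simp

lemma hereditary_add:
  assumes "x \<in> hereditary a" "y \<in> hereditary a"
  shows "x + y \<in> hereditary a"
  unfolding hereditary_def
proof (rule closure_add)
  fix u v assume "u \<in> {a * x * a | x. True}" "v \<in> {a * x * a | x. True}"
  then obtain p q where "u = a * p * a" "v = a * q * a" by blast
  then have "u + v = a * (p + q) * a" by (simp add: algebra_simps)
  then show "u + v \<in> {a * x * a | x. True}" by blast
qed (use assms in \<open>simp_all add: hereditary_def\<close>)

lemma hereditary_scaleR:
  assumes "x \<in> hereditary a"
  shows "c *\<^sub>R x \<in> hereditary a"
proof -
  have "closed ((\<lambda>x. c *\<^sub>R x) -` hereditary a)"
    unfolding hereditary_def by (intro closed_vimage continuous_intros closed_closure)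
  moreover have "c *\<^sub>R (a * x * a) \<in> hereditary a" for x
    using mult_in_hereditary[of a "c *\<^sub>R x"] by simp
  ultimately have "closure {a * x * a | x. True} \<subseteq> (\<lambda>x. c *\<^sub>R x) -` hereditary a"
    by (intro closure_minimal) auto
  then show ?thesis using assms by (auto simp: hereditary_def)
qed

lemma hereditary_subset_if:
  assumes "closed V" "\<And>x. a * x * a \<in> V"
  shows "hereditary a \<subseteq> V"
  unfolding hereditary_def using assms by (intro closure_minimal) auto

text \<open>Two density arguments, one for each outer factor.\<close>

lemma hereditary_sandwich:
  assumes y: "y \<in> hereditary a" and z: "z \<in> hereditary a"
  shows "y * x * z \<in> hereditary a"
proof -
  have "hereditary a \<subseteq> {z. a * u * a * x * z \<in> hereditary a}" for u
    using mult_in_hereditary[of a "u * a * x * a * _"]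
    by (intro hereditary_subset_if closed_vimage_mult_left closed_hereditary) (simp add: mult.assoc)
  then have "a * u * a * x * z \<in> hereditary a" for u
    using z by blast
  then have "hereditary a \<subseteq> {y. y * (x * z) \<in> hereditary a}"
    by (intro hereditary_subset_if closed_vimage_mult_right closed_hereditary) (simp add: mult.assoc)
  then show ?thesis using y by (auto simp: mult.assoc)
qed

text \<open>Here the outer factor is \<open>a\<close> itself, so that membership of \<open>a\<close>
  in \<open>hereditary a\<close> is not presupposed.\<close>

lemma hereditary_mult_left:
  assumes "z \<in> hereditary a"
  shows "a * x * z \<in> hereditary a"
proof -
  have "hereditary a \<subseteq> {z. a * x * z \<in> hereditary a}"
    using mult_in_hereditary[of a "x * a * _"]
    by (intro hereditary_subset_if closed_vimage_mult_left closed_hereditary) (simp add: mult.assoc)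
  then show ?thesis using assms by blast
qed

lemma hereditary_mult_right:
  assumes "z \<in> hereditary a"
  shows "z * x * a \<in> hereditary a"
proof -
  have "hereditary a \<subseteq> {z. z * (x * a) \<in> hereditary a}"
    using mult_in_hereditary[of a "_ * a * x"]
    by (intro hereditary_subset_if closed_vimage_mult_right closed_hereditary) (simp add: mult.assoc)
  then show ?thesis using assms by (auto simp: mult.assoc)
qed

lemma hereditary_mono: "d \<in> hereditary a \<Longrightarrow> hereditary d \<subseteq> hereditary a"
  by (intro hereditary_subset_if closed_hereditary hereditary_sandwich)

lemma hereditary_annihilated_left:
  assumes "z * a = 0" "y \<in> hereditary a"
  shows "z * y = 0"
proof -
  have "hereditary a \<subseteq> {y. z * y \<in> {0}}"
    using assms(1) by (intro hereditary_subset_if closed_vimage_mult_left) (simp_all flip: mult.assoc)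
  then show ?thesis using assms(2) by blast
qed

lemma hereditary_annihilated_right:
  assumes "a * z = 0" "y \<in> hereditary a"
  shows "y * z = 0"
proof -
  have "hereditary a \<subseteq> {y. y * z \<in> {0}}"
    using assms(1) by (intro hereditary_subset_if closed_vimage_mult_right) (simp_all add: mult.assoc)
  then show ?thesis using assms(2) by blast
qed

section \<open>Closed ideals\<close>

lemma closed_idealD:
  assumes "closed_ideal UNIV I"
  shows "closed I" "0 \<in> I" "x \<in> I \<Longrightarrow> y \<in> I \<Longrightarrow> x + y \<in> I" "x \<in> I \<Longrightarrow> c *\<^sub>C x \<in> I"
    "x \<in> I \<Longrightarrow> b * x \<in> I" "x \<in> I \<Longrightarrow> x * b \<in> I"
  using assms unfolding closed_ideal_def by auto

lemma closed_ideal_ideal_generated: "closed_ideal UNIV (ideal_generated X)"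
  unfolding ideal_generated_def hull_def closed_ideal_def by (auto intro!: closed_Inter)

lemma ideal_generated_superset: "X \<subseteq> ideal_generated X"
  unfolding ideal_generated_def by (rule hull_subset)

lemma ideal_generated_least: "closed_ideal UNIV I \<Longrightarrow> X \<subseteq> I \<Longrightarrow> ideal_generated X \<subseteq> I"
  unfolding ideal_generated_def by (rule hull_minimal)

lemma in_ideal_generatedI:
  assumes "\<And>I. closed_ideal UNIV I \<Longrightarrow> X \<subseteq> I \<Longrightarrow> x \<in> I"
  shows "x \<in> ideal_generated X"
  using assms closed_ideal_ideal_generated ideal_generated_superset by blast

lemma closed_ideal_closure_Union:
  fixes J :: "nat \<Rightarrow> 'a::cstar_algebra set"
  assumes J: "\<And>n. closed_ideal UNIV (J n)" and mono: "\<And>m n. m \<le> n \<Longrightarrow> J m \<subseteq> J n"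
  shows "closed_ideal UNIV (closure (\<Union>n. J n))"
proof -
  let ?U = "\<Union>n. J n"
  have add: "x + y \<in> ?U" if xy: "x \<in> ?U" "y \<in> ?U" for x y
  proof -
    obtain m where "x \<in> J m" using xy(1) by blast
    moreover obtain n where "y \<in> J n" using xy(2) by blast
    ultimately have "x \<in> J (max m n)" "y \<in> J (max m n)"
      using mono[of m "max m n"] mono[of n "max m n"] by auto
    then show ?thesis using closed_idealD(3)[OF J] by blast
  qed
  have ops: "c *\<^sub>C x \<in> ?U" "b * x \<in> ?U" "x * b \<in> ?U" if "x \<in> ?U" for x b c
    using that closed_idealD(4)[OF J] closed_idealD(5)[OF J] closed_idealD(6)[OF J] by (fast, fast, fast)
  have zero: "0 \<in> closure ?U"
    using closed_idealD(2)[OF J] closure_subset[of ?U] by blast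
  have left: "closure ?U \<subseteq> {x. b * x \<in> closure ?U}" for b
    using ops(2) closure_subset[of ?U]
    by (intro closure_minimal closed_vimage_mult_left closed_closure) blast
  have right: "closure ?U \<subseteq> {x. x * b \<in> closure ?U}" for b
    using ops(3) closure_subset[of ?U]
    by (intro closure_minimal closed_vimage_mult_right closed_closure) blast
  have scale: "closure ?U \<subseteq> {x. c *\<^sub>C x \<in> closure ?U}" for c
  proof (rule closure_minimal)
    show "?U \<subseteq> {x. c *\<^sub>C x \<in> closure ?U}"
      using ops(1) closure_subset[of ?U] by blast
    have "closed ((\<lambda>x. c *\<^sub>C x) -` closure ?U)"
      by (intro closed_vimage closed_closure linear_continuous_on bounded_linear_scaleC)
    then show "closed {x. c *\<^sub>C x \<in> closure ?U}" by (simp add: vimage_def)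
  qed
  show ?thesis
    unfolding closed_ideal_def
    by (intro conjI ballI allI closed_closure subset_UNIV zero closure_add[OF add])
       (use left right scale in blast)+
qed

section \<open>Cut-downs and the ideals they generate\<close>

definition cut :: "real \<Rightarrow> real \<Rightarrow> complex" where
  "cut \<delta> t = complex_of_real (max (t - \<delta>) 0)"

lemma cone_fun_cut: "\<delta> \<ge> 0 \<Longrightarrow> cut \<delta> \<in> cone_fun"
  unfolding cut_def by (auto simp: cone_fun_def intro!: continuous_intros)

lemma cut_nonzero_iff: "cut \<delta> t \<noteq> 0 \<longleftrightarrow> t > \<delta>"
  by (auto simp: cut_def max_def)

context cone_hom
begin

lemma cone_ideal_closed_ideal:
  assumes "closed_ideal UNIV I"
  shows "cone_ideal {F\<in>cone_fun. \<theta> F \<in> I}"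
  using closed_idealD[OF assms] by (intro cone_ideal_vimage) auto

lemma in_closed_ideal_if_support:
  assumes "closed_ideal UNIV I" "G \<in> cone_fun" "\<theta> G \<in> I" "F \<in> cone_fun"
    and "\<And>t. t \<in> {0<..1} \<Longrightarrow> F t \<noteq> 0 \<Longrightarrow> G t \<noteq> 0"
  shows "\<theta> F \<in> I"
proof -
  have "F \<in> {F\<in>cone_fun. \<theta> F \<in> I}"
    using assms by (intro cone_ideal_memI[OF cone_ideal_closed_ideal]) auto
  then show ?thesis by simp
qed

text \<open>A function \<open>g\<close> that inverts \<open>H\<close> on the support of
  \<open>F\<close> has norm at most \<open>1 / \<eta>\<close>, so
  \<open>w = \<theta> g * (\<theta> H - y)\<close> has norm below 1. Modulo \<open>I\<close> one
  gets \<open>\<theta> F = \<theta> F * w\<close>, and iterating shows that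
  \<open>\<theta> F\<close> has distance 0 from \<open>I\<close>.\<close>

lemma in_closed_ideal_if_near:
  assumes I: "closed_ideal UNIV I" and H: "H \<in> cone_fun" and F: "F \<in> cone_fun"
    and y: "y \<in> I" "norm (\<theta> H - y) < \<eta>"
    and supp: "\<And>t. t \<in> {0<..1} \<Longrightarrow> F t \<noteq> 0 \<Longrightarrow> \<eta> \<le> cmod (H t)"
  shows "\<theta> F \<in> I"
proof -
  have \<eta>: "\<eta> > 0" using y(2) norm_ge_zero order_le_less_trans by blast
  \<comment> \<open>The maximum makes \<open>g\<close> continuous and bounded by
    \<open>1 / \<eta>\<close>; on the support of \<open>F\<close> it is the modulus of
    \<open>H\<close>, whence \<open>g t * H t = 1\<close> there.\<close>
  define g where "g t = cnj (H t) / complex_of_real ((max (cmod (H t)) \<eta>)\<^sup>2)" for t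
  have max_pos: "max (cmod z) \<eta> > 0" for z using \<eta> by simp
  have g: "g \<in> cone_fun"
  proof (rule cone_funI)
    have "complex_of_real ((max (cmod (H t)) \<eta>)\<^sup>2) \<noteq> 0" for t
      using max_pos[of "H t"] by simp
    then show "continuous_on {0..1} g"
      unfolding g_def using cone_fun_continuous[OF H] by (intro continuous_intros ballI)
  qed (simp add: g_def cone_fun_zero[OF H])
  have "norm (\<theta> g) \<le> 1 / \<eta>"
  proof (rule norm_le[OF g])
    fix t
    let ?m = "max (cmod (H t)) \<eta>"
    have "cmod (g t) = cmod (H t) / ?m\<^sup>2"
      unfolding g_def norm_divide norm_of_real by simp
    also have "\<dots> \<le> ?m / ?m\<^sup>2" by (intro divide_right_mono) auto
    also have "\<dots> = 1 / ?m" using max_pos[of "H t"] by (simp add: power2_eq_square)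
    also have "\<dots> \<le> 1 / \<eta>" using \<eta> by (intro divide_left_mono) auto
    finally show "cmod (g t) \<le> 1 / \<eta>" .
  qed
  define w where "w = \<theta> g * (\<theta> H - y)"
  define \<rho> where "\<rho> = norm (\<theta> H - y) / \<eta>"
  have \<rho>: "0 \<le> \<rho>" "\<rho> < 1" using y(2) \<eta> by (auto simp: \<rho>_def)
  have w: "norm w \<le> \<rho>"
    using norm_mult_ineq[of "\<theta> g" "\<theta> H - y"]
      mult_right_mono[OF \<open>norm (\<theta> g) \<le> 1 / \<eta>\<close>, of "norm (\<theta> H - y)"]
    by (simp add: w_def \<rho>_def)
  have "F t * (g t * H t) = F t" if "t \<in> {0<..1}" for t
  proof (cases "F t = 0")
    case False
    then have m: "\<eta> \<le> cmod (H t)" using supp that by blast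
    then have "cnj (H t) * H t = complex_of_real ((max (cmod (H t)) \<eta>)\<^sup>2)"
      by (simp add: of_real_norm_power2 mult.commute max_def)
    moreover have "H t \<noteq> 0" using m \<eta> by auto
    ultimately have "g t * H t = 1" unfolding g_def times_divide_eq_left
      by (metis complex_cnj_zero_iff divide_self mult_eq_0_iff)
    then show ?thesis by simp
  qed simp
  then have "\<theta> (\<lambda>t. F t * (g t * H t)) = \<theta> F"
    using F g H by (intro cong cone_fun_mult)
  then have "\<theta> F = \<theta> F * (\<theta> g * \<theta> H)"
    using F g H by (simp add: mult cone_fun_mult)
  then have eq: "\<theta> F = \<theta> F * w + \<theta> F * \<theta> g * y"
    by (simp add: w_def algebra_simps)
  have approx: "\<exists>i\<in>I. norm (\<theta> F - i) \<le> norm (\<theta> F) * \<rho> ^ n" for n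
  proof (induction n)
    case 0
    then show ?case using closed_idealD(2)[OF I] by (intro bexI[of _ 0]) auto
  next
    case (Suc n)
    then obtain i where i: "i \<in> I" "norm (\<theta> F - i) \<le> norm (\<theta> F) * \<rho> ^ n" by blast
    let ?i = "i * w + \<theta> F * \<theta> g * y"
    have "\<theta> F - ?i = (\<theta> F - i) * w"
      by (subst eq) (simp add: algebra_simps)
    then have "norm (\<theta> F - ?i) \<le> norm (\<theta> F - i) * norm w"
      by (simp add: norm_mult_ineq)
    also have "\<dots> \<le> (norm (\<theta> F) * \<rho> ^ n) * \<rho>"
      using i(2) w \<rho> by (intro mult_mono) auto
    finally have "norm (\<theta> F - ?i) \<le> norm (\<theta> F) * \<rho> ^ Suc n" by (simp add: mult_ac)
    moreover have "?i \<in> I" 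
      by (rule closed_idealD(3)[OF I closed_idealD(6)[OF I i(1)] closed_idealD(5)[OF I y(1)]])
    ultimately show ?case by (intro bexI[of _ ?i])
  qed
  have "\<theta> F \<in> closure I"
    unfolding closure_approachable
  proof (intro allI impI)
    fix e :: real assume "e > 0"
    have "(\<lambda>n. norm (\<theta> F) * \<rho> ^ n) \<longlonglongrightarrow> norm (\<theta> F) * 0"
      using \<rho> by (intro tendsto_intros LIMSEQ_realpow_zero)
    then have "eventually (\<lambda>n. norm (\<theta> F) * \<rho> ^ n < e) sequentially"
      using \<open>e > 0\<close> by (simp add: order_tendstoD)
    then obtain n where "norm (\<theta> F) * \<rho> ^ n < e" by (auto simp: eventually_sequentially)
    then show "\<exists>i\<in>I. dist i (\<theta> F) < e"
      using approx[of n] by (metis dist_commute dist_norm order_le_less_trans)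
  qed
  then show ?thesis using closed_idealD(1)[OF I] by simp
qed

end

text \<open>The ideals generated by the cut-downs of the generator of \<open>\<beta>\<close> form a chain with union dense in
  the ideal generated by the generator itself, so one of them comes within \<open>\<eta>\<close> of \<open>\<theta> H\<close>.\<close>

lemma ideal_generated_by_cut:
  assumes "cone_hom \<theta>" "cone_hom \<beta>" and H: "H \<in> cone_fun" and F: "F \<in> cone_fun" and "\<eta> > 0"
    and gen: "\<And>I. closed_ideal UNIV I \<Longrightarrow> \<beta> complex_of_real \<in> I \<Longrightarrow> \<theta> H \<in> I"
    and supp: "\<And>t. t \<in> {0<..1} \<Longrightarrow> F t \<noteq> 0 \<Longrightarrow> \<eta> \<le> cmod (H t)"
  obtains \<delta> where "\<delta> > 0" "\<And>I. closed_ideal UNIV I \<Longrightarrow> \<beta> (cut \<delta>) \<in> I \<Longrightarrow> \<theta> F \<in> I"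
proof -
  interpret T: cone_hom \<theta> by fact
  interpret B: cone_hom \<beta> by fact
  define \<delta> where "\<delta> n = inverse (real (Suc n))" for n
  have \<delta>: "\<delta> n > 0" for n by (simp add: \<delta>_def)
  define J where "J n = ideal_generated {\<beta> (cut (\<delta> n))}" for n
  have J: "closed_ideal UNIV (J n)" for n
    unfolding J_def by (rule closed_ideal_ideal_generated)
  have cut_in: "\<beta> (cut (\<delta> n)) \<in> J n" for n
    unfolding J_def using ideal_generated_superset by blast
  have "J m \<subseteq> J n" if "m \<le> n" for m n
  proof -
    have "\<delta> n \<le> \<delta> m" using that by (simp add: \<delta>_def)
    then have "\<beta> (cut (\<delta> m)) \<in> J n"
      using less_imp_le[OF \<delta>]
      by (intro B.in_closed_ideal_if_support[OF J _ cut_in] cone_fun_cut) (auto simp: cut_nonzero_iff)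
    then show ?thesis unfolding J_def[of m] by (intro ideal_generated_least[OF J]) auto
  qed
  then have L: "closed_ideal UNIV (closure (\<Union>n. J n))"
    by (intro closed_ideal_closure_Union J)
  have "\<beta> complex_of_real \<in> closure (\<Union>n. J n)"
    unfolding closure_approachable
  proof (intro allI impI)
    fix e :: real assume "e > 0"
    then obtain n where n: "\<delta> n < e" using reals_Archimedean unfolding \<delta>_def by blast
    have "norm (\<beta> complex_of_real - \<beta> (cut (\<delta> n))) \<le> \<delta> n"
    proof (rule B.norm_diff_le)
      fix t :: real assume "t \<in> {0..1}"
      have "complex_of_real t - cut (\<delta> n) t = complex_of_real (t - max (t - \<delta> n) 0)"
        by (simp add: cut_def)
      then show "cmod (complex_of_real t - cut (\<delta> n) t) \<le> \<delta> n"
        using \<open>t \<in> {0..1}\<close> \<delta>[of n] by (simp only: norm_of_real) (auto simp: max_def)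
    qed (use less_imp_le[OF \<delta>] in \<open>auto intro: cone_fun_cut\<close>)
    then show "\<exists>y\<in>\<Union>n. J n. dist y (\<beta> complex_of_real) < e"
      using n cut_in[of n] by (intro bexI[of _ "\<beta> (cut (\<delta> n))"]) (auto simp: dist_norm norm_minus_commute)
  qed
  then have "\<theta> H \<in> closure (\<Union>n. J n)" by (rule gen[OF L])
  then obtain n y where y: "y \<in> J n" "dist y (\<theta> H) < \<eta>"
    using \<open>\<eta> > 0\<close> unfolding closure_approachable by blast
  then have "\<theta> F \<in> J n"
    using supp by (intro T.in_closed_ideal_if_near[OF J H F y(1), of \<eta>])
      (auto simp: dist_norm norm_minus_commute)
  then have "\<theta> F \<in> I" if "closed_ideal UNIV I" "\<beta> (cut (\<delta> n)) \<in> I" for I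
    using ideal_generated_least[OF that(1), of "{\<beta> (cut (\<delta> n))}"] that(2) unfolding J_def by blast
  then show ?thesis using that \<delta>[of n] by blast
qed

section \<open>Matrices over the cone\<close>

text \<open>\<open>\<psi> i j F\<close> stands for the image of \<open>F\<close> tensored with the
  matrix unit at \<open>(i, j)\<close>. The diagonal entries are two orthogonal copies of the cone,
  and the off-diagonal ones link their ideals.\<close>

locale matrix_cone_hom =
  fixes \<psi> :: "nat \<Rightarrow> nat \<Rightarrow> (real \<Rightarrow> complex) \<Rightarrow> 'a::cstar_algebra"
  assumes add: "i < 2 \<Longrightarrow> j < 2 \<Longrightarrow> F \<in> cone_fun \<Longrightarrow> G \<in> cone_fun \<Longrightarrow>
      \<psi> i j (\<lambda>t. F t + G t) = \<psi> i j F + \<psi> i j G"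
    and mult: "i < 2 \<Longrightarrow> j < 2 \<Longrightarrow> k < 2 \<Longrightarrow> l < 2 \<Longrightarrow> F \<in> cone_fun \<Longrightarrow> G \<in> cone_fun \<Longrightarrow>
      \<psi> i j F * \<psi> k l G = (if j = k then \<psi> i l (\<lambda>t. F t * G t) else 0)"
    and scale: "i < 2 \<Longrightarrow> j < 2 \<Longrightarrow> F \<in> cone_fun \<Longrightarrow> \<psi> i j (\<lambda>t. c * F t) = c *\<^sub>C \<psi> i j F"
    and cnj: "i < 2 \<Longrightarrow> j < 2 \<Longrightarrow> F \<in> cone_fun \<Longrightarrow> \<psi> j i (\<lambda>t. cnj (F t)) = adj (\<psi> i j F)"
    and cong: "i < 2 \<Longrightarrow> j < 2 \<Longrightarrow> F \<in> cone_fun \<Longrightarrow> G \<in> cone_fun \<Longrightarrow>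
      (\<And>t. t \<in> {0<..1} \<Longrightarrow> F t = G t) \<Longrightarrow> \<psi> i j F = \<psi> i j G"
begin

lemma cone_hom_diagonal:
  assumes i: "i < 2"
  shows "cone_hom (\<psi> i i)"
proof
  fix F G assume FG: "F \<in> cone_fun" "G \<in> cone_fun"
  show "\<psi> i i (\<lambda>t. F t + G t) = \<psi> i i F + \<psi> i i G" using i FG by (intro add)
  show "\<psi> i i (\<lambda>t. F t * G t) = \<psi> i i F * \<psi> i i G" using i FG by (simp add: mult)
  show "\<psi> i i F = \<psi> i i G" if "\<And>t. t \<in> {0<..1} \<Longrightarrow> F t = G t"
    using that by (rule cong[OF i i FG])
next
  fix F c assume F: "F \<in> cone_fun"
  show "\<psi> i i (\<lambda>t. c * F t) = c *\<^sub>C \<psi> i i F" using i F by (intro scale)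
  show "\<psi> i i (\<lambda>t. cnj (F t)) = adj (\<psi> i i F)" using i F by (intro cnj)
qed

lemma zero: "i < 2 \<Longrightarrow> j < 2 \<Longrightarrow> \<psi> i j (\<lambda>t. 0) = 0"
  using scale[of i j "\<lambda>t. 0" 0] by simp

lemma diff: "i < 2 \<Longrightarrow> j < 2 \<Longrightarrow> F \<in> cone_fun \<Longrightarrow> G \<in> cone_fun \<Longrightarrow>
    \<psi> i j (\<lambda>t. F t - G t) = \<psi> i j F - \<psi> i j G"
  using add[of i j F "\<lambda>t. (- 1) * G t"] scale[of i j G "- 1"] cone_fun_scale[of G "- 1"]
  by (simp add: scaleC_minus_one)

text \<open>An off-diagonal entry is not a homomorphism, but by the C*-identity its norm is
  controlled by the diagonal entry \<open>\<psi> j j\<close> at the squared modulus.\<close>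

lemma norm_diff_le:
  assumes ij: "i < 2" "j < 2" and FG: "F \<in> cone_fun" "G \<in> cone_fun"
    and le: "\<And>t. t \<in> {0..1} \<Longrightarrow> cmod (F t - G t) \<le> e"
  shows "norm (\<psi> i j F - \<psi> i j G) \<le> e"
proof -
  interpret diag: cone_hom "\<psi> j j" by (rule cone_hom_diagonal) fact
  let ?H = "\<lambda>t. F t - G t"
  have H: "?H \<in> cone_fun" using FG by (rule cone_fun_diff)
  have e: "0 \<le> e" by (rule order_trans[OF norm_ge_zero le[of 1]]) simp
  have "norm (\<psi> j j (\<lambda>t. cnj (?H t) * ?H t)) \<le> e * e"
  proof (rule diag.norm_le)
    fix t :: real assume "t \<in> {0<..1}"
    then have "cmod (?H t) \<le> e" by (intro le) simp
    then show "cmod (cnj (?H t) * ?H t) \<le> e * e"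
      unfolding norm_mult complex_mod_cnj using e by (intro mult_mono) auto
  qed (use H in \<open>intro cone_fun_mult cone_fun_cnj\<close>)
  moreover have "\<psi> j j (\<lambda>t. cnj (?H t) * ?H t) = adj (\<psi> i j ?H) * \<psi> i j ?H"
    using mult[OF ij(2,1) ij(1,2) cone_fun_cnj[OF H] H] cnj[OF ij H] by simp
  ultimately have "(norm (\<psi> i j ?H))\<^sup>2 \<le> e\<^sup>2"
    by (simp add: cstar_identity power2_eq_square)
  then have "norm (\<psi> i j ?H) \<le> e" using e by (rule power2_le_imp_le)
  then show ?thesis by (simp add: diff[OF ij FG])
qed

lemma mult_entry:
  "i < 2 \<Longrightarrow> j < 2 \<Longrightarrow> F \<in> cone_fun \<Longrightarrow> G \<in> cone_fun \<Longrightarrow> \<psi> i j (\<lambda>t. F t * G t) = \<psi> i i F * \<psi> i j G"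
  by (simp add: mult)

lemma cone_ideal_entry:
  assumes "i < 2" "j < 2" "closed_ideal UNIV I"
  shows "cone_ideal {F\<in>cone_fun. \<psi> i j F \<in> I}"
proof (rule cone_ideal_preimage)
  show "\<psi> i j (\<lambda>t. F t * G t) \<in> I" if "F \<in> cone_fun" "G \<in> cone_fun" "\<psi> i j G \<in> I" for F G
    using closed_idealD(5)[OF assms(3) that(3)] by (simp add: mult_entry assms that)
qed (use assms closed_idealD[OF assms(3)] in \<open>simp_all add: zero add norm_diff_le del: atLeastAtMost_iff\<close>)

text \<open>Multiplying by suitable entries from both sides moves an entry to another place. As the
  cone has no unit, each side costs a factor \<open>t\<close>, which has no zeros on the half-open
  interval.\<close>

lemma entry_transfer:
  assumes ij: "i < 2" "j < 2" "k < 2" "l < 2" and I: "closed_ideal UNIV I"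
    and G: "G \<in> cone_fun" and mem: "\<psi> k l G \<in> I"
  shows "\<psi> i j (\<lambda>t. complex_of_real t * (G t * complex_of_real t)) \<in> I"
proof -
  have "\<psi> i k complex_of_real * (\<psi> k l G * \<psi> l j complex_of_real) \<in> I"
    using closed_idealD(5)[OF I closed_idealD(6)[OF I mem]] .
  then show ?thesis
    using ij by (simp add: mult G cone_fun_mult)
qed

text \<open>Closed ideals of the matrices over the cone come from closed ideals of the cone, so
  supports can be compared across entries. The witness \<open>G\<close> may depend on
  \<open>t\<close>, which admits infinite covers of the support.\<close>

lemma entry_in_closed_ideal:
  assumes ij: "i < 2" "j < 2" "k < 2" "l < 2" and I: "closed_ideal UNIV I"
    and F: "F \<in> cone_fun"
    and supp: "\<And>t. t \<in> {0<..1} \<Longrightarrow> F t \<noteq> 0 \<Longrightarrow> \<exists>G\<in>cone_fun. \<psi> k l G \<in> I \<and> G t \<noteq> 0"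
  shows "\<psi> i j F \<in> I"
proof -
  have "F \<in> {F\<in>cone_fun. \<psi> i j F \<in> I}"
  proof (rule cone_ideal_memI[OF cone_ideal_entry[OF ij(1,2) I] F])
    fix t :: real assume t: "t \<in> {0<..1}" "F t \<noteq> 0"
    then obtain G where G: "G \<in> cone_fun" "\<psi> k l G \<in> I" "G t \<noteq> 0" using supp by blast
    let ?H = "\<lambda>t. complex_of_real t * (G t * complex_of_real t)"
    have "?H \<in> cone_fun" using G(1) by (intro cone_fun_mult cone_fun_id)
    moreover have "\<psi> i j ?H \<in> I" using entry_transfer[OF ij I G(1,2)] .
    moreover have "?H t \<noteq> 0" using G(3) t(1) by simp
    ultimately show "\<exists>H\<in>{F\<in>cone_fun. \<psi> i j F \<in> I}. H t \<noteq> 0"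
      by (intro bexI[of _ ?H] CollectI conjI)
  qed
  then show ?thesis by simp
qed

end

section \<open>Matrix units and the Global Glimm Property in terms of entries\<close>

definition matrix_unit :: "nat \<Rightarrow> nat \<Rightarrow> complex mat" where
  "matrix_unit i j = mat 2 2 (\<lambda>r. if r = (i, j) then 1 else 0)"

lemma matrix_unit_carrier [simp]: "matrix_unit i j \<in> carrier_mat 2 2"
  by (simp add: matrix_unit_def)

lemma matrix_unit_mult:
  assumes "i < 2" "j < 2" "k < 2" "l < 2"
  shows "matrix_unit i j * matrix_unit k l = (if j = k then matrix_unit i l else 0\<^sub>m 2 2)"
  using assms unfolding matrix_unit_def
  by (intro eq_matI) (auto simp: scalar_prod_def less_2_cases_iff numeral_2_eq_2)

lemma matrix_unit_adjoint: "mat_adjoint (matrix_unit i j) = matrix_unit j i"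
  unfolding matrix_unit_def mat_adjoint_def
  by (intro eq_matI) (auto simp: mat_of_rows_def)

lemma matrix_cone_hom_if_star_hom:
  assumes \<phi>: "star_hom (C0_tensor_M {0<..1::real} 2) B \<phi>"
  shows "matrix_cone_hom (\<lambda>i j F. \<phi> (elem_tensor (restrict_zero {0<..1} F) (matrix_unit i j)))"
    (is "matrix_cone_hom (\<lambda>i j F. \<phi> (?E i j F))")
proof -
  let ?D = "C0_tensor_M {0<..1::real} 2"
  have carrier: "?E i j F \<in> sa_carrier ?D" if "F \<in> cone_fun" for i j F
    using that by (intro elem_tensor_in_carrier restrict_cone_fun_in_C0_functions) simp_all
  have hom: "x \<in> sa_carrier ?D \<Longrightarrow> y \<in> sa_carrier ?D \<Longrightarrow> \<phi> (sa_add ?D x y) = \<phi> x + \<phi> y"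
    "x \<in> sa_carrier ?D \<Longrightarrow> y \<in> sa_carrier ?D \<Longrightarrow> \<phi> (sa_mult ?D x y) = \<phi> x * \<phi> y"
    "x \<in> sa_carrier ?D \<Longrightarrow> \<phi> (sa_scale ?D c x) = c *\<^sub>C \<phi> x"
    "x \<in> sa_carrier ?D \<Longrightarrow> \<phi> (sa_star ?D x) = adj (\<phi> x)" for x y c
    using \<phi> unfolding star_hom_def by simp_all
  show ?thesis
  proof
    fix i j k l :: nat and F G :: "real \<Rightarrow> complex" and c :: complex
    assume ij: "i < 2" "j < 2" and F: "F \<in> cone_fun"
    have "?E i j (\<lambda>t. c * F t) = sa_scale ?D c (?E i j F)"
      by (auto simp: C0_tensor_M_def elem_tensor_def restrict_zero_def fun_eq_iff intro!: eq_matI)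
    then show "\<phi> (?E i j (\<lambda>t. c * F t)) = c *\<^sub>C \<phi> (?E i j F)"
      by (simp add: hom carrier[OF F])
    have "?E j i (\<lambda>t. cnj (F t)) = sa_star ?D (?E i j F)"
      by (subst elem_tensor_star) (auto simp: matrix_unit_adjoint restrict_zero_def intro!: arg_cong2[where f = elem_tensor])
    then show "\<phi> (?E j i (\<lambda>t. cnj (F t))) = adj (\<phi> (?E i j F))"
      by (simp add: hom carrier[OF F])
    assume G: "G \<in> cone_fun"
    have "?E i j (\<lambda>t. F t + G t) = sa_add ?D (?E i j F) (?E i j G)"
      by (auto simp: C0_tensor_M_def elem_tensor_def restrict_zero_def fun_eq_iff matrix_unit_def intro!: eq_matI)
    then show "\<phi> (?E i j (\<lambda>t. F t + G t)) = \<phi> (?E i j F) + \<phi> (?E i j G)"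
      by (simp add: hom carrier[OF F] carrier[OF G])
    show "\<phi> (?E i j F) = \<phi> (?E i j G)" if "\<And>t. t \<in> {0<..1} \<Longrightarrow> F t = G t"
    proof -
      have "restrict_zero {0<..1} F = restrict_zero {0<..1} G"
        using that by (auto simp: restrict_zero_def fun_eq_iff)
      then show ?thesis by simp
    qed
    assume kl: "k < 2" "l < 2"
    have FG: "(\<lambda>t. F t * G t) \<in> cone_fun" using F G by (rule cone_fun_mult)
    have "\<phi> (?E i j F) * \<phi> (?E k l G) = \<phi> (sa_mult ?D (?E i j F) (?E k l G))"
      by (simp add: hom carrier[OF F] carrier[OF G])
    also have "sa_mult ?D (?E i j F) (?E k l G)
        = elem_tensor (restrict_zero {0<..1} (\<lambda>t. F t * G t)) (matrix_unit i j * matrix_unit k l)"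
      by (subst elem_tensor_mult) (auto simp: restrict_zero_def intro!: arg_cong2[where f = elem_tensor])
    \<comment> \<open>The vanishing product is written as a multiple by 0, so that compatibility
      with scalars evaluates its image.\<close>
    also have "\<dots> = (if j = k then ?E i l (\<lambda>t. F t * G t) else sa_scale ?D 0 (?E i l (\<lambda>t. F t * G t)))"
      using matrix_unit_mult[OF ij kl]
      by (auto simp: C0_tensor_M_def elem_tensor_def fun_eq_iff matrix_unit_def intro!: eq_matI)
    finally show "\<phi> (?E i j F) * \<phi> (?E k l G) = (if j = k then \<phi> (?E i l (\<lambda>t. F t * G t)) else 0)"
      by (simp add: hom carrier[OF FG])
  qed
qed

text \<open>The property for \<open>k = 2\<close>. Every element of the domain is a sum of four
  elementary tensors with matrix units, so an ideal that contains all entries contains the whole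
  image.\<close>

lemma global_glimm_matrix_cone_hom:
  fixes a :: "'a::cstar_algebra"
  assumes "global_glimm_property TYPE('a)" "positive a" "\<epsilon> > 0"
  shows "\<exists>\<psi>. matrix_cone_hom \<psi> \<and> (\<forall>i<2. \<forall>j<2. \<forall>F\<in>cone_fun. \<psi> i j F \<in> hereditary a) \<and>
    (\<forall>I. closed_ideal UNIV I \<and> (\<forall>i<2. \<forall>j<2. \<forall>F\<in>cone_fun. \<psi> i j F \<in> I) \<longrightarrow> cut_down a \<epsilon> \<in> I)"
proof -
  let ?D = "C0_tensor_M {0<..1::real} 2"
  obtain \<phi> where \<phi>: "star_hom ?D (hereditary a) \<phi>" "cut_down a \<epsilon> \<in> ideal_generated (\<phi> ` sa_carrier ?D)"
    using assms unfolding global_glimm_property_def by (metis order_refl)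
  define \<psi> where "\<psi> i j F = \<phi> (elem_tensor (restrict_zero {0<..1} F) (matrix_unit i j))" for i j F
  have elem: "elem_tensor (restrict_zero {0<..1} F) (matrix_unit i j) \<in> sa_carrier ?D"
    if "F \<in> cone_fun" for F i j
    using that by (intro elem_tensor_in_carrier restrict_cone_fun_in_C0_functions) simp_all
  show ?thesis
  proof (intro exI[of _ \<psi>] conjI allI ballI impI)
    show "matrix_cone_hom \<psi>"
      unfolding \<psi>_def using matrix_cone_hom_if_star_hom[OF \<phi>(1)] .
    show "\<psi> i j F \<in> hereditary a" if "F \<in> cone_fun" for i j F
      using \<phi>(1) elem[OF that] unfolding \<psi>_def star_hom_def by blast
    fix I assume "closed_ideal UNIV I \<and> (\<forall>i<2. \<forall>j<2. \<forall>F\<in>cone_fun. \<psi> i j F \<in> I)"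
    then have I: "closed_ideal UNIV I"
      and mem: "\<And>i j F. i < 2 \<Longrightarrow> j < 2 \<Longrightarrow> F \<in> cone_fun \<Longrightarrow> \<psi> i j F \<in> I"
      by auto
    have "\<phi> X \<in> I" if X: "X \<in> sa_carrier ?D" for X
    proof -
      have Xm: "X t \<in> carrier_mat 2 2" for t
        using X by (simp add: C0_tensor_M_def)
      have entry: "(\<lambda>t. X t $$ (i, j)) \<in> C0_functions {0<..1}" if "i < 2" "j < 2" for i j
        using X that by (simp add: C0_tensor_M_def)
      define e where "e i j = elem_tensor (\<lambda>t. X t $$ (i, j)) (matrix_unit i j)" for i j
      have e: "e i j \<in> sa_carrier ?D" if "i < 2" "j < 2" for i j
        unfolding e_def using entry[OF that] by (intro elem_tensor_in_carrier) simp_all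
      have e_mem: "\<phi> (e i j) \<in> I" if "i < 2" "j < 2" for i j
      proof -
        have "restrict_zero {0<..1} (\<lambda>t. X t $$ (i, j)) = (\<lambda>t. X t $$ (i, j))"
          using entry[OF that] by (auto simp: restrict_zero_def C0_functions_def fun_eq_iff)
        then show ?thesis
          using mem[OF that C0_functions_imp_cone_fun[OF entry[OF that]]]
          by (simp add: \<psi>_def e_def)
      qed
      have "X = sa_add ?D (sa_add ?D (e 0 0) (e 0 1)) (sa_add ?D (e 1 0) (e 1 1))"
        using carrier_matD[OF Xm]
        by (auto simp: C0_tensor_M_def e_def elem_tensor_def matrix_unit_def fun_eq_iff less_2_cases_iff
            intro!: eq_matI)
      moreover have "sa_add ?D x y \<in> sa_carrier ?D" if "x \<in> sa_carrier ?D" "y \<in> sa_carrier ?D" for x y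
      proof -
        have sum_mem: "(\<lambda>t. f t + g t) \<in> C0_functions {0<..1}"
          if fg: "f \<in> C0_functions {0<..1}" "g \<in> C0_functions {0<..1}" for f g :: "real \<Rightarrow> complex"
        proof -
          have "restrict_zero {0<..1} (\<lambda>t. f t + g t) = (\<lambda>t. f t + g t)"
            using fg by (auto simp: restrict_zero_def C0_functions_def fun_eq_iff)
          then show ?thesis
            using restrict_cone_fun_in_C0_functions[OF cone_fun_add[OF fg[THEN C0_functions_imp_cone_fun]]]
            by simp
        qed
        have xy: "\<And>t. x t \<in> carrier_mat 2 2" "\<And>t. y t \<in> carrier_mat 2 2"
          "\<And>i j. i < 2 \<Longrightarrow> j < 2 \<Longrightarrow> (\<lambda>t. x t $$ (i, j)) \<in> C0_functions {0<..1}"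
          "\<And>i j. i < 2 \<Longrightarrow> j < 2 \<Longrightarrow> (\<lambda>t. y t $$ (i, j)) \<in> C0_functions {0<..1}"
          using that by (simp_all add: C0_tensor_M_def)
        have "(\<lambda>t. (x t + y t) $$ (i, j)) \<in> C0_functions {0<..1}" if "i < 2" "j < 2" for i j
        proof -
          have "(\<lambda>t. (x t + y t) $$ (i, j)) = (\<lambda>t. x t $$ (i, j) + y t $$ (i, j))"
            using carrier_matD[OF xy(2)] that by simp
          then show ?thesis using sum_mem[OF xy(3,4)[OF that]] by simp
        qed
        then show ?thesis using xy(1,2) by (simp add: C0_tensor_M_def)
      qed
      ultimately have "\<phi> X = (\<phi> (e 0 0) + \<phi> (e 0 1)) + (\<phi> (e 1 0) + \<phi> (e 1 1))"
        using \<phi>(1) e unfolding star_hom_def by simp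
      then show ?thesis using e_mem closed_idealD(3)[OF I] by simp
    qed
    then have "ideal_generated (\<phi> ` sa_carrier ?D) \<subseteq> I"
      by (intro ideal_generated_least[OF I]) blast
    then show "cut_down a \<epsilon> \<in> I" using \<phi>(2) by blast
  qed
qed

section \<open>Orthogonal sequences\<close>

text \<open>Half of the threshold \<open>\<delta>\<close> is spent on the property, the other half
  on finding \<open>\<delta>'\<close> such that the cut-down of \<open>\<psi> 0 0\<close> by
  \<open>\<delta>'\<close> still has \<open>\<theta> (cut \<delta>)\<close> in its ideal. This
  cut-down is the generator of \<open>\<beta>\<close>; the other corner is passed on as
  \<open>\<theta>'\<close>, and its cut-down by the same \<open>\<delta>'\<close> generates the same
  ideal.\<close>

lemma ladder_step:
  fixes \<theta> :: "(real \<Rightarrow> complex) \<Rightarrow> 'a::cstar_algebra"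
  assumes ggp: "global_glimm_property TYPE('a)" and "cone_hom \<theta>" and \<delta>: "\<delta> > 0"
  obtains \<theta>' \<beta> \<delta>' where "cone_hom \<theta>'" "cone_hom \<beta>" "\<delta>' > 0"
    "\<theta>' complex_of_real \<in> hereditary (\<theta> complex_of_real)"
    "\<beta> complex_of_real \<in> hereditary (\<theta> complex_of_real)"
    "\<beta> complex_of_real * \<theta>' complex_of_real = 0" "\<theta>' complex_of_real * \<beta> complex_of_real = 0"
    "\<And>I. closed_ideal UNIV I \<Longrightarrow> \<beta> complex_of_real \<in> I \<Longrightarrow> \<theta> (cut \<delta>) \<in> I"
    "\<And>I. closed_ideal UNIV I \<Longrightarrow> \<theta>' (cut \<delta>') \<in> I \<Longrightarrow> \<beta> complex_of_real \<in> I"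
proof -
  interpret T: cone_hom \<theta> by fact
  obtain \<psi> where \<psi>: "matrix_cone_hom \<psi>"
    and her: "\<forall>i<2. \<forall>j<2. \<forall>F\<in>cone_fun. \<psi> i j F \<in> hereditary (\<theta> complex_of_real)"
    and gen: "\<And>I. closed_ideal UNIV I \<Longrightarrow> \<forall>i<2. \<forall>j<2. \<forall>F\<in>cone_fun. \<psi> i j F \<in> I \<Longrightarrow>
      cut_down (\<theta> complex_of_real) (\<delta> / 2) \<in> I"
    using global_glimm_matrix_cone_hom[OF ggp T.positive_gen half_gt_zero[OF \<delta>]] by blast
  interpret P: matrix_cone_hom \<psi> by fact
  have diag: "cone_hom (\<psi> 0 0)" "cone_hom (\<psi> 1 1)"
    by (simp_all add: P.cone_hom_diagonal)
  have cut_half: "cut_down (\<theta> complex_of_real) (\<delta> / 2) = \<theta> (cut (\<delta> / 2))"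
    using T.cut_down_gen[of "\<delta> / 2"] \<delta> unfolding cut_def by simp
  obtain \<delta>' where \<delta>': "\<delta>' > 0"
    "\<And>I. closed_ideal UNIV I \<Longrightarrow> \<psi> 0 0 (cut \<delta>') \<in> I \<Longrightarrow> \<theta> (cut \<delta>) \<in> I"
  proof (rule ideal_generated_by_cut[OF \<open>cone_hom \<theta>\<close> diag(1), of "cut (\<delta> / 2)" "cut \<delta>" "\<delta> / 2"])
    show "\<theta> (cut (\<delta> / 2)) \<in> I" if I: "closed_ideal UNIV I" "\<psi> 0 0 complex_of_real \<in> I" for I
    proof -
      have "\<psi> i j F \<in> I" if "i < 2" "j < 2" "F \<in> cone_fun" for i j F
        using that I(2) by (intro P.entry_in_closed_ideal[of i j 0 0 I F] I(1)) (auto intro!: bexI[of _ complex_of_real])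
      then show ?thesis using gen[OF I(1)] cut_half by simp
    qed
    show "\<delta> / 2 \<le> cmod (cut (\<delta> / 2) t)" if "cut \<delta> t \<noteq> 0" for t
      using that \<delta> unfolding cut_nonzero_iff unfolding cut_def norm_of_real max_def by auto
  qed (use \<delta> cone_fun_cut in auto)
  \<comment> \<open>Composition with the cut-down function turns
    \<open>\<psi> 0 0 (cut \<delta>')\<close> into a generator in its own right.\<close>
  let ?h = "\<lambda>t. max (t - \<delta>') 0"
  define \<beta> where "\<beta> F = \<psi> 0 0 (\<lambda>t. F (?h t))" for F
  have \<beta>: "cone_hom \<beta>"
    unfolding \<beta>_def using \<delta>'(1)
    by (intro cone_hom.cone_hom_compose[OF diag(1)] continuous_intros) auto
  have \<beta>_gen: "\<beta> complex_of_real = \<psi> 0 0 (cut \<delta>')"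
    by (simp add: \<beta>_def cut_def[abs_def])
  have cut': "cut \<delta>' \<in> cone_fun" using \<delta>'(1) by (intro cone_fun_cut) simp
  show ?thesis
  proof (rule that[of "\<psi> 1 1" \<beta> \<delta>'])
    show "\<beta> complex_of_real \<in> I" if "closed_ideal UNIV I" "\<psi> 1 1 (cut \<delta>') \<in> I" for I
      unfolding \<beta>_gen using that cut' by (intro P.entry_in_closed_ideal[of 0 0 1 1 I]) auto
    show "\<theta> (cut \<delta>) \<in> I" if "closed_ideal UNIV I" "\<beta> complex_of_real \<in> I" for I
      using that \<delta>'(2) by (simp add: \<beta>_gen)
  qed (use diag \<beta> \<delta>'(1) her cut' in \<open>simp_all add: \<beta>_gen P.mult\<close>)
qed

text \<open>The links of consecutive stages chain up: an ideal with the generator of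
  \<open>\<beta> (Suc n)\<close> contains the cut-down of the copy \<open>\<theta>s (Suc n)\<close>,
  hence the generator of \<open>\<beta> n\<close>. For orthogonality, all that is chosen after stage
  \<open>m\<close> lies in the hereditary subalgebra of the copy \<open>\<theta>s (Suc m)\<close>,
  which annihilates the generator of \<open>\<beta> m\<close>.\<close>

lemma ladder:
  fixes \<theta> :: "(real \<Rightarrow> complex) \<Rightarrow> 'a::cstar_algebra"
  assumes ggp: "global_glimm_property TYPE('a)" and \<theta>: "cone_hom \<theta>" and \<delta>: "\<delta> > 0"
  obtains \<beta> :: "nat \<Rightarrow> (real \<Rightarrow> complex) \<Rightarrow> 'a" where "\<And>n. cone_hom (\<beta> n)"
    "\<And>n. \<beta> n complex_of_real \<in> hereditary (\<theta> complex_of_real)"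
    "\<And>m n. m \<noteq> n \<Longrightarrow> \<beta> m complex_of_real * \<beta> n complex_of_real = 0"
    "\<And>I n. closed_ideal UNIV I \<Longrightarrow> \<beta> n complex_of_real \<in> I \<Longrightarrow> \<theta> (cut \<delta>) \<in> I"
    "\<And>I m n. closed_ideal UNIV I \<Longrightarrow> m \<le> n \<Longrightarrow> \<beta> n complex_of_real \<in> I \<Longrightarrow> \<beta> m complex_of_real \<in> I"
proof -
  let ?t = complex_of_real
  define step where "step p q \<longleftrightarrow>
    (case p of (\<theta>, \<delta>, _) \<Rightarrow> case q of (\<theta>', \<delta>', \<beta>) \<Rightarrow> cone_hom \<beta> \<and>
      \<theta>' ?t \<in> hereditary (\<theta> ?t) \<and> \<beta> ?t \<in> hereditary (\<theta> ?t) \<and> \<beta> ?t * \<theta>' ?t = 0 \<and> \<theta>' ?t * \<beta> ?t = 0 \<and>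
      (\<forall>I. closed_ideal UNIV I \<longrightarrow> \<beta> ?t \<in> I \<longrightarrow> \<theta> (cut \<delta>) \<in> I) \<and>
      (\<forall>I. closed_ideal UNIV I \<longrightarrow> \<theta>' (cut \<delta>') \<in> I \<longrightarrow> \<beta> ?t \<in> I))"
    for p q :: "((real \<Rightarrow> complex) \<Rightarrow> 'a) \<times> real \<times> ((real \<Rightarrow> complex) \<Rightarrow> 'a)"
  define good where "good n p \<longleftrightarrow> (case p of (\<theta>', \<delta>', _) \<Rightarrow>
      cone_hom \<theta>' \<and> \<delta>' > 0 \<and> (n = 0 \<longrightarrow> \<theta>' = \<theta> \<and> \<delta>' = \<delta>))"
    for n :: nat and p :: "((real \<Rightarrow> complex) \<Rightarrow> 'a) \<times> real \<times> ((real \<Rightarrow> complex) \<Rightarrow> 'a)"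
  have "\<exists>p. \<forall>n. good n (p n) \<and> step (p n) (p (Suc n))"
  proof (rule dependent_nat_choice)
    \<comment> \<open>The last component at index 0 is a placeholder; \<open>\<beta> n\<close> is
      read off at index \<open>Suc n\<close>.\<close>
    show "\<exists>p. good 0 p" using \<theta> \<delta> by (intro exI[of _ "(\<theta>, \<delta>, \<theta>)"]) (simp add: good_def)
    fix p n assume "good n p"
    then obtain \<theta>1 \<delta>1 \<beta>1 where p: "p = (\<theta>1, \<delta>1, \<beta>1)" "cone_hom \<theta>1" "\<delta>1 > 0"
      by (cases p) (auto simp: good_def)
    from ladder_step[OF ggp p(2,3)]
    obtain \<theta>' \<beta> \<delta>' where q: "cone_hom \<theta>'" "cone_hom \<beta>" "\<delta>' > 0"
      "\<theta>' ?t \<in> hereditary (\<theta>1 ?t)" "\<beta> ?t \<in> hereditary (\<theta>1 ?t)"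
      "\<beta> ?t * \<theta>' ?t = 0" "\<theta>' ?t * \<beta> ?t = 0"
      "\<And>I. closed_ideal UNIV I \<Longrightarrow> \<beta> ?t \<in> I \<Longrightarrow> \<theta>1 (cut \<delta>1) \<in> I"
      "\<And>I. closed_ideal UNIV I \<Longrightarrow> \<theta>' (cut \<delta>') \<in> I \<Longrightarrow> \<beta> ?t \<in> I"
      by metis
    then show "\<exists>q. good (Suc n) q \<and> step p q"
      by (intro exI[of _ "(\<theta>', \<delta>', \<beta>)"]) (simp add: good_def step_def p(1))
  qed
  then obtain p where p: "\<And>n. good n (p n)" "\<And>n. step (p n) (p (Suc n))" by blast
  define \<theta>s where "\<theta>s n = fst (p n)" for n
  define \<delta>s where "\<delta>s n = fst (snd (p n))" for n
  define \<beta> where "\<beta> n = snd (snd (p (Suc n)))" for n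
  have init: "\<theta>s 0 = \<theta>" "\<delta>s 0 = \<delta>"
    using p(1)[of 0] by (auto simp: good_def \<theta>s_def \<delta>s_def split: prod.splits)
  have s: "cone_hom (\<beta> n)" "\<theta>s (Suc n) ?t \<in> hereditary (\<theta>s n ?t)" "\<beta> n ?t \<in> hereditary (\<theta>s n ?t)"
    "\<beta> n ?t * \<theta>s (Suc n) ?t = 0" "\<theta>s (Suc n) ?t * \<beta> n ?t = 0"
    "closed_ideal UNIV I \<Longrightarrow> \<beta> n ?t \<in> I \<Longrightarrow> \<theta>s n (cut (\<delta>s n)) \<in> I"
    "closed_ideal UNIV I \<Longrightarrow> \<theta>s (Suc n) (cut (\<delta>s (Suc n))) \<in> I \<Longrightarrow> \<beta> n ?t \<in> I" for n I
    using p(2)[of n] by (auto simp: step_def \<theta>s_def \<delta>s_def \<beta>_def split: prod.splits)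
  have her_mono: "hereditary (\<theta>s n ?t) \<subseteq> hereditary (\<theta>s m ?t)" if "m \<le> n" for m n
    using that
  proof (induction n rule: dec_induct)
    case (step n)
    then show ?case using hereditary_mono[OF s(2)[of n]] by blast
  qed simp
  have orth: "\<beta> m ?t * \<beta> n ?t = 0" "\<beta> n ?t * \<beta> m ?t = 0" if "m < n" for m n
  proof -
    have "\<beta> n ?t \<in> hereditary (\<theta>s (Suc m) ?t)"
      using her_mono[of "Suc m" n] s(3)[of n] that by (auto simp: Suc_le_eq)
    then show "\<beta> m ?t * \<beta> n ?t = 0" "\<beta> n ?t * \<beta> m ?t = 0"
      using hereditary_annihilated_left[OF s(4)[of m]] hereditary_annihilated_right[OF s(5)[of m]] by auto
  qed
  have down: "\<beta> m ?t \<in> I" if I: "closed_ideal UNIV I" and "m \<le> n" "\<beta> n ?t \<in> I" for I m n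
    using that(2,3)
  proof (induction n rule: dec_induct)
    case (step n)
    then show ?case using s(6)[OF I] s(7)[OF I] by blast
  qed
  show ?thesis
  proof (rule that[of \<beta>])
    show "cone_hom (\<beta> n)" for n by (rule s)
    show "\<beta> n ?t \<in> hereditary (\<theta> ?t)" for n
      using s(3)[of n] her_mono[of 0 n] init by auto
    show "\<beta> m ?t * \<beta> n ?t = 0" if "m \<noteq> n" for m n
      using orth that by (metis linorder_neqE_nat)
    show "\<beta> m ?t \<in> I" if "closed_ideal UNIV I" "m \<le> n" "\<beta> n ?t \<in> I" for I m n
      by (rule down[OF that])
    show "\<theta> (cut \<delta>) \<in> I" if "closed_ideal UNIV I" "\<beta> n ?t \<in> I" for I n
      using s(6)[OF that(1) down[OF that(1) _ that(2), of 0]] init by simp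
  qed
qed

text \<open>The function \<open>t / (t + \<delta>) ^ 6\<close> of \<open>gen\<close> serves as
  \<open>y\<close>. Three factors on the left are what the passage from ideals of the hereditary
  subalgebra to ideals of the whole algebra consumes.\<close>

lemma (in cone_hom) gen_in_closure_cubes:
  "gen \<in> closure {gen * gen * gen * y * (gen * gen * gen) | y. True}"
  unfolding closure_approachable
proof (intro allI impI)
  fix e :: real assume "e > 0"
  \<comment> \<open>Bernoulli's inequality for the sixth power will bound the error by
    \<open>6 * \<delta>\<close>.\<close>
  define \<delta> where "\<delta> = e / 7"
  have \<delta>: "\<delta> > 0" "6 * \<delta> < e" using \<open>e > 0\<close> by (auto simp: \<delta>_def)
  let ?t = complex_of_real
  define k where "k t = ?t (t / (t + \<delta>) ^ 6)" for t
  have k: "k \<in> cone_fun"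
    unfolding k_def using \<delta>(1) by (intro cone_funI continuous_intros) auto
  let ?F = "\<lambda>t. ?t t * (?t t * (?t t * (k t * (?t t * (?t t * ?t t)))))"
  have F: "?F \<in> cone_fun" using k by (intro cone_fun_mult cone_fun_id)
  have "norm (\<theta> ?F - gen) \<le> 6 * \<delta>"
  proof (rule norm_diff_le[OF F cone_fun_id])
    fix t :: real assume t: "t \<in> {0..1}"
    define u where "u = \<delta> / (t + \<delta>)"
    have pos: "t + \<delta> > 0" using t \<delta>(1) by auto
    have u: "0 \<le> u" "u \<le> 1" "t / (t + \<delta>) = 1 - u" "t * u \<le> \<delta>"
      using t \<delta>(1) pos by (auto simp: u_def field_simps)
    have "?F t = ?t (t * (t / (t + \<delta>)) ^ 6)"
      by (simp add: k_def power_divide eval_nat_numeral flip: of_real_mult of_real_divide)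
    then have "cmod (?F t - ?t t) = \<bar>t * (1 - u) ^ 6 - t\<bar>"
      unfolding u(3) by (simp only: norm_of_real flip: of_real_diff)
    moreover have "t * (1 - u) ^ 6 \<le> t"
      using t u by (simp add: mult_left_le power_le_one)
    moreover have "t * (1 - 6 * u) \<le> t * (1 - u) ^ 6"
      using Bernoulli_inequality[of "- u" 6] u t by (intro mult_left_mono) auto
    ultimately show "cmod (?F t - ?t t) \<le> 6 * \<delta>"
      using u(4) by (simp add: algebra_simps)
  qed
  moreover have "\<theta> ?F = gen * gen * gen * \<theta> k * (gen * gen * gen)"
    using k by (simp only: mult cone_fun_mult cone_fun_id mult.assoc)
  ultimately show "\<exists>x\<in>{gen * gen * gen * y * (gen * gen * gen) | y. True}. dist x gen < e"
    using \<delta>(2) by (intro bexI[of _ "\<theta> ?F"]) (auto simp: dist_norm)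
qed

text \<open>The functions whose images are annihilated by \<open>z\<close> form a closed ideal of
  the cone; it contains the identity function, which has no zeros on the half-open interval.\<close>

lemma (in cone_hom) annihilated_left:
  assumes "z * gen = 0" "F \<in> cone_fun"
  shows "z * \<theta> F = 0"
proof -
  have "cone_ideal {F\<in>cone_fun. \<theta> F \<in> {v. z * v \<in> {0}}}"
  proof (rule cone_ideal_vimage)
    show "closed {v. z * v \<in> {0}}" by (intro closed_vimage_mult_left) simp
    show "\<theta> F * \<theta> G \<in> {v. z * v \<in> {0}}"
      if "F \<in> cone_fun" "G \<in> cone_fun" "\<theta> G \<in> {v. z * v \<in> {0}}" for F G
      using that by (simp add: commute[OF that(1,2)] flip: mult.assoc)
  qed (simp_all add: distrib_left)
  then have "F \<in> {F\<in>cone_fun. \<theta> F \<in> {v. z * v \<in> {0}}}"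
  proof (rule cone_ideal_memI)
    show "\<exists>G\<in>{F\<in>cone_fun. \<theta> F \<in> {v. z * v \<in> {0}}}. G t \<noteq> 0" if "t \<in> {0<..1}" for t
      using assms(1) that by (intro bexI[of _ complex_of_real]) auto
  qed fact
  then show ?thesis by simp
qed

lemma (in cone_hom) annihilated_right:
  assumes "gen * z = 0" "F \<in> cone_fun"
  shows "\<theta> F * z = 0"
proof -
  have "cone_ideal {F\<in>cone_fun. \<theta> F \<in> {v. v * z \<in> {0}}}"
  proof (rule cone_ideal_vimage)
    show "closed {v. v * z \<in> {0}}" by (intro closed_vimage_mult_right) simp
  qed (simp_all add: distrib_right mult.assoc)
  then have "F \<in> {F\<in>cone_fun. \<theta> F \<in> {v. v * z \<in> {0}}}"
  proof (rule cone_ideal_memI)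
    show "\<exists>G\<in>{F\<in>cone_fun. \<theta> F \<in> {v. v * z \<in> {0}}}. G t \<noteq> 0" if "t \<in> {0<..1}" for t
      using assms(1) that by (intro bexI[of _ complex_of_real]) auto
  qed fact
  then show ?thesis by simp
qed

lemma sums_single_nonzero:
  fixes f :: "nat \<Rightarrow> 'b::{comm_monoid_add, t2_space}"
  assumes "f sums S" "\<And>j. j \<noteq> i \<Longrightarrow> f j = 0"
  shows "S = f i"
proof -
  have "(\<lambda>j. if j = i then f j else 0) = f" using assms(2) by auto
  then have "f sums f i" using sums_single[of i f] by simp
  then show ?thesis by (rule sums_unique2[OF assms(1)])
qed

section \<open>Soft orthogonal sums\<close>

locale orthogonal_sequence =
  fixes \<beta> :: "nat \<Rightarrow> (real \<Rightarrow> complex) \<Rightarrow> 'a::cstar_algebra"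
  assumes hom: "cone_hom (\<beta> i)"
    and orth: "i \<noteq> j \<Longrightarrow> \<beta> i complex_of_real * \<beta> j complex_of_real = 0"
    and cofinal: "\<exists>j\<ge>N. \<forall>I. closed_ideal UNIV I \<longrightarrow> \<beta> j complex_of_real \<in> I \<longrightarrow> \<beta> i complex_of_real \<in> I"
begin

definition b :: "nat \<Rightarrow> 'a" where
  "b i = \<beta> i complex_of_real"

definition total :: 'a where
  "total = (\<Sum>i. (1/2) ^ i *\<^sub>R b i)"

lemma norm_b: "norm (b i) \<le> 1"
  unfolding b_def by (rule cone_hom.norm_le[OF hom]) simp_all

lemma b_orth: "i \<noteq> j \<Longrightarrow> b i * b j = 0"
  unfolding b_def by (rule orth)

lemma sums_total: "(\<lambda>i. (1/2) ^ i *\<^sub>R b i) sums total"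
proof -
  have "summable (\<lambda>i. (1/2) ^ i *\<^sub>R b i)"
  proof (rule summable_comparison_test)
    show "\<exists>N. \<forall>n\<ge>N. norm ((1/2) ^ n *\<^sub>R b n) \<le> (1/2) ^ n"
      using norm_b by (intro exI[of _ 0]) (auto intro: mult_left_le)
  qed (simp add: summable_geometric)
  then show ?thesis unfolding total_def by (rule summable_sums)
qed

lemma b_mult_total: "b i * total = (1/2) ^ i *\<^sub>R (b i * b i)"
  using sums_single_nonzero[OF bounded_linear.sums[OF bounded_linear_mult_right sums_total], of i "b i"]
  by (simp add: b_orth)

lemma total_mult_b: "total * b i = (1/2) ^ i *\<^sub>R (b i * b i)"
  using sums_single_nonzero[OF bounded_linear.sums[OF bounded_linear_mult_left sums_total], of i "b i"]
  by (simp add: b_orth)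

lemma b_square: "b i * b i = 2 ^ i *\<^sub>R (b i * total)" "b i * b i = 2 ^ i *\<^sub>R (total * b i)"
  by (simp_all add: b_mult_total total_mult_b power_one_over)

lemma adj_total: "adj total = total"
proof -
  have "adj ((1/2) ^ i *\<^sub>R b i) = (1/2) ^ i *\<^sub>R b i" for i
    using cone_hom.adj_gen[OF hom[of i]]
    by (simp add: scaleR_scaleC adj_scaleC b_def)
  then show ?thesis
    using bounded_linear.sums[OF bounded_linear_adj sums_total] sums_total sums_unique2 by simp
qed

text \<open>For \<open>l\<close> off the half-line the inverse is assembled from the summands:
  \<open>k i\<close> is the inverse of \<open>(1/2) ^ i * t - l\<close> plus the constant
  \<open>1 / l\<close>. This has size of order \<open>(1/2) ^ i\<close>, so the sum \<open>w\<close>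
  converges, and by orthogonality products with \<open>w\<close> are computed term by term.\<close>

lemma positive_total: "positive total"
proof -
  have "l \<notin> spectrum total" if l: "l \<notin> complex_of_real ` {0..}" for l
  proof -
    have l0: "l \<noteq> 0" using l by auto
    \<comment> \<open>A positive lower bound for the distance of \<open>l\<close> from the
      half-line, making the estimate for \<open>k i\<close> uniform.\<close>
    obtain c where c: "c > 0" "\<And>r. r \<ge> 0 \<Longrightarrow> c \<le> cmod (complex_of_real r - l)"
    proof (cases "Im l = 0")
      case True
      then have "l = complex_of_real (Re l)" by (simp add: complex_eq_iff)
      then have "Re l < 0" using l by (metis atLeast_iff image_eqI not_le)
      moreover have "- Re l \<le> cmod (complex_of_real r - l)" if "r \<ge> 0" for r
        using abs_Re_le_cmod[of "complex_of_real r - l"] that by simp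
      ultimately show ?thesis using that[of "- Re l"] by simp
    next
      case False
      have "\<bar>Im l\<bar> \<le> cmod (complex_of_real r - l)" for r
        using abs_Im_le_cmod[of "complex_of_real r - l"] by simp
      then show ?thesis using that[of "\<bar>Im l\<bar>"] False by simp
    qed
    let ?s = "\<lambda>i. (1/2::real) ^ i"
    define k where "k i t = complex_of_real (?s i * t) / (l * (complex_of_real (?s i * t) - l))" for i t
    have nz: "complex_of_real (?s i * t) - l \<noteq> 0" if "t \<in> {0..1}" for i t
      using c(1) c(2)[of "?s i * t"] that by auto
    have k: "k i \<in> cone_fun" for i
      unfolding k_def using nz l0 by (intro cone_funI continuous_intros) auto
    have "norm (\<beta> i (k i)) \<le> ?s i * (1 / (cmod l * c))" for i
    proof (rule cone_hom.norm_le[OF hom k])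
      fix t :: real assume t: "t \<in> {0<..1}"
      have "cmod (k i t) = ?s i * t / (cmod l * cmod (complex_of_real (?s i * t) - l))"
        using t unfolding k_def norm_divide norm_mult[of l] norm_of_real by simp
      also have "\<dots> \<le> ?s i * 1 / (cmod l * c)"
        using t c(1) c(2)[of "?s i * t"] l0 by (intro frac_le mult_left_mono) auto
      finally show "cmod (k i t) \<le> ?s i * (1 / (cmod l * c))" by simp
    qed
    then have "\<exists>N. \<forall>i\<ge>N. norm (\<beta> i (k i)) \<le> ?s i * (1 / (cmod l * c))" by blast
    moreover have "summable (\<lambda>i. ?s i * (1 / (cmod l * c)))"
      by (rule summable_mult2[OF summable_geometric]) simp
    ultimately have "summable (\<lambda>i. \<beta> i (k i))" by (rule summable_comparison_test)
    then obtain w where w: "(\<lambda>i. \<beta> i (k i)) sums w" by (auto simp: summable_def)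
    have bw: "b i * w = b i * \<beta> i (k i)" for i
    proof (rule sums_single_nonzero[OF bounded_linear.sums[OF bounded_linear_mult_right w]])
      show "b i * \<beta> j (k j) = 0" if "j \<noteq> i" for j
        unfolding b_def using that by (intro cone_hom.annihilated_left[OF hom orth k]) simp
    qed
    have wb: "w * b i = \<beta> i (k i) * b i" for i
    proof (rule sums_single_nonzero[OF bounded_linear.sums[OF bounded_linear_mult_left w]])
      show "\<beta> j (k j) * b i = 0" if "j \<noteq> i" for j
        unfolding b_def using that by (intro cone_hom.annihilated_right[OF hom orth k])
    qed
    have comm: "w * b i = b i * w" for i
      unfolding bw wb unfolding b_def by (rule cone_hom.commute[OF hom k cone_fun_id])
    \<comment> \<open>The contribution of index \<open>i\<close> to the equation saying that
      \<open>w\<close> with scalar part \<open>- 1 / l\<close> inverts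
      \<open>total - l\<close>.\<close>
    have term_zero: "?s i *\<^sub>R (b i * w) + (- 1 / l) *\<^sub>C (?s i *\<^sub>R b i) + (- l) *\<^sub>C \<beta> i (k i) = 0" for i
    proof -
      interpret B: cone_hom "\<beta> i" by (rule hom)
      let ?t = complex_of_real
      have "?s i *\<^sub>R (b i * w) + (- 1 / l) *\<^sub>C (?s i *\<^sub>R b i) + (- l) *\<^sub>C \<beta> i (k i)
          = \<beta> i (\<lambda>t. ?t (?s i) * (?t t * k i t) + (- 1 / l) * (?t (?s i) * ?t t) + (- l) * k i t)"
        unfolding bw using k
        by (simp only: B.add B.mult B.scale cone_fun_add cone_fun_mult cone_fun_scale cone_fun_id
            scaleR_scaleC b_def)
      also have "\<dots> = \<beta> i (\<lambda>t. 0)"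
      proof (rule B.cong)
        fix t :: real assume "t \<in> {0<..1}"
        then have "?t (?s i * t) - l \<noteq> 0" by (intro nz) auto
        then have "(?t (?s i * t) - l) * k i t = ?t (?s i * t) / l"
          using l0 by (simp add: k_def)
        then show "?t (?s i) * (?t t * k i t) + (- 1 / l) * (?t (?s i) * ?t t) + (- l) * k i t = 0"
          by (simp add: algebra_simps)
      qed ((rule cone_fun_0 cone_fun_id cone_fun_add cone_fun_scale cone_fun_mult k)+)
      finally show ?thesis by simp
    qed
    have "(\<lambda>i. ?s i *\<^sub>R (b i * w)) sums (total * w)"
      using bounded_linear.sums[OF bounded_linear_mult_left sums_total, of w] by simp
    moreover have "(\<lambda>i. ?s i *\<^sub>R (b i * w)) sums (w * total)"
      using bounded_linear.sums[OF bounded_linear_mult_right sums_total, of w] by (simp add: comm)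
    ultimately have "w * total = total * w"
      and tw: "(\<lambda>i. ?s i *\<^sub>R (b i * w)) sums (total * w)"
      using sums_unique2 by auto
    have "(\<lambda>i. ?s i *\<^sub>R (b i * w) + (- 1 / l) *\<^sub>C (?s i *\<^sub>R b i) + (- l) *\<^sub>C \<beta> i (k i)) sums
        (total * w + (- 1 / l) *\<^sub>C total + (- l) *\<^sub>C w)"
      by (intro sums_add tw bounded_linear.sums[OF bounded_linear_scaleC] sums_total w)
    then have eq: "total * w + (- 1 / l) *\<^sub>C total + (- l) *\<^sub>C w = 0"
      unfolding term_zero using sums_unique2 sums_zero by blast
    have "unitization_mult (total, - l) (w, - 1 / l) = (0, 1)"
      "unitization_mult (w, - 1 / l) (total, - l) = (0, 1)"
      using eq l0 \<open>w * total = total * w\<close> by (simp_all add: unitization_mult_def add_ac)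
    then show ?thesis unfolding spectrum_def by blast
  qed
  then show ?thesis unfolding positive_def using adj_total by blast
qed

text \<open>On either side a square of \<open>b i\<close> is traded for one factor
  \<open>total\<close> at the cost of a scalar \<open>2 ^ i\<close>.\<close>

lemma cube_eq: "b i * b i * b i * y * (b i * b i * b i)
    = 4 ^ i *\<^sub>R (total * (b i * b i * y * b i * b i) * total)"
proof -
  have "b i * b i * b i * y * (b i * b i * b i) = (b i * b i) * (b i * y * b i) * (b i * b i)"
    by (simp only: mult.assoc)
  also have "\<dots> = (2 ^ i *\<^sub>R (total * b i)) * (b i * y * b i) * (2 ^ i *\<^sub>R (b i * total))"
    using b_square by metis
  also have "\<dots> = (2 ^ i * 2 ^ i) *\<^sub>R (total * (b i * b i * y * b i * b i) * total)"
    by (simp add: mult.assoc)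
  finally show ?thesis by (simp flip: power_mult_distrib)
qed

lemma b_in_closedI:
  assumes "closed V" "\<And>y. b i * b i * b i * y * (b i * b i * b i) \<in> V"
  shows "b i \<in> V"
proof -
  have "closure {b i * b i * b i * y * (b i * b i * b i) | y. True} \<subseteq> V"
    using assms by (intro closure_minimal) auto
  then show ?thesis
    using cone_hom.gen_in_closure_cubes[OF hom[of i]] unfolding b_def by blast
qed

lemma b_in_hereditary: "b i \<in> hereditary total"
  by (rule b_in_closedI[OF closed_hereditary])
     (simp only: cube_eq, intro hereditary_scaleR mult_in_hereditary)

lemma total_in_hereditary_if:
  assumes "\<And>i. b i \<in> hereditary a"
  shows "total \<in> hereditary a"
proof -
  have "(\<Sum>i<n. (1/2) ^ i *\<^sub>R b i) \<in> hereditary a" for n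
    by (induction n) (auto intro: hereditary_zero hereditary_add hereditary_scaleR assms)
  then show ?thesis
    by (rule closed_sequentially[OF closed_hereditary _ sums_total[unfolded sums_def]])
qed

lemma total_in_closed_ideal_if:
  assumes I: "closed_ideal UNIV I" and "\<And>i. b i \<in> I"
  shows "total \<in> I"
proof -
  have "(\<Sum>i<n. (1/2) ^ i *\<^sub>R b i) \<in> I" for n
    using assms(2) closed_idealD[OF I]
    by (induction n) (auto simp: scaleR_scaleC)
  then show ?thesis
    by (rule closed_sequentially[OF closed_idealD(1)[OF I] _ sums_total[unfolded sums_def]])
qed

lemma b_in_closed_ideal:
  assumes I: "closed_ideal UNIV I" and "total \<in> I"
  shows "b i \<in> I"
proof -
  have "hereditary total \<subseteq> I"
    using closed_idealD(6)[OF I closed_idealD(6)[OF I assms(2)]]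
    by (intro hereditary_subset_if closed_idealD(1)[OF I])
  then show ?thesis using b_in_hereditary by blast
qed

text \<open>In a unital quotient of \<open>hereditary total\<close> the unit \<open>e\<close> is close to some \<open>total * x * total\<close>,
  whose product with \<open>b i\<close> is of norm \<open>O(2\<^sup>-\<^sup>i)\<close>; hence all but finitely many \<open>b i\<close> vanish there.\<close>

lemma eventually_b_in_ideal:
  assumes I: "closed_ideal (hereditary total) I" and e: "e \<in> hereditary total"
    and unit: "\<And>z. z \<in> hereditary total \<Longrightarrow> z * e - z \<in> I"
  shows "\<exists>N. \<forall>i\<ge>N. b i \<in> I"
proof -
  let ?B = "hereditary total"
  have ID: "closed I" "0 \<in> I" "x \<in> I \<Longrightarrow> y \<in> I \<Longrightarrow> x + y \<in> I" "x \<in> I \<Longrightarrow> c *\<^sub>C x \<in> I"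
    "h \<in> ?B \<Longrightarrow> x \<in> I \<Longrightarrow> x * h \<in> I" "x \<in> I \<Longrightarrow> x \<in> ?B" for x y c h
    using I unfolding closed_ideal_def by auto
  have scaleR: "r *\<^sub>R x \<in> I" if "x \<in> I" for r x
    unfolding scaleR_scaleC using ID(4)[OF that] .
  have minus: "x - y \<in> I" if "x \<in> I" "y \<in> I" for x y
    using ID(3)[OF that(1) scaleR[OF that(2), of "- 1"]] by simp
  obtain x where x: "norm (e - total * x * total) < 1 / 4"
    using e unfolding hereditary_def closure_approachable
    by (auto simp: dist_norm norm_minus_commute dest!: spec[of _ "1/4"])
  define C where "C = norm x * norm total"
  have "(\<lambda>i. (1/2) ^ i * C) \<longlonglongrightarrow> 0"
    by (intro tendsto_mult_left_zero LIMSEQ_realpow_zero) auto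
  then have "eventually (\<lambda>i. (1/2) ^ i * C < 1 / 4) sequentially"
    by (rule order_tendstoD(2)) simp
  then obtain N where N: "\<And>i. i \<ge> N \<Longrightarrow> (1/2) ^ i * C < 1 / 4"
    by (auto simp: eventually_sequentially)
  have "b i \<in> I" if "i \<ge> N" for i
  proof -
    let ?h = "total * x * total" and ?g = "b i * x * total"
    have h: "?h \<in> ?B" by (rule mult_in_hereditary)
    have g: "?g \<in> ?B"
      by (rule hereditary_mult_right[OF b_in_hereditary])
    have norm_g: "norm ((1/2) ^ i *\<^sub>R ?g) \<le> 1 / 4"
    proof -
      have "norm ?g \<le> norm (b i) * norm x * norm total"
        by (meson mult_right_mono norm_ge_zero norm_mult_ineq order_trans)
      also have "\<dots> \<le> 1 * norm x * norm total"
        using norm_b by (intro mult_right_mono) auto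
      finally have "(1/2) ^ i * norm ?g \<le> (1/2) ^ i * C"
        by (intro mult_left_mono) (auto simp: C_def)
      moreover have "norm ((1/2) ^ i *\<^sub>R ?g) = (1/2) ^ i * norm ?g" by simp
      ultimately show ?thesis using N[OF that] by linarith
    qed
    have approx: "\<exists>j\<in>I. norm (b i - j) \<le> (1/2) ^ n * norm (b i)" for n
    proof (induction n)
      case 0
      then show ?case using ID(2) by (intro bexI[of _ 0]) auto
    next
      case (Suc n)
      then obtain j where j: "j \<in> I" "norm (b i - j) \<le> (1/2) ^ n * norm (b i)" by blast
      define r where "r = b i - j"
      \<comment> \<open>Modulo \<open>I\<close> one has \<open>b i = b i * e = b i * v\<close>,
        because \<open>b i * ?h\<close> equals \<open>(1/2) ^ i *\<^sub>R (b i * ?g)\<close>. The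
        two bounds by \<open>1 / 4\<close> give \<open>v\<close> norm at most \<open>1 / 2\<close>,
        so each round halves the distance to \<open>I\<close>; \<open>j'\<close> collects the
        corrections.\<close>
      define v where "v = (e - ?h) + (1/2) ^ i *\<^sub>R ?g"
      define j' where "j' = j * e - (b i * e - b i) + ((1/2) ^ i *\<^sub>R (j * ?g) - j * ?h)"
      have bh: "b i * ?h = (1/2) ^ i *\<^sub>R (b i * ?g)"
      proof -
        have "b i * ?h = (b i * total) * x * total" by (simp only: mult.assoc)
        then show ?thesis by (simp add: b_mult_total mult.assoc)
      qed
      have "r * v = r * e - b i * ?h + j * ?h + (1/2) ^ i *\<^sub>R (b i * ?g) - (1/2) ^ i *\<^sub>R (j * ?g)"
        by (simp add: r_def v_def algebra_simps)
      then have "b i - j' = r * v"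
        unfolding bh by (simp add: r_def j'_def algebra_simps)
      moreover have "norm (r * v) \<le> norm r * (1 / 4 + 1 / 4)"
      proof -
        have "norm v \<le> 1 / 4 + 1 / 4"
          unfolding v_def using x norm_g by (intro norm_triangle_mono) auto
        then show ?thesis
          by (meson mult_left_mono norm_ge_zero norm_mult_ineq order_trans)
      qed
      ultimately have "norm (b i - j') \<le> (1/2) ^ Suc n * norm (b i)"
        using j(2) by (simp add: r_def)
      moreover have "j' \<in> I"
        unfolding j'_def using j(1) e h g b_in_hereditary
        by (intro ID(3) minus scaleR ID(5) unit)
      ultimately show ?case by blast
    qed
    have "b i \<in> closure I"
      unfolding closure_approachable
    proof (intro allI impI)
      fix \<epsilon> :: real assume "\<epsilon> > 0"
      have "(\<lambda>n. (1/2) ^ n * norm (b i)) \<longlonglongrightarrow> 0"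
        by (intro tendsto_mult_left_zero LIMSEQ_realpow_zero) auto
      then have "eventually (\<lambda>n. (1/2) ^ n * norm (b i) < \<epsilon>) sequentially"
        using \<open>\<epsilon> > 0\<close> by (rule order_tendstoD(2))
      then obtain n where "(1/2) ^ n * norm (b i) < \<epsilon>" by (auto simp: eventually_sequentially)
      then show "\<exists>j\<in>I. dist j (b i) < \<epsilon>"
        using approx[of n] by (metis dist_commute dist_norm order_le_less_trans)
    qed
    then show ?thesis using ID(1) by simp
  qed
  then show ?thesis by blast
qed

text \<open>\<open>I\<close> is an ideal of the hereditary subalgebra only, whereas
  \<open>cofinal\<close> speaks of ideals of the whole algebra. The bridge is \<open>J\<close>, the
  ideal of all elements that land in \<open>I\<close> when placed between \<open>total * p\<close>
  and \<open>q * total\<close>.\<close>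

lemma ideal_eq_if_eventually:
  assumes I: "closed_ideal (hereditary total) I" and N: "\<And>i. i \<ge> N \<Longrightarrow> b i \<in> I"
  shows "I = hereditary total"
proof -
  let ?B = "hereditary total"
  have ID: "closed I" "0 \<in> I" "x \<in> I \<Longrightarrow> y \<in> I \<Longrightarrow> x + y \<in> I" "x \<in> I \<Longrightarrow> c *\<^sub>C x \<in> I"
    "h \<in> ?B \<Longrightarrow> x \<in> I \<Longrightarrow> h * x \<in> I" "h \<in> ?B \<Longrightarrow> x \<in> I \<Longrightarrow> x * h \<in> I" "I \<subseteq> ?B" for x y c h
    using I unfolding closed_ideal_def by auto
  define J where "J = {y. \<forall>p q. (total * p) * y * (q * total) \<in> I}"
  have J: "closed_ideal UNIV J"
    unfolding closed_ideal_def
  proof (intro conjI ballI allI)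
    have "J = (\<Inter>p q. {y. (total * p) * y * (q * total) \<in> I})" by (auto simp: J_def)
    then show "closed J" by (auto intro!: closed_INT closed_vimage_mult ID(1))
    show "x + y \<in> J" if "x \<in> J" "y \<in> J" for x y
      using that ID(3) by (simp add: J_def distrib_left distrib_right)
    show "c *\<^sub>C x \<in> J" if "x \<in> J" for c x
      using that ID(4) by (simp add: J_def mult_scaleC_left mult_scaleC_right)
    fix y x assume x: "x \<in> J"
    have "(total * (p * y)) * x * (q * total) \<in> I" "(total * p) * x * ((y * q) * total) \<in> I" for p q
      using x unfolding J_def by blast+
    then show "y * x \<in> J" "x * y \<in> J" by (simp_all add: J_def mult.assoc)
  qed (simp_all add: J_def ID(2))
  have "b i \<in> J" if "i \<ge> N" for i
  proof (rule b_in_closedI[OF closed_idealD(1)[OF J]])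
    fix y
    show "b i * b i * b i * y * (b i * b i * b i) \<in> J"
      unfolding J_def
    proof (intro CollectI allI)
      fix p q
      let ?b = "b i"
      \<comment> \<open>Of the three leading factors the first brings \<open>total * p\<close> into
        the hereditary subalgebra, the second is the element of \<open>I\<close>, and the third does
        for the right end what the first does for the left.\<close>
      have "total * p * ?b \<in> ?B" by (rule hereditary_mult_left[OF b_in_hereditary])
      moreover have "?b * (y * ?b * ?b * ?b * q) * total \<in> ?B"
        by (rule hereditary_mult_right[OF b_in_hereditary])
      ultimately have "(total * p * ?b) * ?b * (?b * (y * ?b * ?b * ?b * q) * total) \<in> I"
        using N[OF that] by (intro ID(6) ID(5))
      then show "(total * p) * (?b * ?b * ?b * y * (?b * ?b * ?b)) * (q * total) \<in> I"
        by (simp only: mult.assoc)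
    qed
  qed
  then have "b i \<in> J" for i
    using cofinal[of N i] J unfolding b_def by blast
  then have total: "total \<in> J"
    by (rule total_in_closed_ideal_if[OF J])
  have "hereditary total \<subseteq> I"
  proof (rule hereditary_subset_if[OF ID(1)])
    fix x
    \<comment> \<open>\<open>total \<in> J\<close> only gives products with an extra
      \<open>total\<close> in the middle. It is removed by a limit, since \<open>total\<close> lies
      in its own hereditary subalgebra.\<close>
    have "hereditary total \<subseteq> {v. (total * x) * v \<in> I}"
    proof (intro hereditary_subset_if closed_vimage_mult_left ID(1), rule CollectI)
      fix y
      have "(total * x) * total * (y * total) \<in> I" using total unfolding J_def by blast
      then show "(total * x) * (total * y * total) \<in> I" by (simp only: mult.assoc)
    qed
    then show "total * x * total \<in> I"
      using total_in_hereditary_if[OF b_in_hereditary] by blast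
  qed
  then show ?thesis using ID(7) by blast
qed

lemma soft_total: "soft_element total"
  unfolding soft_element_def soft_algebra_def
proof (intro conjI allI impI positive_total notI)
  fix I assume I: "closed_ideal (hereditary total) I \<and> I \<noteq> hereditary total"
    and "quotient_unital (hereditary total) I"
  then obtain E where E: "E \<in> coset I ` hereditary total"
    "\<forall>X\<in>coset I ` hereditary total. quotient_mult I E X = X \<and> quotient_mult I X E = X"
    unfolding quotient_unital_def quotient_carrier_def by (elim bexE)
  from E(1) obtain e where "e \<in> hereditary total" "E = coset I e" by (elim imageE)
  with E(2) have e: "e \<in> hereditary total"
    "\<And>z. z \<in> hereditary total \<Longrightarrow> quotient_mult I (coset I z) (coset I e) = coset I z"
    by simp_all
  \<comment> \<open>As \<open>0 \<in> I\<close>, the product of the cosets of \<open>z\<close> and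
    \<open>e\<close> contains \<open>z * e\<close>, so the unit law becomes a relation modulo
    \<open>I\<close>.\<close>
  have "z * e - z \<in> I" if "z \<in> hereditary total" for z
  proof -
    have "0 \<in> I" using I by (simp add: closed_ideal_def)
    then have "z \<in> coset I z" "e \<in> coset I e" "z * e \<in> coset I (z * e)"
      by (force simp: coset_def)+
    then have "z * e \<in> quotient_mult I (coset I z) (coset I e)"
      unfolding quotient_mult_def by blast
    then show ?thesis using e(2)[OF that] by (auto simp: coset_def)
  qed
  then show False
    using eventually_b_in_ideal[of I e] ideal_eq_if_eventually[of I] I e(1) by blast
qed

end

section \<open>Abundance of soft elements\<close>

text \<open>\<open>bump i\<close> is \<open>t\<close> times the tent of radius 1 around \<open>i + 1\<close> in the variable \<open>1 / t\<close>. Tents of the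
  same parity are disjoint, and all tents together cover the half-open interval.\<close>

definition bump :: "nat \<Rightarrow> real \<Rightarrow> real" where
  "bump i t = max 0 (t - \<bar>1 - real (i + 1) * t\<bar>)"

lemma continuous_on_bump: "continuous_on S (bump i)"
  unfolding bump_def by (intro continuous_intros)

lemma bump_range: "t \<in> {0..1} \<Longrightarrow> bump i t \<in> {0..1}"
  unfolding bump_def by auto

lemma bump_zero [simp]: "bump i 0 = 0"
  by (simp add: bump_def)

text \<open>For positive \<open>t\<close>, \<open>bump i t\<close> is nonzero exactly when
  \<open>i < 1 / t < i + 2\<close>.\<close>

lemma bump_disjoint:
  assumes "i + 2 \<le> j" "t \<in> {0..1}"
  shows "bump i t * bump j t = 0"
proof (rule ccontr)
  assume "bump i t * bump j t \<noteq> 0"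
  then have pos: "\<bar>1 - real (i + 1) * t\<bar> < t" "\<bar>1 - real (j + 1) * t\<bar> < t"
    by (auto simp: bump_def max_def split: if_splits)
  then have "1 < real (i + 2) * t" "real j * t < 1"
    by (auto simp: algebra_simps abs_less_iff)
  moreover have "real (i + 2) * t \<le> real j * t"
    using assms by (intro mult_right_mono) auto
  ultimately show False by simp
qed

text \<open>The tent centred at the integer nearest to \<open>1 / t\<close> has height at least
  \<open>1 / 2\<close> there, so \<open>bump i t \<ge> t / 2\<close>. Moreover
  \<open>1 / t \<le> i + 3 / 2\<close>, which turns this into a threshold depending on
  \<open>i\<close> alone; 4 in place of 3 makes it strict.\<close>

lemma bump_cover:
  assumes t: "t \<in> {0<..1}"
  obtains i where "1 / real (2 * i + 4) < bump i t"
proof -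
  define m where "m = round (1 / t)"
  have m: "\<bar>1 / t - of_int m\<bar> \<le> 1 / 2"
    unfolding m_def by (subst abs_minus_commute) (rule of_int_round_abs_le)
  have "1 \<le> 1 / t" using t by simp
  then have "m \<ge> 1" using m by linarith
  define i where "i = nat (m - 1)"
  have mi: "of_int m = real (i + 1)" using \<open>m \<ge> 1\<close> by (simp add: i_def)
  have "1 - real (i + 1) * t = t * (1 / t - of_int m)"
    using t by (simp add: mi field_simps)
  then have "\<bar>1 - real (i + 1) * t\<bar> = t * \<bar>1 / t - of_int m\<bar>"
    using t by (simp add: abs_mult)
  also have "\<dots> \<le> t * (1 / 2)"
    using m t by (intro mult_left_mono) auto
  finally have half: "\<bar>1 - real (i + 1) * t\<bar> \<le> t / 2" by simp
  then have "t / 2 \<le> bump i t" unfolding bump_def by linarith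
  moreover have "1 - real (i + 1) * t \<le> t / 2" using half by linarith
  then have "2 \<le> real (2 * i + 3) * t" by (simp add: algebra_simps)
  then have "1 < real (2 * i + 4) * (t / 2)" using t by (simp add: algebra_simps)
  then have "1 / real (2 * i + 4) < t / 2" by (simp add: divide_less_eq mult.commute)
  ultimately show ?thesis using that[of i] by simp
qed

lemma soft_element_if_global_glimm:
  fixes a :: "'a::cstar_algebra"
  assumes ggp: "global_glimm_property TYPE('a)" and "positive a" "\<epsilon> > 0"
  shows "\<exists>b. b \<in> hereditary a \<and> soft_element b \<and> cut_down a \<epsilon> \<in> ideal_generated {b}"
proof -
  let ?t = complex_of_real
  obtain \<psi> where \<psi>: "matrix_cone_hom \<psi>"
    and her: "\<forall>i<2. \<forall>j<2. \<forall>F\<in>cone_fun. \<psi> i j F \<in> hereditary a"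
    and gen: "\<And>I. closed_ideal UNIV I \<Longrightarrow> \<forall>i<2. \<forall>j<2. \<forall>F\<in>cone_fun. \<psi> i j F \<in> I \<Longrightarrow> cut_down a \<epsilon> \<in> I"
    using global_glimm_matrix_cone_hom[OF assms] by blast
  interpret P: matrix_cone_hom \<psi> by fact
  \<comment> \<open>The corner alternates with the parity of \<open>i\<close>, so distinct indices
    in the same corner differ by at least 2.\<close>
  define \<theta> where "\<theta> i F = \<psi> (i mod 2) (i mod 2) (\<lambda>t. F (bump i t))" for i F
  \<comment> \<open>The threshold above which the bumps still cover the half-open interval.\<close>
  define \<delta> where "\<delta> i = 1 / real (2 * i + 4)" for i
  have \<delta>: "\<delta> i > 0" for i by (simp add: \<delta>_def)
  have bump_fun: "(\<lambda>t. F (bump i t)) \<in> cone_fun" if "F \<in> cone_fun" for F i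
    by (rule cone_fun_compose[OF that continuous_on_bump bump_zero bump_range])
  have \<theta>: "cone_hom (\<theta> i)" for i
    unfolding \<theta>_def
    by (rule cone_hom.cone_hom_compose[OF P.cone_hom_diagonal continuous_on_bump bump_zero bump_range]) auto
  have \<theta>_orth: "\<theta> i ?t * \<theta> j ?t = 0" if "i \<noteq> j" for i j
  proof (cases "i mod 2 = j mod 2")
    case True
    have "i + 2 \<le> j \<or> j + 2 \<le> i" using True that by presburger
    then have "bump i t * bump j t = 0" if "t \<in> {0<..1}" for t
      using that bump_disjoint[of i j t] bump_disjoint[of j i t, folded mult.commute[of "bump i t"]]
      by (elim disjE) simp_all
    then have "\<psi> (i mod 2) (i mod 2) (\<lambda>t. ?t (bump i t) * ?t (bump j t)) = \<psi> (i mod 2) (i mod 2) (\<lambda>t. 0)"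
      using bump_fun[OF cone_fun_id] by (intro P.cong cone_fun_mult) (simp_all flip: of_real_mult)
    then show ?thesis
      using True bump_fun[OF cone_fun_id] by (simp add: \<theta>_def P.mult P.zero)
  next
    case False
    then show ?thesis using bump_fun[OF cone_fun_id] by (simp add: \<theta>_def P.mult)
  qed
  have "\<exists>\<beta>. (\<forall>n. cone_hom (\<beta> n)) \<and> (\<forall>n. \<beta> n ?t \<in> hereditary (\<theta> i ?t)) \<and>
      (\<forall>m n. m \<noteq> n \<longrightarrow> \<beta> m ?t * \<beta> n ?t = 0) \<and>
      (\<forall>I. closed_ideal UNIV I \<longrightarrow> \<beta> (0::nat) ?t \<in> I \<longrightarrow> \<theta> i (cut (\<delta> i)) \<in> I) \<and>
      (\<forall>I m n. closed_ideal UNIV I \<longrightarrow> m \<le> n \<longrightarrow> \<beta> n ?t \<in> I \<longrightarrow> \<beta> m ?t \<in> I)" for i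
    by (rule ladder[OF ggp \<theta>[of i] \<delta>[of i]]) blast
  then obtain \<beta> where \<beta>: "\<And>i n. cone_hom (\<beta> i n)" "\<And>i n. \<beta> i n ?t \<in> hereditary (\<theta> i ?t)"
    "\<And>i m n. m \<noteq> n \<Longrightarrow> \<beta> i m ?t * \<beta> i n ?t = 0"
    "\<And>i I. closed_ideal UNIV I \<Longrightarrow> \<beta> i (0::nat) ?t \<in> I \<Longrightarrow> \<theta> i (cut (\<delta> i)) \<in> I"
    "\<And>i I m n. closed_ideal UNIV I \<Longrightarrow> m \<le> n \<Longrightarrow> \<beta> i n ?t \<in> I \<Longrightarrow> \<beta> i m ?t \<in> I"
    by metis
  \<comment> \<open>The rows are merged into one sequence; row \<open>i\<close> lies below bump
    \<open>i\<close>.\<close>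
  define \<gamma> where "\<gamma> m = case_prod \<beta> (prod_decode m)" for m
  have \<gamma>_encode: "\<gamma> (prod_encode (i, n)) = \<beta> i n" for i n by (simp add: \<gamma>_def)
  have \<gamma>_cases: "\<exists>i n. m = prod_encode (i, n)" for m
    by (metis prod_decode_inverse surj_pair)
  interpret O: orthogonal_sequence \<gamma>
  proof (rule orthogonal_sequence.intro)
    fix m N :: nat
    obtain i n where m: "m = prod_encode (i, n)" using \<gamma>_cases by blast
    show "cone_hom (\<gamma> m)" unfolding m \<gamma>_encode by (rule \<beta>)
    \<comment> \<open>The witness for \<open>cofinal\<close> stays in row \<open>i\<close>, where
      the ideals grow with the second index; the code of a pair is at least its second
      component.\<close>
    have "prod_encode (i, max n N) \<ge> N"
      using le_prod_encode_2[of "max n N" i] by linarith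
    then show "\<exists>j\<ge>N. \<forall>I. closed_ideal UNIV I \<longrightarrow> \<gamma> j ?t \<in> I \<longrightarrow> \<gamma> m ?t \<in> I"
      unfolding m using \<beta>(5)[of _ n "max n N" i]
      by (intro exI[of _ "prod_encode (i, max n N)"]) (simp add: \<gamma>_encode)
    fix m' assume "m \<noteq> m'"
    moreover obtain i' n' where m': "m' = prod_encode (i', n')" using \<gamma>_cases by blast
    ultimately consider "i \<noteq> i'" | "i = i'" "n \<noteq> n'" using m by auto
    then show "\<gamma> m ?t * \<gamma> m' ?t = 0"
      unfolding m m' \<gamma>_encode
    proof cases
      case 1
      then have "\<theta> i ?t * \<beta> i' n' ?t = 0"
        using hereditary_annihilated_left[OF \<theta>_orth \<beta>(2)] by blast
      then show "\<beta> i n ?t * \<beta> i' n' ?t = 0"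
        using hereditary_annihilated_right[OF _ \<beta>(2)] by blast
    next
      case 2
      then show "\<beta> i n ?t * \<beta> i' n' ?t = 0" using \<beta>(3) by blast
    qed
  qed
  have "O.b m \<in> hereditary a" for m
  proof -
    obtain i n where m: "m = prod_encode (i, n)" using \<gamma>_cases by blast
    have "\<theta> i ?t \<in> hereditary a"
      using her bump_fun[OF cone_fun_id] by (simp add: \<theta>_def)
    then show ?thesis
      unfolding O.b_def m \<gamma>_encode using hereditary_mono \<beta>(2) by blast
  qed
  then have "O.total \<in> hereditary a" by (rule O.total_in_hereditary_if)
  moreover have "cut_down a \<epsilon> \<in> ideal_generated {O.total}"
  proof (rule in_ideal_generatedI)
    fix I assume I: "closed_ideal UNIV I" "{O.total} \<subseteq> I"
    have cut_mem: "(\<lambda>t. cut (\<delta> i) (bump i t)) \<in> cone_fun" for i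
      using \<delta>[of i] by (intro bump_fun cone_fun_cut) simp
    have "\<beta> i 0 ?t \<in> I" for i
      using O.b_in_closed_ideal[OF I(1), of "prod_encode (i, 0)"] I(2) by (simp add: O.b_def \<gamma>_encode)
    then have "\<theta> i (cut (\<delta> i)) \<in> I" for i by (rule \<beta>(4)[OF I(1)])
    then have mem: "\<psi> (i mod 2) (i mod 2) (\<lambda>t. cut (\<delta> i) (bump i t)) \<in> I" for i by (simp add: \<theta>_def)
    \<comment> \<open>All bumps are brought into one corner, because supports are compared with a
      single entry.\<close>
    have diag: "\<psi> 0 0 (\<lambda>t. cut (\<delta> i) (bump i t)) \<in> I" for i
      using mem[of i] cut_mem[of i]
      by (intro P.entry_in_closed_ideal[of 0 0 "i mod 2" "i mod 2" I] I(1)) auto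
    have "\<psi> i j F \<in> I" if "i < 2" "j < 2" "F \<in> cone_fun" for i j F
    proof (rule P.entry_in_closed_ideal[of i j 0 0 I F])
      fix t :: real assume "t \<in> {0<..1}"
      then obtain m where "\<delta> m < bump m t" using bump_cover unfolding \<delta>_def by blast
      then show "\<exists>G\<in>cone_fun. \<psi> 0 0 G \<in> I \<and> G t \<noteq> 0"
        using diag[of m] cut_mem[of m] by (intro bexI[of _ "\<lambda>t. cut (\<delta> m) (bump m t)"]) (auto simp: cut_nonzero_iff)
    qed (use that I in auto)
    then show "cut_down a \<epsilon> \<in> I" by (intro gen[OF I(1)]) blast
  qed
  ultimately show ?thesis using O.soft_total by blast
qed

theorem proposition7p7:
  shows "(two_omega_divisible TYPE('s::cu_semigroup) \<and> satisfies_O5 TYPE('s) \<longrightarrow>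
            (\<forall>(x::'s) (k::nat). \<exists>y. strongly_soft y \<and> k \<cdot>\<^sub>N y \<le> x \<and> x \<le> \<infinity>\<cdot> y) \<and>
            abundance_of_strongly_soft_elements TYPE('s)) \<and>
         (global_glimm_property TYPE('a::cstar_algebra) \<longrightarrow> abundance_of_soft_elements TYPE('a))"
proof (intro conjI impI)
  assume "two_omega_divisible TYPE('s) \<and> satisfies_O5 TYPE('s)"
  then have *: "\<exists>y. strongly_soft y \<and> k \<cdot>\<^sub>N y \<le> x \<and> x \<le> \<infinity>\<cdot> y" for x :: 's and k
    using strongly_soft_full_divisor[of k x] by blast
  then show "\<forall>(x::'s) k. \<exists>y. strongly_soft y \<and> k \<cdot>\<^sub>N y \<le> x \<and> x \<le> \<infinity>\<cdot> y" by blast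
  show "abundance_of_strongly_soft_elements TYPE('s)"
    unfolding abundance_of_strongly_soft_elements_def
  proof (intro allI impI)
    fix x' x :: 's
    assume "x' \<lless> x"
    then have le: "x' \<le> x" by (rule way_below_imp_le)
    obtain y where "strongly_soft y" "1 \<cdot>\<^sub>N y \<le> x" "x \<le> \<infinity>\<cdot> y" using * by blast
    then show "\<exists>y. strongly_soft y \<and> x' \<le> \<infinity>\<cdot> y \<and> y \<le> x"
      using order_trans[OF le] by auto
  qed
next
  assume "global_glimm_property TYPE('a)"
  then show "abundance_of_soft_elements TYPE('a)"
    unfolding abundance_of_soft_elements_def using soft_element_if_global_glimm by blast
qed

end
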